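(* Let $n\ge3$. For every $\gamma>1/2$, there exist a bounded, smooth, uniformly strictly convex domain $\Omega_\gamma\subset\mathbb R^n$ and a smooth function $u_\gamma$ on $\Omega_\gamma$, with $\Gamma_2$-admissible graph and $u_\gamma<0$ in $\Omega_\gamma$, satisfying $$\sigma_2(\kappa[u_\gamma])=(1+|Du_\gamma|^2)^{-2}\quad\text{in }\Omega_\gamma,\qquad u_\gamma=0\quad\text{on }\partial\Omega_\gamma,$$ such that $(-u_\gamma)^\gamma$ is not concave in $\Omega_\gamma$. Consequently, the exponent $1/2$ in the assertion that $(-u)^{1/2}$ is concave for all $\Gamma_2$-admissible solutions $u$ of this Dirichlet problem on bounded smooth uniformly convex domains is optimal among universal power-concavity exponents, i.e. it cannot be replaced by any exponent $\gamma>1/2$.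
   Context: For a function $u$ on $\Omega\subset\mathbb R^n$, $\kappa[u]=(\kappa_1[u],\ldots,\kappa_n[u])$ denotes the principal curvatures of the graph $\{(x,u(x)):x\in\Omega\}\subset\mathbb R^{n+1}$, i.e. the eigenvalues of the symmetric matrix $$\frac{1}{\sqrt{1+|Du|^2}}\,(I+Du\otimes Du)^{-1/2}\,D^2u\,(I+Du\otimes Du)^{-1/2}.$$ For $\lambda\in\mathbb R^n$, $\sigma_1(\lambda)=\sum_i\lambda_i$ and $\sigma_2(\lambda)=\sum_{i<j}\lambda_i\lambda_j$. The Gårding cone is $\Gamma_2=\{\lambda\in\mathbb R^n:\sigma_1(\lambda)>0,\ \sigma_2(\lambda)>0\}$. The graph of $u$ is called $\Gamma_2$-admissible if $\kappa[u](x)\in\Gamma_2$ at every point $x$. A smooth bounded domain is uniformly (strictly) convex if all principal curvatures of its boundary are bounded below by a positive constant. *)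

theory Defs
  imports "HOL-Analysis.Analysis"
begin

definition partial_deriv :: "'n::finite \<Rightarrow> (real ^ 'n \<Rightarrow> real) \<Rightarrow> real ^ 'n \<Rightarrow> real" where
  "partial_deriv i f x = frechet_derivative f (at x) (axis i 1)"

definition grad :: "(real ^ 'n::finite \<Rightarrow> real) \<Rightarrow> real ^ 'n \<Rightarrow> real ^ 'n" where
  "grad f x = (\<chi> i. partial_deriv i f x)"

definition hessian :: "(real ^ 'n::finite \<Rightarrow> real) \<Rightarrow> real ^ 'n \<Rightarrow> real ^ 'n ^ 'n" where
  "hessian f x = (\<chi> i j. partial_deriv j (partial_deriv i f) x)"

text \<open>The next two notions are only used for open \<open>S\<close>.\<close>

primrec Ck_on :: "nat \<Rightarrow> (real ^ 'n::finite \<Rightarrow> real) \<Rightarrow> (real ^ 'n) set \<Rightarrow> bool" where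
  "Ck_on 0 f S \<longleftrightarrow> continuous_on S f"
| "Ck_on (Suc k) f S \<longleftrightarrow> f differentiable_on S \<and> (\<forall>i. Ck_on k (partial_deriv i f) S)"

definition smooth_on :: "(real ^ 'n::finite \<Rightarrow> real) \<Rightarrow> (real ^ 'n) set \<Rightarrow> bool" where
  "smooth_on f S \<longleftrightarrow> (\<forall>k. Ck_on k f S)"


definition pos_definite :: "real ^ 'n::finite ^ 'n \<Rightarrow> bool" where
  "pos_definite A \<longleftrightarrow> transpose A = A \<and> (\<forall>v. v \<noteq> 0 \<longrightarrow> 0 < v \<bullet> (A *v v))"

text \<open>\<open>A\<^sup>-\<^sup>1\<^sup>/\<^sup>2\<close>, for positive definite \<open>A\<close>.\<close>

definition inv_sqrt_matrix :: "real ^ 'n::finite ^ 'n \<Rightarrow> real ^ 'n ^ 'n" where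
  "inv_sqrt_matrix A = (THE B. pos_definite B \<and> B ** B = matrix_inv A)"

text \<open>The eigenvalues listed with algebraic multiplicity. They exist whenever \<open>A\<close> is symmetric and
  are unique up to order; below they only enter through symmetric functions.\<close>

definition eigenvalue_vector :: "real ^ 'n::finite ^ 'n \<Rightarrow> real ^ 'n" where
  "eigenvalue_vector A = (SOME l. \<forall>t. det (mat t - A) = (\<Prod>i\<in>UNIV. t - l $ i))"

definition graph_curvature_matrix :: "(real ^ 'n::finite \<Rightarrow> real) \<Rightarrow> real ^ 'n \<Rightarrow> real ^ 'n ^ 'n" where
  "graph_curvature_matrix u x =
     (let p = grad u x;
          B = inv_sqrt_matrix (mat 1 + (\<chi> i j. p $ i * p $ j))
      in (1 / sqrt (1 + (norm p)\<^sup>2)) *\<^sub>R (B ** hessian u x ** B))"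

definition graph_curvatures :: "(real ^ 'n::finite \<Rightarrow> real) \<Rightarrow> real ^ 'n \<Rightarrow> real ^ 'n" where
  "graph_curvatures u x = eigenvalue_vector (graph_curvature_matrix u x)"

definition sigma1 :: "real ^ 'n::finite \<Rightarrow> real" where
  "sigma1 l = (\<Sum>i\<in>UNIV. l $ i)"

text \<open>The two-element sets \<open>S\<close> stand for the pairs \<open>i < j\<close>: the index type carries no order.\<close>

definition sigma2 :: "real ^ 'n::finite \<Rightarrow> real" where
  "sigma2 l = (\<Sum>S | card S = 2. \<Prod>i\<in>S. l $ i)"

definition Gamma2 :: "(real ^ 'n::finite) set" where
  "Gamma2 = {l. 0 < sigma1 l \<and> 0 < sigma2 l}"

definition Gamma2_admissible :: "(real ^ 'n::finite) set \<Rightarrow> (real ^ 'n \<Rightarrow> real) \<Rightarrow> bool" where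
  "Gamma2_admissible \<Omega> u \<longleftrightarrow> (\<forall>x\<in>\<Omega>. graph_curvatures u x \<in> Gamma2)"


text \<open>Since the gradient does not vanish on \<open>U\<close>, the zero set of \<open>\<rho>\<close> in \<open>U\<close> is a smooth hypersurface,
  it equals \<open>frontier \<Omega> \<inter> U\<close>, and \<open>\<Omega>\<close> lies on one side of it, so \<open>grad \<rho>\<close> points outward.\<close>

definition local_defining_function ::
  "(real ^ 'n::finite) set \<Rightarrow> real ^ 'n \<Rightarrow> (real ^ 'n) set \<Rightarrow> (real ^ 'n \<Rightarrow> real) \<Rightarrow> bool" where
  "local_defining_function \<Omega> p U \<rho> \<longleftrightarrow>
     open U \<and> p \<in> U \<and> smooth_on \<rho> U \<and> (\<forall>x\<in>U. grad \<rho> x \<noteq> 0) \<and> \<Omega> \<inter> U = {x\<in>U. \<rho> x < 0}"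

definition bounded_smooth_domain :: "(real ^ 'n::finite) set \<Rightarrow> bool" where
  "bounded_smooth_domain \<Omega> \<longleftrightarrow>
     open \<Omega> \<and> connected \<Omega> \<and> \<Omega> \<noteq> {} \<and> bounded \<Omega> \<and>
     (\<forall>p\<in>frontier \<Omega>. \<exists>U \<rho>. local_defining_function \<Omega> p U \<rho>)"

text \<open>\<open>k\<close> is an eigenvalue of the Weingarten map at \<open>p\<close> of the level set of \<open>\<rho>\<close> through \<open>p\<close>, i.e. of
  the differential, on the tangent space, of the unit normal pointing towards larger \<open>\<rho>\<close>. Spheres
  bounding balls have positive curvatures.\<close>

definition level_set_curvature :: "(real ^ 'n::finite \<Rightarrow> real) \<Rightarrow> real ^ 'n \<Rightarrow> real \<Rightarrow> bool" where
  "level_set_curvature \<rho> p k \<longleftrightarrow>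
     (\<exists>v. v \<noteq> 0 \<and> v \<bullet> grad \<rho> p = 0 \<and>
        frechet_derivative (\<lambda>x. grad \<rho> x /\<^sub>R norm (grad \<rho> x)) (at p) v = k *\<^sub>R v)"

text \<open>The curvatures at \<open>p\<close> do not depend on the local defining function: on the boundary the
  normalised gradient is always the outward unit normal, and only its tangential derivatives enter.
  For a bounded smooth domain \<open>convex \<Omega>\<close> follows from the curvature bound; it is listed because
  \<^const>\<open>concave_on\<close> demands convexity of the set, and a failure of concavity must not come from there.\<close>

definition uniformly_convex_domain :: "(real ^ 'n::finite) set \<Rightarrow> bool" where
  "uniformly_convex_domain \<Omega> \<longleftrightarrow>
     convex \<Omega> \<and>
     (\<exists>c>0. \<forall>p\<in>frontier \<Omega>. \<exists>U \<rho>. local_defining_function \<Omega> p U \<rho> \<and>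
        (\<forall>k. level_set_curvature \<rho> p k \<longrightarrow> c \<le> k))"


text \<open>Continuity on the closure gives the boundary condition its meaning.\<close>

definition admissible_solution :: "(real ^ 'n::finite) set \<Rightarrow> (real ^ 'n \<Rightarrow> real) \<Rightarrow> bool" where
  "admissible_solution \<Omega> u \<longleftrightarrow>
     smooth_on u \<Omega> \<and> continuous_on (closure \<Omega>) u \<and> Gamma2_admissible \<Omega> u \<and>
     (\<forall>x\<in>\<Omega>. sigma2 (graph_curvatures u x) = (1 + (norm (grad u x))\<^sup>2) powi (-2)) \<and>
     (\<forall>x\<in>frontier \<Omega>. u x = 0)"

text \<open>The type argument fixes the dimension.\<close>

definition universal_power_concavity_exponent :: "'n::finite itself \<Rightarrow> real \<Rightarrow> bool" where
  "universal_power_concavity_exponent _ \<gamma> \<longleftrightarrow>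
     (\<forall>(\<Omega> :: (real ^ 'n) set) u.
        bounded_smooth_domain \<Omega> \<and> uniformly_convex_domain \<Omega> \<and> admissible_solution \<Omega> u \<longrightarrow>
        concave_on \<Omega> (\<lambda>x. (- u x) powr \<gamma>))"

end

theory Submission
  imports Defs
begin

text \<open>Near the tip of a narrow cone an admissible solution is almost homogeneous of degree two, and then
  \<open>(-u)\<^sup>\<gamma>\<close> is convex along the axis for \<open>\<gamma> > 1/2\<close>. To have exact solutions on domains of this shape, write
  \<open>u(x) = e V(x\<^sub>1, |x'| / sqrt e)\<close>. For \<open>e = 0\<close> the equation for \<open>V(x, r)\<close> is solved by
  \<open>c (r\<^sup>2 / 2 - q(x))\<close> with arbitrary \<open>q\<close>, and for small \<open>e > 0\<close> a solution with the same values on the axis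
  \<open>r = 0\<close> is a fixed point of a contraction, in the spirit of the Cauchy--Kovalevskaya theorem: in a Banach
  algebra of power series with weights \<open>3\<^sup>j\<^sup>+\<^sup>k j! k! / (j + k)!\<close> the inverse of \<open>W\<^sub>r\<^sub>r + (n - 2) W\<^sub>r / r\<close> stays bounded
  after two further \<open>x\<close>-derivatives.

  The domain is the set \<open>{u < 0}\<close> for \<open>q(x) = x (x - d) (1 - x)\<close>. At \<open>e = 0\<close> the function \<open>V / x\<close> is
  \<open>c (r\<^sup>2 / (2 x) - (x - d) (1 - x))\<close>, which is uniformly convex, and this persists for small \<open>e\<close>; so \<open>u / x\<^sub>1\<close>
  is a convex defining function. On the axis \<open>-u\<close> is a multiple of \<open>q\<close>, which is close to \<open>x\<^sup>2\<close> for
  \<open>d << x << 1\<close>, so \<open>(-u)\<^sup>\<gamma>\<close> is not concave once \<open>d\<close> is small.\<close>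

section \<open>Curvatures of graphs\<close>

text \<open>The thinness \<open>e\<close> of the domain is the perturbation parameter. In the
  rescaled variables every term with an x-derivative carries a power of \<open>e\<close>; at
  \<open>e = 0\<close> there remains \<open>sigma2\<close> of the Hessian of V in the n - 1
  transverse variables, set equal to 1. This is where n >= 3 enters: for n = 2 that expression is
  zero. Its linearisation is a multiple of the radial Laplacian in n - 1 variables, while the
  correction contains V_xx, so each iteration loses two x-derivatives and no norm with finitely many
  derivatives would do. Prescribing V on the axis instead of on a boundary has two benefits: the
  boundary is read off afterwards as the zero set, and the axis values remain exactly
  \<open>- c q\<close>, so the failure of concavity is a computation with a cubic. The double zero
  of x^2 (1 - x) would produce a cone vertex; \<open>d > 0\<close> splits it and rounds the vertex.
  u itself is not convex there, as q'' > 0 for small x. Division by x turns r^2 / 2 into the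
  perspective function r^2 / (2 x) and q into a concave quadratic. The price is 1 / x, at most 2 / d
  where it is used, so \<open>d\<close> is fixed before \<open>e\<close>.\<close>

definition outer :: "real ^ 'n::finite \<Rightarrow> real ^ 'n \<Rightarrow> real ^ 'n ^ 'n" where
  "outer p q = (\<chi> i j. p $ i * q $ j)"

lemma outer_mult_vec: "outer p q *v v = (q \<bullet> v) *\<^sub>R p"
  by (simp add: outer_def matrix_vector_mult_def vec_eq_iff inner_vec_def sum_distrib_left mult.assoc mult.commute mult.left_commute)

lemma trace_conjugation:
  fixes D B :: "real ^ 'n::finite ^ 'n"
  assumes "transpose D = D"
  shows "trace (D ** B ** D) = (\<Sum>i\<in>UNIV. column i D \<bullet> (B *v column i D))"
proof -
  have s: "D $ i $ j = D $ j $ i" for i j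
    using assms by (metis transpose_def vec_lambda_beta)
  show ?thesis
    unfolding trace_def matrix_matrix_mult_def column_def matrix_vector_mult_def inner_vec_def
    apply (simp add: sum_distrib_left sum_distrib_right)
    apply (rule sum.cong[OF refl])
    apply (subst sum.swap)
    apply (rule sum.cong[OF refl])
    apply (rule sum.cong[OF refl])
    apply (simp add: s mult.assoc)
    done
qed

text \<open>With \<open>D = B - C\<close> one has
  \<open>B ** D + D ** C = B ** B - C ** C = 0\<close>; multiplying by \<open>D\<close> and taking
  traces gives trace (D B D) = - trace (D C D). Both traces are sums of quadratic forms over the
  columns of \<open>D\<close>, hence nonnegative, so they vanish and definiteness kills every
  column.\<close>

lemma pos_definite_sqrt_unique:
  fixes B C :: "real ^ 'n::finite ^ 'n"
  assumes B: "pos_definite B" and C: "pos_definite C" and eq: "B ** B = C ** C"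
  shows "B = C"
proof -
  define D where "D = B - C"
  have symD: "transpose D = D"
    using B C by (simp add: D_def pos_definite_def transpose_def vec_eq_iff)
  have BD: "B ** D + D ** C = 0"
    using eq unfolding D_def matrix_eq
    by (simp add: matrix_vector_mult_diff_rdistrib matrix_vector_mult_add_rdistrib
        matrix_vector_mult_diff_distrib flip: matrix_vector_mul_assoc)
  have "trace (D ** B ** D) = - trace (D ** C ** D)"
  proof -
    have "D ** (B ** D) + D ** (D ** C) = 0"
      using BD by (simp flip: matrix_add_ldistrib)
    then have "trace (D ** (B ** D)) + trace (D ** (D ** C)) = 0"
      by (simp add: trace_def sum.distrib flip: trace_add) (simp add: vec_eq_iff flip: sum.distrib)
    moreover have "trace (D ** (D ** C)) = trace ((D ** C) ** D)"
      by (rule trace_mul_sym)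
    ultimately show ?thesis by (simp add: matrix_mul_assoc)
  qed
  then have z: "(\<Sum>i\<in>UNIV. column i D \<bullet> (B *v column i D)) + (\<Sum>i\<in>UNIV. column i D \<bullet> (C *v column i D)) = 0"
    using trace_conjugation[OF symD] by (metis add.left_inverse)
  have nB: "0 \<le> v \<bullet> (B *v v)" and nC: "0 \<le> v \<bullet> (C *v v)" for v
    using B C unfolding pos_definite_def
    by (metis inner_zero_left less_eq_real_def)+
  have "(\<Sum>i\<in>UNIV. column i D \<bullet> (B *v column i D)) = 0"
    using z nB nC by (smt (verit) sum_nonneg)
  then have "column i D \<bullet> (B *v column i D) = 0" for i
    using nB by (subst (asm) sum_nonneg_eq_0_iff) auto
  then have "column i D = 0" for i
    using B unfolding pos_definite_def by (metis less_irrefl)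
  then have "D = 0"
    by (simp add: column_def vec_eq_iff)
  then show ?thesis by (simp add: D_def)
qed

lemma matrix_inv_eqI:
  fixes A B :: "real ^ 'n::finite ^ 'n"
  assumes "A ** B = mat 1"
  shows "matrix_inv A = B"
proof -
  have "B ** A = mat 1" using assms matrix_left_right_inverse by blast
  then have "invertible A" using assms unfolding invertible_def by blast
  then have "A ** matrix_inv A = mat 1"
    unfolding invertible_def matrix_inv_def by (metis (mono_tags, lifting) someI_ex)
  then show ?thesis
    by (metis \<open>B ** A = mat 1\<close> matrix_mul_assoc matrix_mul_lid matrix_mul_rid)
qed

text \<open>The root is an explicit rank-one perturbation of the identity: with w = sqrt (1 +
  |p|^2), the matrix I - p p^T / (w (w + 1)) acts as 1 / w on \<open>p\<close> and as the identity
  orthogonally to it. Only symmetry and the square are recorded, because later traces see the root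
  through its square.\<close>

lemma inv_sqrt_metric:
  fixes p :: "real ^ 'n::finite"
  defines "M \<equiv> mat 1 + (\<chi> i j. p $ i * p $ j)"
  shows "transpose (inv_sqrt_matrix M) = inv_sqrt_matrix M"
    and "inv_sqrt_matrix M ** inv_sqrt_matrix M = mat 1 - (1 / (1 + (norm p)\<^sup>2)) *\<^sub>R outer p p"
proof -
  define w where "w = sqrt (1 + (norm p)\<^sup>2)"
  have w1: "w \<ge> 1" by (simp add: w_def)
  have w2: "w\<^sup>2 = 1 + p \<bullet> p" by (simp add: w_def power2_norm_eq_inner)
  define k where "k = 1 / (w * (w + 1))"
  have k0: "k \<ge> 0" using w1 by (simp add: k_def)
  have kp: "k * (p \<bullet> p) = (w - 1) / w"
  proof -
    have "p \<bullet> p = (w - 1) * (w + 1)" using w2 by (simp add: algebra_simps power2_eq_square)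
    then show ?thesis using w1 by (simp add: k_def divide_simps)
  qed
  define B where "B = mat 1 - k *\<^sub>R outer p p"
  have M: "M = mat 1 + outer p p" by (simp add: M_def outer_def)
  have posB: "pos_definite B"
    unfolding pos_definite_def
  proof (intro conjI allI impI)
    show "transpose B = B"
      unfolding B_def by (simp add: transpose_def outer_def vec_eq_iff mat_def mult.commute)
    fix v :: "real ^ 'n" assume v: "v \<noteq> 0"
    have Bv: "B *v v = v - (k * (p \<bullet> v)) *\<^sub>R p"
      unfolding B_def
      by (simp add: matrix_vector_mult_diff_rdistrib outer_mult_vec flip: scaleR_matrix_vector_assoc)
    have "v \<bullet> (B *v v) = v \<bullet> v - k * (p \<bullet> v)\<^sup>2"
      unfolding Bv by (simp add: inner_diff_right inner_commute power2_eq_square)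
    moreover have "k * (p \<bullet> v)\<^sup>2 \<le> k * ((p \<bullet> p) * (v \<bullet> v))"
      by (intro mult_left_mono k0 Cauchy_Schwarz_ineq)
    moreover have "k * ((p \<bullet> p) * (v \<bullet> v)) = (w - 1) / w * (v \<bullet> v)"
      using kp by (simp flip: mult.assoc)
    moreover have "(w - 1) / w * (v \<bullet> v) < 1 * (v \<bullet> v)"
      using w1 v by (intro mult_strict_right_mono) auto
    ultimately show "0 < v \<bullet> (B *v v)" by linarith
  qed
  have kk: "2 * k - k * (k * (p \<bullet> p)) = 1 / w\<^sup>2"
    unfolding kp unfolding k_def using w1
    by (simp add: divide_simps power2_eq_square)
  have BB: "B ** B = mat 1 - (1 / w\<^sup>2) *\<^sub>R outer p p"
  proof -
    have "B ** B = mat 1 - (k + k - k * (k * (p \<bullet> p))) *\<^sub>R outer p p"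
      unfolding B_def matrix_eq
      by (simp add: matrix_vector_mult_diff_rdistrib matrix_vector_mult_add_rdistrib outer_mult_vec
          inner_diff_right flip: matrix_vector_mul_assoc scaleR_matrix_vector_assoc)
        (simp add: algebra_simps flip: scaleR_add_left)
    also have "\<dots> = mat 1 - (2 * k - k * (k * (p \<bullet> p))) *\<^sub>R outer p p"
      by simp
    finally show ?thesis using kk by simp
  qed
  have "M ** (mat 1 - (1 / w\<^sup>2) *\<^sub>R outer p p) = mat 1 + (1 - 1 / w\<^sup>2 - (p \<bullet> p) / w\<^sup>2) *\<^sub>R outer p p"
    unfolding M matrix_eq
    by (simp add: matrix_vector_mult_diff_rdistrib matrix_vector_mult_add_rdistrib outer_mult_vec
        inner_diff_right flip: matrix_vector_mul_assoc scaleR_matrix_vector_assoc)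
      (simp add: algebra_simps)
  also have "1 - 1 / w\<^sup>2 - (p \<bullet> p) / w\<^sup>2 = 0"
    using w1 w2 by (simp add: divide_simps) (smt (verit) inner_ge_zero)
  also have "mat 1 + 0 *\<^sub>R outer p p = mat 1" by simp
  finally have inv: "matrix_inv M = B ** B" using BB matrix_inv_eqI by metis
  have "inv_sqrt_matrix M = B"
    unfolding inv_sqrt_matrix_def inv
    by (rule the_equality) (use posB pos_definite_sqrt_unique in auto)
  then show "transpose (inv_sqrt_matrix M) = inv_sqrt_matrix M"
    and "inv_sqrt_matrix M ** inv_sqrt_matrix M = mat 1 - (1 / (1 + (norm p)\<^sup>2)) *\<^sub>R outer p p"
    using posB BB w2 by (auto simp: pos_definite_def power2_norm_eq_inner)
qed

section \<open>Spectral theorem for real symmetric matrices\<close>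

lemma symmetric_matrix_inner:
  fixes A :: "real ^ 'n::finite ^ 'n"
  assumes "transpose A = A"
  shows "x \<bullet> (A *v y) = (A *v x) \<bullet> y"
  by (metis assms dot_lmul_matrix transpose_matrix_vector)

text \<open>The new eigenvector maximises the Rayleigh quotient on the unit sphere of the orthogonal
  complement of \<open>B\<close>. Since \<open>B\<close> consists of eigenvectors and
  \<open>A\<close> is symmetric, the residual \<open>z = A *v x - l *\<^sub>R x\<close> stays in
  that complement and is an admissible test direction.\<close>

lemma symmetric_matrix_new_eigenvector:
  fixes A :: "real ^ 'n::finite ^ 'n"
  assumes A: "transpose A = A"
    and B: "\<And>b. b \<in> B \<Longrightarrow> \<exists>l. A *v b = l *\<^sub>R b"
    and y: "y \<noteq> 0" "\<And>b. b \<in> B \<Longrightarrow> b \<bullet> y = 0"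
  shows "\<exists>x l. norm x = 1 \<and> (\<forall>b\<in>B. b \<bullet> x = 0) \<and> A *v x = l *\<^sub>R x"
proof -
  define K where "K = sphere 0 1 \<inter> {x. \<forall>b\<in>B. b \<bullet> x = 0}"
  have "closed {x. \<forall>b\<in>B. b \<bullet> x = 0}"
    unfolding Collect_ball_eq by (intro closed_INT ballI closed_Collect_eq continuous_intros)
  then have "compact K" unfolding K_def by (intro compact_Int_closed compact_sphere)
  moreover have "(1 / norm y) *\<^sub>R y \<in> K"
    using y by (auto simp: K_def)
  moreover have "continuous_on K (\<lambda>x. x \<bullet> (A *v x))"
    by (intro continuous_intros matrix_vector_mult_linear_continuous_on)
  ultimately obtain x where x: "x \<in> K" and max: "\<And>z. z \<in> K \<Longrightarrow> z \<bullet> (A *v z) \<le> x \<bullet> (A *v x)"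
    using continuous_attains_sup[of K "\<lambda>x. x \<bullet> (A *v x)"] by (metis empty_iff)
  define l where "l = x \<bullet> (A *v x)"
  have nx: "norm x = 1" and Bx: "\<And>b. b \<in> B \<Longrightarrow> b \<bullet> x = 0" using x by (auto simp: K_def)
  have xx: "x \<bullet> x = 1" using nx by (simp add: norm_eq_1)
  have le: "z \<bullet> (A *v z) \<le> l * (z \<bullet> z)" if z: "\<And>b. b \<in> B \<Longrightarrow> b \<bullet> z = 0" for z
  proof (cases "z = 0")
    case False
    define s where "s = 1 / norm z"
    have "s *\<^sub>R z \<in> K" using z False by (auto simp: K_def s_def)
    from max[OF this] have "s\<^sup>2 * (z \<bullet> (A *v z)) \<le> l"
      by (simp add: l_def matrix_vector_mult_scaleR power2_eq_square mult.assoc)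
    moreover have "s\<^sup>2 = 1 / (z \<bullet> z)" by (simp add: s_def power_divide power2_norm_eq_inner)
    ultimately show ?thesis using False by (simp add: divide_simps)
  qed simp
  define z where "z = A *v x - l *\<^sub>R x"
  have Bz: "b \<bullet> z = 0" if b: "b \<in> B" for b
  proof -
    obtain c where "A *v b = c *\<^sub>R b" using B b by blast
    then have "b \<bullet> (A *v x) = 0" using Bx[OF b] by (simp add: symmetric_matrix_inner[OF A])
    then show ?thesis using Bx[OF b] by (simp add: z_def inner_diff_right)
  qed
  have "A *v x = z + l *\<^sub>R x" by (simp add: z_def)
  then have xAz: "z \<bullet> (A *v x) = z \<bullet> z + l * (x \<bullet> z)" "x \<bullet> (A *v z) = z \<bullet> z + l * (x \<bullet> z)"
    by (simp_all add: symmetric_matrix_inner[OF A, of x] inner_add_right inner_add_left inner_commute[of z x])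
  \<comment> \<open>Maximality tested at \<open>x + t *\<^sub>R z\<close>. The first-order term is
    \<open>2 * t * (z \<bullet> z)\<close>, so a small positive \<open>t\<close> contradicts the
    inequality unless \<open>z\<close> vanishes.\<close>
  have quad: "2 * t * (z \<bullet> z) + t\<^sup>2 * (z \<bullet> (A *v z) - l * (z \<bullet> z)) \<le> 0" for t :: real
  proof -
    have "(x + t *\<^sub>R z) \<bullet> (A *v (x + t *\<^sub>R z)) \<le> l * ((x + t *\<^sub>R z) \<bullet> (x + t *\<^sub>R z))"
      by (rule le) (simp add: inner_add_right Bx Bz)
    also have "l * ((x + t *\<^sub>R z) \<bullet> (x + t *\<^sub>R z)) = l + 2 * t * (l * (x \<bullet> z)) + t\<^sup>2 * (l * (z \<bullet> z))"
      by (simp add: inner_add_left inner_add_right xx inner_commute[of z x] power2_eq_square distrib_left)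
    also have "(x + t *\<^sub>R z) \<bullet> (A *v (x + t *\<^sub>R z))
        = l + t * (x \<bullet> (A *v z)) + t * (z \<bullet> (A *v x)) + t\<^sup>2 * (z \<bullet> (A *v z))"
      by (simp add: matrix_vector_right_distrib matrix_vector_mult_scaleR inner_add_left inner_add_right
          power2_eq_square distrib_left flip: l_def)
    finally show ?thesis unfolding xAz by (simp add: algebra_simps)
  qed
  have "z \<bullet> z = 0"
  proof (rule ccontr)
    assume nz: "z \<bullet> z \<noteq> 0"
    define M where "M = \<bar>z \<bullet> (A *v z) - l * (z \<bullet> z)\<bar> + 1"
    define t where "t = (z \<bullet> z) / M"
    have M0: "M > 0" and zz: "z \<bullet> z > 0" using nz by (auto simp: M_def)
    have "t\<^sup>2 * (z \<bullet> (A *v z) - l * (z \<bullet> z)) \<ge> t\<^sup>2 * (- M)"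
      by (rule mult_left_mono) (auto simp: M_def)
    with quad[of t] have "2 * t * (z \<bullet> z) \<le> t\<^sup>2 * M" by simp
    moreover have "t\<^sup>2 * M = t * (z \<bullet> z)" using M0 by (simp add: t_def power2_eq_square)
    moreover have "t * (z \<bullet> z) > 0" using M0 zz by (simp add: t_def)
    ultimately show False by linarith
  qed
  then have "A *v x = l *\<^sub>R x" by (simp add: z_def)
  then show ?thesis using nx Bx by blast
qed

text \<open>Orthonormal sets of eigenvectors are enlarged one vector at a time until their
  cardinality is the dimension; an indexing of such a set by the coordinate type gives the columns
  of \<open>P\<close>.\<close>

theorem symmetric_matrix_diagonalization:
  fixes A :: "real ^ 'n::finite ^ 'n"
  assumes A: "transpose A = A"
  obtains P :: "real ^ 'n ^ 'n" and d :: "real ^ 'n"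
  where "orthogonal_matrix P" "A = P ** (\<chi> i j. if i = j then d $ i else 0) ** transpose P"
proof -
  define good where "good B \<longleftrightarrow> pairwise orthogonal B \<and> (\<forall>b\<in>B. norm b = 1 \<and> (\<exists>l. A *v b = l *\<^sub>R b))"
    for B :: "(real ^ 'n) set"
  have ind: "independent B" if "good B" for B
    using that unfolding good_def by (intro pairwise_orthogonal_independent) auto
  have bnd: "finite B \<and> card B \<le> CARD('n)" if "good B" for B
    using independent_bound[OF ind[OF that]] by simp
  have "\<exists>B. good B \<and> card B = k" if "k \<le> CARD('n)" for k
    using that
  proof (induction k)
    case 0
    have "good {}" by (simp add: good_def)
    then show ?case by (metis card.empty)
  next
    case (Suc k)
    then obtain B where B: "good B" "card B = k" by auto
    have "dim B < DIM(real ^ 'n)"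
      using dim_le_card'[of B] B Suc.prems bnd[OF B(1)] by simp
    then obtain y where y: "y \<noteq> 0" "\<And>x. x \<in> span B \<Longrightarrow> orthogonal y x"
      using orthogonal_to_subspace_exists[of B] by blast
    have "b \<bullet> y = 0" if "b \<in> B" for b
      using y(2)[OF span_base[OF that]] by (simp add: orthogonal_def inner_commute)
    with symmetric_matrix_new_eigenvector[OF A, of B y] y(1) B(1)
    obtain x l where x: "norm x = 1" "\<forall>b\<in>B. b \<bullet> x = 0" "A *v x = l *\<^sub>R x"
      unfolding good_def by blast
    have "x \<notin> B" using x(1,2) by (metis norm_eq_1 zero_neq_one)
    moreover have "good (insert x B)"
      using B(1) x unfolding good_def
      by (auto simp: pairwise_insert orthogonal_def inner_commute)
    ultimately show ?case using B bnd[OF B(1)] by (metis card_insert_disjoint)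
  qed
  then obtain B where B: "good B" "card B = CARD('n)" by blast
  then obtain f where f: "bij_betw f (UNIV :: 'n set) B"
    using bnd[OF B(1)] by (metis finite_same_card_bij finite_class.finite_UNIV)
  define P where "P = (\<chi> i j. f j $ i)"
  have colP: "column j P = f j" for j by (simp add: column_def P_def vec_eq_iff)
  have inB: "f j \<in> B" for j using f by (auto simp: bij_betw_def)
  have ff: "f i \<bullet> f j = (if i = j then 1 else 0)" for i j
  proof (cases "i = j")
    case True
    then show ?thesis using B(1) inB[of j] by (simp add: good_def norm_eq_1)
  next
    case False
    then have "f i \<noteq> f j" using f by (auto simp: bij_betw_def inj_on_def)
    then show ?thesis using B(1) inB[of i] inB[of j] False
      by (auto simp: good_def pairwise_def orthogonal_def)
  qed
  have "transpose P ** P = mat 1"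
    by (simp add: matrix_mult_transpose_dot_column colP ff mat_def vec_eq_iff)
  then have oP: "orthogonal_matrix P"
    using orthogonal_matrix by blast
  have "\<forall>j. \<exists>l. A *v f j = l *\<^sub>R f j"
    using B(1) inB by (auto simp: good_def)
  then obtain e where e: "\<And>j. A *v f j = e j *\<^sub>R f j" by metis
  define d where "d = (\<chi> j. e j)"
  have "A ** P = P ** (\<chi> i j. if i = j then d $ i else 0)"
  proof -
    have "(A ** P) $ i $ j = (A *v f j) $ i" for i j
      by (simp add: matrix_matrix_mult_def matrix_vector_mult_def P_def)
    moreover have "(P ** (\<chi> i j. if i = j then d $ i else 0)) $ i $ j = e j * f j $ i" for i j
      by (simp add: matrix_matrix_mult_def P_def d_def if_distrib mult.commute cong: if_cong)
    ultimately show ?thesis by (simp add: vec_eq_iff e)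
  qed
  then have "A = P ** (\<chi> i j. if i = j then d $ i else 0) ** transpose P"
    using oP unfolding orthogonal_matrix_def by (metis matrix_mul_assoc matrix_mul_rid)
  with oP that show thesis by blast
qed

section \<open>Symmetric functions of the eigenvalues\<close>

lemma sum_squares_eq_sigma2:
  fixes l :: "real ^ 'n::finite"
  shows "(\<Sum>i\<in>UNIV. l $ i)\<^sup>2 = (\<Sum>i\<in>UNIV. (l $ i)\<^sup>2) + 2 * sigma2 l"
proof -
  have "(\<Sum>i\<in>A. l $ i)\<^sup>2 = (\<Sum>i\<in>A. (l $ i)\<^sup>2) + 2 * (\<Sum>S | S \<subseteq> A \<and> card S = 2. \<Prod>i\<in>S. l $ i)"
    if "finite A" for A :: "'n set"
    using that
  proof (induction A)
    case empty
    have "{S. S = {} \<and> card S = 2} = ({} :: 'n set set)" by auto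
    then show ?case by simp
  next
    case (insert a A)
    \<comment> \<open>Two-element subsets either avoid \<open>a\<close> or have the form
      \<open>{a, i}\<close> with \<open>i\<close> in \<open>A\<close>; the second kind yields the
      cross term of the expanded square.\<close>
    have eq: "{S. S \<subseteq> insert a A \<and> card S = 2} = {S. S \<subseteq> A \<and> card S = 2} \<union> (\<lambda>i. {a, i}) ` A"
    proof safe
      fix S assume S: "S \<subseteq> insert a A" "card S = 2" "S \<notin> (\<lambda>i. {a, i}) ` A"
      show "x \<in> A" if "x \<in> S" for x
      proof (rule ccontr)
        assume "x \<notin> A"
        then have "x = a" using S that by auto
        obtain p q where pq: "S = {p, q}" "p \<noteq> q" using S(2) by (meson card_2_iff)
        then have "S \<in> (\<lambda>i. {a, i}) ` A" using S(1) that \<open>x = a\<close> by (auto simp: doubleton_eq_iff)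
        then show False using S(3) by simp
      qed
    next
      fix i assume "i \<in> A"
      then have "a \<noteq> i" using insert.hyps by auto
      then show "card {a, i} = 2" by simp
    qed auto
    have disj: "{S. S \<subseteq> A \<and> card S = 2} \<inter> (\<lambda>i. {a, i}) ` A = {}"
      using insert.hyps by auto
    have inj: "inj_on (\<lambda>i. {a, i}) A"
      by (auto simp: inj_on_def doubleton_eq_iff)
    have "(\<Sum>S | S \<subseteq> insert a A \<and> card S = 2. \<Prod>i\<in>S. l $ i)
        = (\<Sum>S | S \<subseteq> A \<and> card S = 2. \<Prod>i\<in>S. l $ i) + (\<Sum>i\<in>A. \<Prod>i\<in>{a, i}. l $ i)"
      unfolding eq using insert.hyps disj inj
      by (subst sum.union_disjoint) (auto simp: sum.reindex)
    also have "(\<Sum>i\<in>A. \<Prod>i\<in>{a, i}. l $ i) = (\<Sum>i\<in>A. l $ a * l $ i)"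
      using insert.hyps by (intro sum.cong refl) (subst prod.insert; auto)
    also have "\<dots> = l $ a * (\<Sum>i\<in>A. l $ i)" by (simp add: sum_distrib_left)
    finally show ?case using insert by (simp add: power2_sum algebra_simps)
  qed
  from this[of UNIV] show ?thesis by (simp add: sigma2_def)
qed

text \<open>\<open>eigenvalue_vector\<close> is a choice that is determined only up to order. The
  multiset of roots of the characteristic polynomial is not affected by this, and so neither is any
  sum of a function over the entries.\<close>

lemma linear_factors_unique:
  fixes l d :: "real ^ 'n::finite"
  assumes "\<And>t. (\<Prod>i\<in>UNIV. t - l $ i) = (\<Prod>i\<in>UNIV. t - d $ i)"
  shows "(\<Sum>i\<in>UNIV. f (l $ i)) = (\<Sum>i\<in>UNIV. (f (d $ i) :: real))"
proof -
  have m: "proots (\<Prod>i\<in>UNIV. [:- v $ i, 1:]) = image_mset (\<lambda>i. v $ i) (mset_set UNIV)" for v :: "real ^ 'n"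
  proof -
    have "proots (\<Prod>i\<in>UNIV. [:- v $ i, 1:]) = (\<Sum>i\<in>UNIV. proots [:- v $ i, 1:])"
      by (rule proots_prod) auto
    also have "\<dots> = (\<Sum>i\<in>UNIV. {# v $ i #})" by simp
    finally show ?thesis by (simp add: sum_unfold_sum_mset image_mset.compositionality o_def)
  qed
  have "poly (\<Prod>i\<in>UNIV. [:- l $ i, 1:]) t = poly (\<Prod>i\<in>UNIV. [:- d $ i, 1:]) t" for t
    using assms[of t] by (simp add: poly_prod)
  then have "(\<Prod>i\<in>UNIV. [:- l $ i, 1:]) = (\<Prod>i\<in>UNIV. [:- d $ i, 1:])"
    using poly_eq_poly_eq_iff by blast
  then have "image_mset (\<lambda>i. l $ i) (mset_set UNIV) = image_mset (\<lambda>i. d $ i) (mset_set UNIV)"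
    using m[of l] m[of d] by simp
  then have "(\<Sum>x\<in>#image_mset (\<lambda>i. l $ i) (mset_set UNIV). f x) = (\<Sum>x\<in>#image_mset (\<lambda>i. d $ i) (mset_set UNIV). f x)"
    by simp
  then show ?thesis by (simp add: image_mset.compositionality o_def sum_unfold_sum_mset)
qed

text \<open>Diagonalisation shows that the characteristic polynomial splits over the reals, which
  makes the choice in \<open>eigenvalue_vector\<close> meaningful, and the diagonal has the same
  power sums as the chosen vector.\<close>

lemma eigenvalue_vector_symmetric:
  fixes A :: "real ^ 'n::finite ^ 'n"
  assumes A: "transpose A = A"
  shows "sigma1 (eigenvalue_vector A) = trace A"
    and "2 * sigma2 (eigenvalue_vector A) = (trace A)\<^sup>2 - trace (A ** A)"
proof -
  obtain P d where P: "orthogonal_matrix P"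
    and AP: "A = P ** (\<chi> i j. if i = j then d $ i else 0) ** transpose P"
    using symmetric_matrix_diagonalization[OF A] .
  let ?D = "\<lambda>v :: real ^ 'n. (\<chi> i j. if i = j then v $ i else 0) :: real ^ 'n ^ 'n"
  have PP: "P ** transpose P = mat 1" "transpose P ** P = mat 1"
    using P by (auto simp: orthogonal_matrix_def)
  have det: "det (mat t - A) = (\<Prod>i\<in>UNIV. t - d $ i)" for t
  proof -
    have "mat t - A = P ** ?D (\<chi> i. t - d $ i) ** transpose P"
    proof -
      have "?D (\<chi> i. t - d $ i) = mat t - ?D d" by (simp add: vec_eq_iff mat_def)
      moreover have "P ** mat t ** transpose P = mat t"
      proof -
        have "mat t = t *\<^sub>R (mat 1 :: real ^ 'n ^ 'n)" by (simp add: vec_eq_iff mat_def)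
        then show ?thesis using PP(1) by (simp add: matrix_scalar_ac flip: scalar_matrix_assoc)
      qed
      ultimately show ?thesis using AP
        by (simp add: matrix_eq matrix_vector_mult_diff_rdistrib matrix_vector_mult_diff_distrib
            flip: matrix_vector_mul_assoc)
    qed
    then have "det (mat t - A) = det P * det (?D (\<chi> i. t - d $ i)) * det (transpose P)"
      by (simp add: det_mul)
    also have "\<dots> = det (P ** transpose P) * det (?D (\<chi> i. t - d $ i))" by (simp add: det_mul)
    also have "\<dots> = (\<Prod>i\<in>UNIV. t - d $ i)" unfolding PP by (subst det_diagonal) auto
    finally show ?thesis .
  qed
  then have "\<exists>l :: real ^ 'n. \<forall>t. det (mat t - A) = (\<Prod>i\<in>UNIV. t - l $ i)" by blast
  then have "\<forall>t. det (mat t - A) = (\<Prod>i\<in>UNIV. t - eigenvalue_vector A $ i)"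
    unfolding eigenvalue_vector_def by (rule someI_ex)
  then have eq: "(\<Sum>i\<in>UNIV. f (eigenvalue_vector A $ i)) = (\<Sum>i\<in>UNIV. f (d $ i))" for f :: "real \<Rightarrow> real"
    using det by (intro linear_factors_unique) simp
  have tr: "trace (P ** M ** transpose P) = trace M" for M
    by (metis PP(2) matrix_mul_assoc matrix_mul_lid trace_mul_sym)
  have trA: "trace A = (\<Sum>i\<in>UNIV. d $ i)" unfolding AP tr by (simp add: trace_def)
  have "A ** A = P ** (?D d ** ?D d) ** transpose P"
  proof -
    have "A ** A = P ** (?D d ** (transpose P ** P) ** ?D d) ** transpose P"
      unfolding AP by (simp only: matrix_mul_assoc)
    then show ?thesis by (simp only: PP(2) matrix_mul_rid)
  qed
  then have trAA: "trace (A ** A) = (\<Sum>i\<in>UNIV. (d $ i)\<^sup>2)"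
    by (simp add: tr) (simp add: trace_def matrix_matrix_mult_def if_distrib power2_eq_square cong: if_cong)
  show s1: "sigma1 (eigenvalue_vector A) = trace A"
    using eq[of "\<lambda>x. x"] trA by (simp add: sigma1_def)
  show "2 * sigma2 (eigenvalue_vector A) = (trace A)\<^sup>2 - trace (A ** A)"
    using sum_squares_eq_sigma2[of "eigenvalue_vector A"] s1 eq[of "\<lambda>x. x\<^sup>2"] trAA
    by (simp add: sigma1_def)
qed

text \<open>Cyclicity of the trace gives trace (B H B) = trace (H B^2), and similarly for the square
  of B H B, so the inverse square root disappears. After multiplication by (1 + |p|^2)^2 the second
  symmetric function is a polynomial in \<open>p\<close> and \<open>H\<close>; the right-hand side
  of the Dirichlet problem is the one for which this polynomial has to equal 1.\<close>

lemma graph_curvatures_formulas: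
  fixes u :: "real ^ 'n::finite \<Rightarrow> real"
  defines "p \<equiv> \<lambda>x. grad u x" and "H \<equiv> \<lambda>x. hessian u x"
  assumes sym: "transpose (H x) = H x"
  shows "sigma1 (graph_curvatures u x) =
      (trace (H x) - (p x \<bullet> (H x *v p x)) / (1 + (norm (p x))\<^sup>2)) / sqrt (1 + (norm (p x))\<^sup>2)"
    and "sigma2 (graph_curvatures u x) * (1 + (norm (p x))\<^sup>2)\<^sup>2 =
      (1 + (norm (p x))\<^sup>2) * ((trace (H x))\<^sup>2 - trace (H x ** H x)) / 2
        - trace (H x) * (p x \<bullet> (H x *v p x)) + (norm (H x *v p x))\<^sup>2"
proof -
  define w where "w = 1 + (norm (p x))\<^sup>2"
  have w: "w > 0" by (simp add: w_def add_pos_nonneg)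
  define B where "B = inv_sqrt_matrix (mat 1 + (\<chi> i j. p x $ i * p x $ j))"
  have BT: "transpose B = B" and BB: "B ** B = mat 1 - (1 / w) *\<^sub>R outer (p x) (p x)"
    unfolding B_def w_def by (rule inv_sqrt_metric)+
  let ?H = "H x" and ?p = "p x"
  define M where "M = B ** ?H ** B"
  have gm: "graph_curvature_matrix u x = (1 / sqrt w) *\<^sub>R M"
    by (simp add: graph_curvature_matrix_def Let_def M_def B_def w_def p_def H_def)
  have trs: "trace (c *\<^sub>R N) = c * trace N" for c and N :: "real ^ 'n ^ 'n"
    by (simp add: trace_def sum_distrib_left)
  have trd: "trace (N - N') = trace N - trace N'" for N N' :: "real ^ 'n ^ 'n"
    by (simp add: trace_def sum_subtractf)
  have tro: "trace (outer a b) = b \<bullet> a" for a b :: "real ^ 'n"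
    by (simp add: trace_def outer_def inner_vec_def mult.commute)
  have HBB: "?H ** (B ** B) = ?H - (1 / w) *\<^sub>R outer (?H *v ?p) ?p"
    unfolding BB by (simp add: matrix_eq matrix_vector_mult_diff_rdistrib outer_mult_vec
        matrix_vector_mult_diff_distrib matrix_vector_mult_scaleR flip: matrix_vector_mul_assoc scaleR_matrix_vector_assoc)
  have symM: "transpose ((1 / sqrt w) *\<^sub>R M) = (1 / sqrt w) *\<^sub>R M"
    by (simp add: M_def matrix_transpose_mul transpose_scalar BT sym matrix_mul_assoc)
  have trM: "trace M = trace ?H - (?p \<bullet> (?H *v ?p)) / w"
  proof -
    have "trace M = trace (?H ** (B ** B))"
      unfolding M_def by (metis matrix_mul_assoc trace_mul_sym)
    then show ?thesis unfolding HBB by (simp add: trd trs tro)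
  qed
  have trMM: "trace (M ** M) = trace (?H ** ?H) - 2 * (norm (?H *v ?p))\<^sup>2 / w + (?p \<bullet> (?H *v ?p))\<^sup>2 / w\<^sup>2"
  proof -
    have "trace (M ** M) = trace ((?H ** (B ** B)) ** (?H ** (B ** B)))"
      unfolding M_def by (metis matrix_mul_assoc trace_mul_sym)
    also have "(?H ** (B ** B)) ** (?H ** (B ** B)) =
        ?H ** ?H - (1 / w) *\<^sub>R outer (?H *v (?H *v ?p)) ?p - (1 / w) *\<^sub>R outer (?H *v ?p) (?H *v ?p)
         + ((?p \<bullet> (?H *v ?p)) / w\<^sup>2) *\<^sub>R outer (?H *v ?p) ?p"
      unfolding HBB matrix_eq
      by (simp add: matrix_vector_mult_diff_rdistrib matrix_vector_mult_add_rdistrib outer_mult_vec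
          inner_diff_right matrix_vector_mult_diff_distrib matrix_vector_mult_scaleR
          symmetric_matrix_inner[OF sym] flip: matrix_vector_mul_assoc scaleR_matrix_vector_assoc)
        (simp add: algebra_simps power2_eq_square)
    also have "trace \<dots> = trace (?H ** ?H) - 2 * (norm (?H *v ?p))\<^sup>2 / w + (?p \<bullet> (?H *v ?p))\<^sup>2 / w\<^sup>2"
      unfolding symmetric_matrix_inner[OF sym, symmetric]
      by (simp add: trd trs tro trace_add symmetric_matrix_inner[OF sym, of ?p] power2_norm_eq_inner)
        (simp add: algebra_simps power2_eq_square)
    finally show ?thesis .
  qed
  note deval = eigenvalue_vector_symmetric[OF symM, folded gm, folded graph_curvatures_def]
  show "sigma1 (graph_curvatures u x) =
      (trace (H x) - (p x \<bullet> (H x *v p x)) / (1 + (norm (p x))\<^sup>2)) / sqrt (1 + (norm (p x))\<^sup>2)"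
    using deval(1) by (simp add: gm trs trM flip: w_def)
  have "trace (((1 / sqrt w) *\<^sub>R M) ** ((1 / sqrt w) *\<^sub>R M)) = trace (M ** M) / w"
    using w by (simp add: matrix_scalar_ac trs flip: scalar_matrix_assoc)
  then have "2 * sigma2 (graph_curvatures u x) = ((trace M)\<^sup>2 - trace (M ** M)) / w"
    using deval(2) w by (simp add: gm trs power_divide diff_divide_distrib)
  then have "2 * sigma2 (graph_curvatures u x) * w = (trace M)\<^sup>2 - trace (M ** M)"
    using w by (simp add: field_simps)
  then have "2 * (sigma2 (graph_curvatures u x) * w\<^sup>2) = w * ((trace M)\<^sup>2 - trace (M ** M))"
    by (metis mult.assoc mult.commute power2_eq_square)
  also have "\<dots> = w * ((trace ?H)\<^sup>2 - trace (?H ** ?H)) - 2 * (trace ?H * (?p \<bullet> (?H *v ?p)))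
      + 2 * (norm (?H *v ?p))\<^sup>2"
    unfolding trM trMM power2_diff using w by (simp add: divide_simps power2_eq_square algebra_simps)
  finally show "sigma2 (graph_curvatures u x) * (1 + (norm (p x))\<^sup>2)\<^sup>2 =
      (1 + (norm (p x))\<^sup>2) * ((trace (H x))\<^sup>2 - trace (H x ** H x)) / 2
        - trace (H x) * (p x \<bullet> (H x *v p x)) + (norm (H x *v p x))\<^sup>2"
    unfolding w_def[symmetric] by linarith
qed

section \<open>A Banach algebra of double power series\<close>

lemma has_sum_UNIV_reindex:
  fixes f :: "'a \<Rightarrow> real"
  assumes "inj h" "\<And>p. p \<notin> range h \<Longrightarrow> f p = 0"
  shows "(f has_sum s) UNIV \<longleftrightarrow> ((f \<circ> h) has_sum s) UNIV"
proof -
  have "(f has_sum s) UNIV \<longleftrightarrow> (f has_sum s) (range h)"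
    by (rule has_sum_cong_neutral) (use assms(2) in auto)
  then show ?thesis using has_sum_reindex[OF assms(1)] by blast
qed

text \<open>Absolute summability permits regrouping the sum over pairs of exponents by their sum
  \<open>(J, K)\<close>; only finitely many pairs fall into each group.\<close>

lemma Cauchy_product_has_sum:
  fixes f g :: "nat \<times> nat \<Rightarrow> real"
  assumes f: "(f has_sum A) UNIV" "(\<lambda>p. \<bar>f p\<bar>) summable_on UNIV"
    and g: "(g has_sum B) UNIV" "(\<lambda>p. \<bar>g p\<bar>) summable_on UNIV"
  shows "((\<lambda>(J, K). \<Sum>a\<le>J. \<Sum>b\<le>K. f (a, b) * g (J - a, K - b)) has_sum A * B) UNIV"
proof -
  have s: "(\<lambda>(p, q). f p * g q) summable_on UNIV \<times> UNIV"
  proof (rule abs_summable_summable)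
    have "(\<lambda>p. \<bar>f p\<bar> * infsum (\<lambda>q. \<bar>g q\<bar>) UNIV) summable_on UNIV"
      by (rule summable_on_cmult_left) (rule f(2))
    moreover have "infsum (\<lambda>q. \<bar>g q\<bar>) UNIV \<ge> 0" by (rule infsum_nonneg) simp
    ultimately show "(\<lambda>x. norm ((\<lambda>(p, q). f p * g q) x)) summable_on UNIV \<times> UNIV"
      using g(2) by (subst Infinite_Sum.abs_summable_on_Sigma_iff)
        (auto simp: abs_mult infsum_cmult_right' intro!: summable_on_cmult_right)
  qed
  have "infsum (\<lambda>(p, q). f p * g q) (UNIV \<times> UNIV) = infsum (\<lambda>p. infsum (\<lambda>q. f p * g q) UNIV) UNIV"
    using infsum_Sigma'_banach[of "\<lambda>p q. f p * g q" UNIV "\<lambda>_. UNIV"] s by simp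
  also have "\<dots> = A * B"
    using f(1) g(1) by (simp add: infsum_cmult_right' infsum_cmult_left' infsumI)
  finally have 1: "((\<lambda>(p, q). f p * g q) has_sum A * B) (UNIV \<times> UNIV)"
    using s by (metis has_sum_infsum)
  have 2: "((\<lambda>((J, K), (a, b)). f (a, b) * g (J - a, K - b)) has_sum A * B)
      (Sigma UNIV (\<lambda>(J, K). {..J} \<times> {..K}))"
    by (rule iffD1[OF has_sum_reindex_bij_witness[where
          i = "\<lambda>((J, K), (a, b)). ((a, b), (J - a, K - b))" and
          j = "\<lambda>((a, b), (c, d)). ((a + c, b + d), (a, b))"] 1]) auto
  have "((\<lambda>p. \<Sum>q\<in>(case p of (J, K) \<Rightarrow> {..J} \<times> {..K}). case (p, q) of ((J, K), (a, b)) \<Rightarrow> f (a, b) * g (J - a, K - b))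
      has_sum A * B) UNIV"
    by (rule has_sum_SigmaD[OF 2]) (auto simp: has_sum_finiteI split: prod.splits)
  then show ?thesis
    by (rule has_sum_cong[THEN iffD1, rotated]) (auto simp: sum.cartesian_product)
qed

text \<open>The reciprocal binomial coefficient is what lets an integration in r pay for a
  derivative in x. The base 3 makes evaluation possible for |x| + |r| <= 3, a region that contains
  all x in [0, 7/4] and r in [0, 5/4].\<close>

definition dweight :: "nat \<Rightarrow> nat \<Rightarrow> real" where
  "dweight j k = 3 ^ (j + k) / real ((j + k) choose k)"

lemma dweight_pos: "dweight j k > 0"
  by (simp add: dweight_def)

text \<open>The product of the two binomial coefficients is a single term of Vandermonde's sum.
  Submultiplicative weights make \<open>wnorm\<close> submultiplicative for the Cauchy
  product.\<close>

lemma dweight_submult: "dweight (a + c) (b + d) \<le> dweight a b * dweight c d"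
proof -
  have "((a + b) choose b) * ((c + d) choose d) \<le> (\<Sum>k\<le>b + d. ((a + b) choose k) * ((c + d) choose (b + d - k)))"
    using member_le_sum[of b "{..b + d}" "\<lambda>k. ((a + b) choose k) * ((c + d) choose (b + d - k))"] by simp
  also have "\<dots> = (a + b + (c + d)) choose (b + d)" by (rule vandermonde)
  finally have "real ((a + b) choose b) * real ((c + d) choose d) \<le> real ((a + c + (b + d)) choose (b + d))"
    by (metis ab_semigroup_add_class.add_ac(1) add.commute add.left_commute of_nat_le_iff of_nat_mult)
  then have "1 / real ((a + c + (b + d)) choose (b + d)) \<le> 1 / (real ((a + b) choose b) * real ((c + d) choose d))"
    by (intro divide_left_mono) auto
  then have "3 ^ (a + c + (b + d)) * (1 / real ((a + c + (b + d)) choose (b + d)))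
      \<le> (3::real) ^ (a + c + (b + d)) * (1 / (real ((a + b) choose b) * real ((c + d) choose d)))"
    by (rule mult_left_mono) simp
  then show ?thesis by (simp add: dweight_def power_add mult_ac)
qed

text \<open>The monomial times its binomial coefficient is one term of the expansion of (|x| +
  |r|)^(j + k).\<close>

lemma monomial_le_dweight:
  assumes "\<bar>x\<bar> + \<bar>r\<bar> \<le> 3"
  shows "\<bar>x\<bar> ^ j * \<bar>r\<bar> ^ k \<le> dweight j k"
proof -
  have "real ((j + k) choose k) * \<bar>r\<bar> ^ k * \<bar>x\<bar> ^ (j + k - k)
      \<le> (\<Sum>i\<le>j + k. real ((j + k) choose i) * \<bar>r\<bar> ^ i * \<bar>x\<bar> ^ (j + k - i))"
    by (rule member_le_sum) auto
  also have "\<dots> = (\<bar>r\<bar> + \<bar>x\<bar>) ^ (j + k)" by (simp add: binomial_ring)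
  also have "\<dots> \<le> 3 ^ (j + k)" using assms by (intro power_mono) auto
  finally show ?thesis by (simp add: dweight_def field_simps)
qed

text \<open>The outer series is in r (exponent \<open>k\<close>), the inner one in x (exponent
  \<open>j\<close>). Iterated formal power series supply the ring laws, so that only summability has
  to be added.\<close>

definition fps2_nth :: "real fps fps \<Rightarrow> nat \<Rightarrow> nat \<Rightarrow> real" where
  "fps2_nth F j k = fps_nth (fps_nth F k) j"

definition fps2 :: "(nat \<Rightarrow> nat \<Rightarrow> real) \<Rightarrow> real fps fps" where
  "fps2 a = Abs_fps (\<lambda>k. Abs_fps (\<lambda>j. a j k))"

lemma fps2_nth_fps2 [simp]: "fps2_nth (fps2 a) j k = a j k"
  by (simp add: fps2_nth_def fps2_def)

lemma fps2_nth_eqI: "(\<And>j k. fps2_nth F j k = fps2_nth G j k) \<Longrightarrow> F = G"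
  by (simp add: fps2_nth_def fps_eq_iff)

lemma fps2_nth_simps [simp]:
  "fps2_nth 0 j k = 0" "fps2_nth (F + G) j k = fps2_nth F j k + fps2_nth G j k" "fps2_nth (F - G) j k = fps2_nth F j k - fps2_nth G j k"
  "fps2_nth (- F) j k = - fps2_nth F j k"
  by (simp_all add: fps2_nth_def)

lemma fps2_nth_one: "fps2_nth 1 j k = (if j = 0 \<and> k = 0 then 1 else 0)"
  by (simp add: fps2_nth_def fps_one_def)

lemma fps2_nth_mult: "fps2_nth (F * G) J K = (\<Sum>a\<le>J. \<Sum>b\<le>K. fps2_nth F a b * fps2_nth G (J - a) (K - b))"
  by (subst sum.swap) (simp add: fps2_nth_def fps_mult_nth fps_sum_nth atLeast0AtMost)

definition wnorm :: "real fps fps \<Rightarrow> real" where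
  "wnorm F = infsum (\<lambda>(j, k). \<bar>fps2_nth F j k\<bar> * dweight j k) UNIV"

definition wsummable :: "real fps fps \<Rightarrow> bool" where
  "wsummable F \<longleftrightarrow> (\<lambda>(j, k). \<bar>fps2_nth F j k\<bar> * dweight j k) summable_on UNIV"

lemma wsummable_wnorm: "wsummable F \<Longrightarrow> ((\<lambda>(j, k). \<bar>fps2_nth F j k\<bar> * dweight j k) has_sum wnorm F) UNIV"
  by (simp add: wsummable_def wnorm_def)

lemma wsummable_dominated:
  assumes "((\<lambda>(j, k). b j k) has_sum S) UNIV" "\<And>j k. \<bar>fps2_nth F j k\<bar> * dweight j k \<le> b j k"
  shows "wsummable F" "wnorm F \<le> S"
proof -
  show w: "wsummable F"
    unfolding wsummable_def
    by (rule summable_on_comparison_test[OF has_sum_imp_summable[OF assms(1)]])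
       (use assms(2) dweight_pos in \<open>auto simp: less_imp_le\<close>)
  show "wnorm F \<le> S"
    by (rule has_sum_mono[OF wsummable_wnorm[OF w] assms(1)]) (use assms(2) in auto)
qed

lemma wsummable_add:
  assumes "wsummable F" "wsummable G"
  shows "wsummable (F + G)" "wnorm (F + G) \<le> wnorm F + wnorm G"
proof -
  have "((\<lambda>(j, k). \<bar>fps2_nth F j k\<bar> * dweight j k + \<bar>fps2_nth G j k\<bar> * dweight j k) has_sum wnorm F + wnorm G) UNIV"
    using has_sum_add[OF assms[THEN wsummable_wnorm]] by (simp add: case_prod_unfold)
  then show "wsummable (F + G)" "wnorm (F + G) \<le> wnorm F + wnorm G"
    by (rule wsummable_dominated; simp add: abs_triangle_ineq dweight_pos less_imp_le mult_right_mono flip: distrib_right)+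
qed

lemma wsummable_scale:
  assumes "wsummable F" "\<And>j k. fps2_nth G j k = c * fps2_nth F j k"
  shows "wsummable G" "wnorm G = \<bar>c\<bar> * wnorm F"
proof -
  have "((\<lambda>(j, k). \<bar>fps2_nth G j k\<bar> * dweight j k) has_sum \<bar>c\<bar> * wnorm F) UNIV"
    using has_sum_cmult_right[OF wsummable_wnorm[OF assms(1)], of "\<bar>c\<bar>"]
    by (simp add: case_prod_unfold assms(2) abs_mult mult.assoc)
  then show "wsummable G" "wnorm G = \<bar>c\<bar> * wnorm F"
    by (auto simp: wsummable_def wnorm_def infsumI has_sum_imp_summable)
qed

lemma wsummable_mult:
  assumes "wsummable F" "wsummable G"
  shows "wsummable (F * G)" "wnorm (F * G) \<le> wnorm F * wnorm G"
proof -
  have *: "((\<lambda>(J, K). \<Sum>a\<le>J. \<Sum>b\<le>K. (\<bar>fps2_nth F a b\<bar> * dweight a b) * (\<bar>fps2_nth G (J - a) (K - b)\<bar> * dweight (J - a) (K - b)))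
     has_sum wnorm F * wnorm G) UNIV"
    using Cauchy_product_has_sum[OF wsummable_wnorm[OF assms(1)] _ wsummable_wnorm[OF assms(2)]] assms
    by (simp add: wsummable_def case_prod_unfold abs_mult less_imp_le[OF dweight_pos])
  have "\<bar>fps2_nth (F * G) J K\<bar> * dweight J K \<le>
      (\<Sum>a\<le>J. \<Sum>b\<le>K. (\<bar>fps2_nth F a b\<bar> * dweight a b) * (\<bar>fps2_nth G (J - a) (K - b)\<bar> * dweight (J - a) (K - b)))" for J K
  proof -
    have "\<bar>fps2_nth (F * G) J K\<bar> \<le> (\<Sum>a\<le>J. \<Sum>b\<le>K. \<bar>fps2_nth F a b\<bar> * \<bar>fps2_nth G (J - a) (K - b)\<bar>)"
      unfolding fps2_nth_mult abs_mult[symmetric] by (intro order.trans[OF sum_abs] sum_mono sum_abs)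
    then have "\<bar>fps2_nth (F * G) J K\<bar> * dweight J K \<le> (\<Sum>a\<le>J. \<Sum>b\<le>K. \<bar>fps2_nth F a b\<bar> * \<bar>fps2_nth G (J - a) (K - b)\<bar> * dweight J K)"
      using mult_right_mono less_imp_le[OF dweight_pos[of J K]] by (fastforce simp flip: sum_distrib_right)
    also have "\<dots> \<le> (\<Sum>a\<le>J. \<Sum>b\<le>K. \<bar>fps2_nth F a b\<bar> * \<bar>fps2_nth G (J - a) (K - b)\<bar> * (dweight a b * dweight (J - a) (K - b)))"
    proof (intro sum_mono mult_left_mono)
      fix a b assume "a \<in> {..J}" "b \<in> {..K}"
      then show "dweight J K \<le> dweight a b * dweight (J - a) (K - b)"
        using dweight_submult[of a "J - a" b "K - b"] by simp
    qed auto
    finally show ?thesis by (simp add: mult_ac)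
  qed
  then show "wsummable (F * G)" "wnorm (F * G) \<le> wnorm F * wnorm G"
    using wsummable_dominated[OF *] by auto
qed

lemma has_sum_single:
  fixes f :: "'a \<Rightarrow> 'b \<Rightarrow> real"
  assumes "\<And>x y. \<not> (x = a \<and> y = b) \<Longrightarrow> f x y = 0" "S = f a b"
  shows "((\<lambda>(x, y). f x y) has_sum S) UNIV"
proof -
  have "((\<lambda>(x, y). f x y) has_sum f a b) {(a, b)}" by (rule has_sum_finiteI) auto
  then show ?thesis
    unfolding assms(2) by (rule has_sum_cong_neutral[THEN iffD1, rotated 3]) (use assms in auto)
qed

lemma wsummable_monomial:
  assumes "\<And>j k. fps2_nth F j k = (if j = a \<and> k = b then c else 0)"
  shows "wsummable F" "wnorm F = \<bar>c\<bar> * dweight a b"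
proof -
  have "((\<lambda>(j, k). \<bar>fps2_nth F j k\<bar> * dweight j k) has_sum \<bar>c\<bar> * dweight a b) UNIV"
    by (rule has_sum_single[of a b "\<lambda>j k. \<bar>fps2_nth F j k\<bar> * dweight j k"])
       (auto simp: assms)
  then show "wsummable F" "wnorm F = \<bar>c\<bar> * dweight a b"
    by (auto simp: wsummable_def wnorm_def infsumI has_sum_imp_summable)
qed

typedef dseries = "{F. wsummable F}" morphisms fps_of Abs_dseries
proof
  show "0 \<in> {F. wsummable F}" using wsummable_monomial(1)[of 0 0 0 0] by simp
qed

setup_lifting type_definition_dseries

lemma wsummable_fps_of [simp]: "wsummable (fps_of f)"
  using fps_of by simp

instantiation dseries :: comm_ring_1
begin
lift_definition zero_dseries :: dseries is 0
  using wsummable_monomial(1)[of 0 0 0 0] by simp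
lift_definition one_dseries :: dseries is 1
  using wsummable_monomial(1)[of 1 0 0 1] by (simp add: fps2_nth_one)
lift_definition plus_dseries :: "dseries \<Rightarrow> dseries \<Rightarrow> dseries" is "(+)"
  by (rule wsummable_add(1))
lift_definition minus_dseries :: "dseries \<Rightarrow> dseries \<Rightarrow> dseries" is "(-)"
proof -
  fix F G assume "wsummable F" "wsummable G"
  moreover from this have "wsummable (- G)" using wsummable_scale(1)[of G "- G" "-1"] by simp
  ultimately show "wsummable (F - G)" using wsummable_add(1) by fastforce
qed
lift_definition uminus_dseries :: "dseries \<Rightarrow> dseries" is "uminus"
  subgoal for F using wsummable_scale(1)[of F "- F" "-1"] by simp done
lift_definition times_dseries :: "dseries \<Rightarrow> dseries \<Rightarrow> dseries" is "(*)"
  by (rule wsummable_mult(1))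
instance
  by standard (transfer; simp add: algebra_simps)+
end

definition coef :: "dseries \<Rightarrow> nat \<Rightarrow> nat \<Rightarrow> real" where
  "coef f = fps2_nth (fps_of f)"

lemma dseries_eqI: "(\<And>j k. coef f j k = coef g j k) \<Longrightarrow> f = g"
  unfolding coef_def by (metis fps2_nth_eqI fps_of_inject)

lemma coef_simps [simp]:
  "coef 0 j k = 0" "coef (f + g) j k = coef f j k + coef g j k" "coef (f - g) j k = coef f j k - coef g j k"
  "coef (- f) j k = - coef f j k"
  by (simp_all add: coef_def zero_dseries.rep_eq plus_dseries.rep_eq minus_dseries.rep_eq uminus_dseries.rep_eq)

lemma coef_one: "coef 1 j k = (if j = 0 \<and> k = 0 then 1 else 0)"
  by (simp add: coef_def one_dseries.rep_eq fps2_nth_one)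

lemma coef_mult: "coef (f * g) J K = (\<Sum>a\<le>J. \<Sum>b\<le>K. coef f a b * coef g (J - a) (K - b))"
  by (simp add: coef_def times_dseries.rep_eq fps2_nth_mult)

instantiation dseries :: real_normed_algebra_1
begin
lift_definition scaleR_dseries :: "real \<Rightarrow> dseries \<Rightarrow> dseries" is "\<lambda>c F. fps2 (\<lambda>j k. c * fps2_nth F j k)"
  subgoal for c F using wsummable_scale(1)[of F _ c] by simp done
lift_definition norm_dseries :: "dseries \<Rightarrow> real" is wnorm .
definition sgn_dseries :: "dseries \<Rightarrow> dseries" where "sgn_dseries f = inverse (norm f) *\<^sub>R f"
definition dist_dseries :: "dseries \<Rightarrow> dseries \<Rightarrow> real" where "dist_dseries f g = norm (f - g)"
definition uniformity_dseries :: "(dseries \<times> dseries) filter" where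
  "uniformity_dseries = (INF e\<in>{0 <..}. principal {(f, g). dist f g < e})"
definition open_dseries :: "dseries set \<Rightarrow> bool" where
  "open_dseries U = (\<forall>x\<in>U. eventually (\<lambda>(x', y). x' = x \<longrightarrow> y \<in> U) uniformity)"

lemma coef_scaleR [simp]: "coef (c *\<^sub>R f) j k = c * coef f j k"
  by (simp add: coef_def scaleR_dseries.rep_eq)

lemma norm_has_sum: "((\<lambda>(j, k). \<bar>coef f j k\<bar> * dweight j k) has_sum norm f) UNIV"
  unfolding coef_def norm_dseries.rep_eq by (rule wsummable_wnorm) simp

instance
proof
  fix f g h :: dseries and a b :: real
  show "dist f g = norm (f - g)" by (rule dist_dseries_def)
  show "uniformity = (INF e\<in>{0 <..}. principal {(f, g :: dseries). dist f g < e})" by (rule uniformity_dseries_def)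
  show "open U \<longleftrightarrow> (\<forall>x\<in>U. eventually (\<lambda>(x', y). x' = x \<longrightarrow> y \<in> U) uniformity)" for U :: "dseries set"
    by (rule open_dseries_def)
  show "sgn f = inverse (norm f) *\<^sub>R f" by (rule sgn_dseries_def)
  show "norm f = 0 \<longleftrightarrow> f = 0"
  proof
    assume 0: "norm f = 0"
    show "f = 0"
    proof (rule dseries_eqI)
      fix j k
      have "(\<lambda>(j, k). \<bar>coef f j k\<bar> * dweight j k) (j, k) = 0"
        by (rule nonneg_has_sum_le_0D[OF norm_has_sum]) (use 0 dweight_pos in \<open>auto simp: less_imp_le\<close>)
      then show "coef f j k = coef 0 j k" using dweight_pos[of j k] by simp
    qed
  next
    assume "f = 0"
    then show "norm f = 0" using wsummable_monomial(2)[of 0 0 0 0] by (simp add: norm_dseries.rep_eq zero_dseries.rep_eq)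
  qed
  show "norm (f + g) \<le> norm f + norm g" by transfer (rule wsummable_add(2))
  show "norm (a *\<^sub>R f) = \<bar>a\<bar> * norm f" by transfer (rule wsummable_scale(2); simp)
  show "norm (f * g) \<le> norm f * norm g" by transfer (rule wsummable_mult(2))
  show "norm (1 :: dseries) = 1"
    using wsummable_monomial(2)[of 1 0 0 1] by (simp add: norm_dseries.rep_eq one_dseries.rep_eq fps2_nth_one dweight_def)
  show "a *\<^sub>R (f + g) = a *\<^sub>R f + a *\<^sub>R g" "(a + b) *\<^sub>R f = a *\<^sub>R f + b *\<^sub>R f"
    "a *\<^sub>R b *\<^sub>R f = (a * b) *\<^sub>R f" "1 *\<^sub>R f = f"
    by (rule dseries_eqI; simp add: algebra_simps)+
  have l: "a *\<^sub>R f * g = a *\<^sub>R (f * g)" for f g :: dseries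
    by (rule dseries_eqI) (simp add: coef_mult sum_distrib_left mult.assoc)
  show "a *\<^sub>R f * g = a *\<^sub>R (f * g)" by (rule l)
  show "f * a *\<^sub>R g = a *\<^sub>R (f * g)" using l[of g f] by (simp add: mult.commute)
qed
end

lemma coef_bound: "\<bar>coef f j k\<bar> * dweight j k \<le> norm f"
proof -
  have "(\<Sum>p\<in>{(j, k)}. (\<lambda>(j, k). \<bar>coef f j k\<bar> * dweight j k) p) \<le> norm f"
    by (rule finite_sum_le_has_sum[OF norm_has_sum]) (auto simp: dweight_pos less_imp_le)
  then show ?thesis by simp
qed

text \<open>Coefficients of a Cauchy sequence converge one by one. Bounds on finite partial sums of
  the norm pass to the limit, which yields both finiteness of the norm of the limit and convergence
  in norm.\<close>

instance dseries :: banach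
proof
  fix X :: "nat \<Rightarrow> dseries"
  assume C: "Cauchy X"
  have "Cauchy (\<lambda>n. coef (X n) j k)" for j k
  proof (rule metric_CauchyI)
    fix e :: real assume e: "e > 0"
    then obtain M where M: "\<And>m n. m \<ge> M \<Longrightarrow> n \<ge> M \<Longrightarrow> dist (X m) (X n) < e * dweight j k"
      using metric_CauchyD[OF C, of "e * dweight j k"] dweight_pos[of j k] by (metis mult_pos_pos)
    have "dist (coef (X m) j k) (coef (X n) j k) < e" if "m \<ge> M" "n \<ge> M" for m n
    proof -
      have "\<bar>coef (X m) j k - coef (X n) j k\<bar> * dweight j k < e * dweight j k"
        using coef_bound[of "X m - X n" j k] M[OF that] by (simp add: dist_norm)
      then show ?thesis using dweight_pos[of j k] by (simp add: dist_real_def)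
    qed
    then show "\<exists>M. \<forall>m\<ge>M. \<forall>n\<ge>M. dist (coef (X m) j k) (coef (X n) j k) < e" by blast
  qed
  then have "\<forall>j k. \<exists>l. (\<lambda>n. coef (X n) j k) \<longlonglongrightarrow> l" by (simp add: real_Cauchy_convergent convergent_def flip: convergent_def)
  then obtain L where L: "\<And>j k. (\<lambda>n. coef (X n) j k) \<longlonglongrightarrow> L j k" by metis
  have fin: "(\<Sum>(j, k)\<in>S. \<bar>coef (X m) j k - L j k\<bar> * dweight j k) \<le> e"
    if e: "\<And>n. n \<ge> M \<Longrightarrow> dist (X m) (X n) \<le> e" and S: "finite S" for S e m M
  proof (rule tendsto_upperbound)
    show "(\<lambda>n. \<Sum>(j, k)\<in>S. \<bar>coef (X m) j k - coef (X n) j k\<bar> * dweight j k)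
        \<longlonglongrightarrow> (\<Sum>(j, k)\<in>S. \<bar>coef (X m) j k - L j k\<bar> * dweight j k)"
      unfolding case_prod_unfold by (intro tendsto_intros L)
    show "\<forall>\<^sub>F n in sequentially. (\<Sum>(j, k)\<in>S. \<bar>coef (X m) j k - coef (X n) j k\<bar> * dweight j k) \<le> e"
      unfolding eventually_sequentially
    proof (intro exI allI impI)
      fix n assume "n \<ge> M"
      have "(\<Sum>p\<in>S. (\<lambda>(j, k). \<bar>coef (X m - X n) j k\<bar> * dweight j k) p) \<le> norm (X m - X n)"
        by (rule finite_sum_le_has_sum[OF norm_has_sum]) (use S in \<open>auto simp: dweight_pos less_imp_le\<close>)
      then show "(\<Sum>(j, k)\<in>S. \<bar>coef (X m) j k - coef (X n) j k\<bar> * dweight j k) \<le> e"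
        using e[OF \<open>n \<ge> M\<close>] by (simp add: dist_norm)
    qed
  qed simp
  have near: "wsummable (fps_of (X m) - fps2 L) \<and> wnorm (fps_of (X m) - fps2 L) \<le> e"
    if e: "\<And>n. n \<ge> M \<Longrightarrow> dist (X m) (X n) \<le> e" for e m M
  proof -
    have b: "sum (\<lambda>(j, k). \<bar>fps2_nth (fps_of (X m) - fps2 L) j k\<bar> * dweight j k) S \<le> e" if "finite S" for S
      using fin[OF e that] by (simp add: coef_def)
    have "wsummable (fps_of (X m) - fps2 L)"
      unfolding wsummable_def
      by (rule nonneg_bounded_partial_sums_imp_summable_on[of _ _ e])
         (use b in \<open>auto simp: dweight_pos less_imp_le intro!: eventually_finite_subsets_at_top_weakI\<close>)
    then show ?thesis
      using infsum_le_finite_sums[of "\<lambda>(j, k). \<bar>fps2_nth (fps_of (X m) - fps2 L) j k\<bar> * dweight j k" UNIV e] b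
      by (simp add: wsummable_def wnorm_def)
  qed
  obtain M1 where "\<And>m n. m \<ge> M1 \<Longrightarrow> n \<ge> M1 \<Longrightarrow> dist (X m) (X n) < 1"
    using metric_CauchyD[OF C, of 1] by auto
  then have "wsummable (fps_of (X M1) - fps2 L)" using near[of M1 M1 1] by (simp add: less_imp_le)
  then have "wsummable (- (fps_of (X M1) - fps2 L))"
    using wsummable_scale(1)[of _ "- (fps_of (X M1) - fps2 L)" "-1"] by simp
  then have wL: "wsummable (fps2 L)"
    using wsummable_add(1)[of "fps_of (X M1)" "- (fps_of (X M1) - fps2 L)"] by simp
  define Y where "Y = Abs_dseries (fps2 L)"
  have Y: "fps_of Y = fps2 L" using wL by (simp add: Y_def Abs_dseries_inverse)
  have "X \<longlonglongrightarrow> Y"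
  proof (rule metric_LIMSEQ_I)
    fix r :: real assume "r > 0"
    then obtain M where M: "\<And>m n. m \<ge> M \<Longrightarrow> n \<ge> M \<Longrightarrow> dist (X m) (X n) < r / 2"
      using metric_CauchyD[OF C, of "r / 2"] by auto
    have "dist (X m) Y < r" if "m \<ge> M" for m
    proof -
      have "wnorm (fps_of (X m) - fps2 L) \<le> r / 2" using near[of M m "r / 2"] M that less_imp_le by blast
      then show ?thesis using \<open>r > 0\<close> by (simp add: dist_norm norm_dseries.rep_eq minus_dseries.rep_eq Y)
    qed
    then show "\<exists>no. \<forall>n\<ge>no. dist (X n) Y < r" by blast
  qed
  then show "convergent X" by (auto simp: convergent_def)
qed

section \<open>Evaluation at a point, a norm-decreasing algebra homomorphism\<close>

definition deval :: "real \<Rightarrow> real \<Rightarrow> dseries \<Rightarrow> real" where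
  "deval x r f = infsum (\<lambda>(j, k). coef f j k * (x ^ j * r ^ k)) UNIV"

context
  fixes x r :: real
  assumes xr: "\<bar>x\<bar> + \<bar>r\<bar> \<le> 3"
begin

lemma deval_abs_summable: "(\<lambda>(j, k). \<bar>coef f j k * (x ^ j * r ^ k)\<bar>) summable_on UNIV"
  by (rule summable_on_comparison_test[OF has_sum_imp_summable[OF norm_has_sum[of f]]])
     (auto simp: abs_mult power_abs intro!: mult_left_mono monomial_le_dweight xr)

lemma deval_has_sum: "((\<lambda>(j, k). coef f j k * (x ^ j * r ^ k)) has_sum deval x r f) UNIV"
  unfolding deval_def
  by (rule has_sum_infsum, rule abs_summable_summable)
     (use deval_abs_summable[of f] in \<open>simp add: case_prod_unfold\<close>)

lemma deval_eqI: "((\<lambda>(j, k). coef f j k * (x ^ j * r ^ k)) has_sum a) UNIV \<Longrightarrow> deval x r f = a"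
  using deval_has_sum has_sum_unique by blast

lemma deval_add: "deval x r (f + g) = deval x r f + deval x r g"
  using has_sum_add[OF deval_has_sum[of f] deval_has_sum[of g]]
  by (intro deval_eqI) (simp add: case_prod_unfold algebra_simps)

lemma deval_scaleR: "deval x r (c *\<^sub>R f) = c * deval x r f"
  using has_sum_cmult_right[OF deval_has_sum[of f], of c]
  by (intro deval_eqI) (simp add: case_prod_unfold algebra_simps)

lemma deval_uminus: "deval x r (- f) = - deval x r f"
  using deval_scaleR[of "-1" f] by simp

lemma deval_diff: "deval x r (f - g) = deval x r f - deval x r g"
  using deval_add[of f "- g"] deval_uminus by simp

lemma deval_monomial:
  assumes "\<And>j k. coef f j k = (if j = a \<and> k = b then c else 0)"
  shows "deval x r f = c * (x ^ a * r ^ b)"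
  by (rule deval_eqI, rule has_sum_single[of a b "\<lambda>j k. coef f j k * (x ^ j * r ^ k)"])
     (auto simp: assms)

lemma deval_one: "deval x r 1 = 1"
  using deval_monomial[of 1 0 0 1] by (simp add: coef_one)

lemma deval_mult: "deval x r (f * g) = deval x r f * deval x r g"
proof (rule deval_eqI)
  have "((\<lambda>(J, K). \<Sum>a\<le>J. \<Sum>b\<le>K. (coef f a b * (x ^ a * r ^ b)) * (coef g (J - a) (K - b) * (x ^ (J - a) * r ^ (K - b))))
     has_sum deval x r f * deval x r g) UNIV"
    using Cauchy_product_has_sum[OF deval_has_sum[of f] _ deval_has_sum[of g]] deval_abs_summable
    by (simp add: case_prod_unfold)
  moreover have "(\<Sum>a\<le>J. \<Sum>b\<le>K. (coef f a b * (x ^ a * r ^ b)) * (coef g (J - a) (K - b) * (x ^ (J - a) * r ^ (K - b))))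
     = coef (f * g) J K * (x ^ J * r ^ K)" for J K
    unfolding coef_mult sum_distrib_right
  proof (intro sum.cong refl)
    fix a b assume "a \<in> {..J}" "b \<in> {..K}"
    then have "x ^ J = x ^ a * x ^ (J - a)" "r ^ K = r ^ b * r ^ (K - b)"
      by (simp_all flip: power_add)
    then show "(coef f a b * (x ^ a * r ^ b)) * (coef g (J - a) (K - b) * (x ^ (J - a) * r ^ (K - b)))
      = coef f a b * coef g (J - a) (K - b) * (x ^ J * r ^ K)" by simp
  qed
  ultimately show "((\<lambda>(j, k). coef (f * g) j k * (x ^ j * r ^ k)) has_sum deval x r f * deval x r g) UNIV"
    by simp
qed

lemma abs_deval_le: "\<bar>deval x r f\<bar> \<le> norm f"
proof -
  have "(\<lambda>p. norm ((\<lambda>(j, k). coef f j k * (x ^ j * r ^ k)) p)) summable_on UNIV"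
    using deval_abs_summable[of f] by (simp add: case_prod_unfold)
  then have "\<bar>deval x r f\<bar> \<le> infsum (\<lambda>p. norm ((\<lambda>(j, k). coef f j k * (x ^ j * r ^ k)) p)) UNIV"
    unfolding deval_def real_norm_def[symmetric] by (rule norm_infsum_bound)
  also have "\<dots> \<le> norm f"
    by (rule has_sum_mono[OF has_sum_infsum norm_has_sum])
      (use deval_abs_summable[of f] in \<open>auto simp: case_prod_unfold abs_mult power_abs intro!: mult_left_mono monomial_le_dweight xr\<close>)
  finally show ?thesis .
qed

end

definition monom2 :: "nat \<Rightarrow> nat \<Rightarrow> dseries" where
  "monom2 a b = Abs_dseries (fps2 (\<lambda>j k. if j = a \<and> k = b then 1 else 0))"

lemma coef_monom2: "coef (monom2 a b) j k = (if j = a \<and> k = b then 1 else 0)"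
  unfolding monom2_def coef_def
  by (subst Abs_dseries_inverse) (use wsummable_monomial(1)[of _ a b 1] in auto)

lemma deval_monom2: "\<bar>x\<bar> + \<bar>r\<bar> \<le> 3 \<Longrightarrow> deval x r (monom2 a b) = x ^ a * r ^ b"
  using deval_monomial[of x r "monom2 a b" a b 1] by (simp add: coef_monom2)

text \<open>It sends \<open>x ^ (j + a) * r ^ k\<close> to
  \<open>\<mu> j k * x ^ j * r ^ (k + b)\<close>: differentiation \<open>a\<close> times in x
  combined with integration \<open>b\<close> times in r, all numerical factors being collected in
  \<open>\<mu>\<close>.\<close>

definition shift_op :: "(nat \<Rightarrow> nat \<Rightarrow> real) \<Rightarrow> nat \<Rightarrow> nat \<Rightarrow> dseries \<Rightarrow> dseries" where
  "shift_op \<mu> a b f = Abs_dseries (fps2 (\<lambda>j k. if b \<le> k then \<mu> j (k - b) * coef f (j + a) (k - b) else 0))"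

context
  fixes \<mu> :: "nat \<Rightarrow> nat \<Rightarrow> real" and a b :: nat and B :: real
  assumes \<mu>: "\<And>j k. \<bar>\<mu> j k\<bar> * dweight j (k + b) \<le> B * dweight (j + a) k"
begin

lemma shift_op_aux:
  defines "F \<equiv> \<lambda>f. fps2 (\<lambda>j k. if b \<le> k then \<mu> j (k - b) * coef f (j + a) (k - b) else 0)"
  shows "wsummable (F f)" "wnorm (F f) \<le> B * norm f"
proof -
  define h where "h = (\<lambda>(j :: nat, k :: nat). (j, k + b))"
  define s where "s = (\<lambda>(j :: nat, k :: nat). (j + a, k))"
  define n where "n = (\<lambda>(j, k). \<bar>coef f j k\<bar> * dweight j k)"
  have B0: "B \<ge> 0" using \<mu>[of 0 0] dweight_pos[of 0 b] dweight_pos[of a 0]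
    by (smt (verit, ccfv_threshold) abs_ge_zero add_0 mult_nonneg_nonneg mult_pos_pos zero_le_mult_iff)
  have injh: "inj h" and injs: "inj s" by (auto simp: h_def s_def inj_on_def)
  have n_sum: "(n has_sum norm f) UNIV" unfolding n_def by (rule norm_has_sum)
  have n0: "n p \<ge> 0" for p by (simp add: n_def case_prod_unfold dweight_pos less_imp_le)
  have "n summable_on (range s)"
    using n_sum by (rule summable_on_subset[OF has_sum_imp_summable]) auto
  then obtain S where S: "(n has_sum S) (range s)" by (auto simp: summable_on_def)
  have Sle: "S \<le> norm f"
    by (rule has_sum_mono2[OF S n_sum]) (use n0 in auto)
  have "((n \<circ> s) has_sum S) UNIV" using S has_sum_reindex[OF injs] by blast
  then have m: "((\<lambda>p. B * (n \<circ> s) p) has_sum B * S) UNIV" by (rule has_sum_cmult_right)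
  define m' where "m' = (\<lambda>(j, k). if b \<le> k then B * n (j + a, k - b) else 0)"
  have "((m' \<circ> h) has_sum B * S) UNIV"
    using m by (simp add: m'_def h_def s_def o_def case_prod_unfold)
  moreover have "m' p = 0" if "p \<notin> range h" for p
  proof -
    obtain j k where jk: "p = (j, k)" by force
    have "\<not> b \<le> k"
    proof
      assume "b \<le> k"
      then have "p = h (j, k - b)" by (simp add: h_def jk)
      then show False using that by blast
    qed
    then show ?thesis by (simp add: m'_def jk)
  qed
  ultimately have m'_sum: "(m' has_sum B * S) UNIV" using has_sum_UNIV_reindex[OF injh] by blast
  have le: "\<bar>fps2_nth (F f) j k\<bar> * dweight j k \<le> (if b \<le> k then B * n (j + a, k - b) else 0)" for j k
  proof (cases "b \<le> k")
    case True
    have "\<bar>\<mu> j (k - b)\<bar> * dweight j k * \<bar>coef f (j + a) (k - b)\<bar> \<le> B * dweight (j + a) (k - b) * \<bar>coef f (j + a) (k - b)\<bar>"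
      using \<mu>[of j "k - b"] True by (intro mult_right_mono) auto
    then show ?thesis using True by (simp add: F_def n_def abs_mult mult_ac)
  qed (simp add: F_def)
  note d = wsummable_dominated[OF m'_sum[unfolded m'_def] le]
  show "wsummable (F f)" by (rule d)
  show "wnorm (F f) \<le> B * norm f"
    using d(2) mult_left_mono[OF Sle B0] by linarith
qed

lemma coef_shift_op:
  "coef (shift_op \<mu> a b f) j k = (if b \<le> k then \<mu> j (k - b) * coef f (j + a) (k - b) else 0)"
  unfolding shift_op_def coef_def[of "Abs_dseries _"]
  by (subst Abs_dseries_inverse) (use shift_op_aux(1) in auto)

lemma norm_shift_op: "norm (shift_op \<mu> a b f) \<le> B * norm f"
  using shift_op_aux[of f] unfolding shift_op_def norm_dseries.rep_eq by (simp add: Abs_dseries_inverse)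

lemma shift_op_diff: "shift_op \<mu> a b f - shift_op \<mu> a b g = shift_op \<mu> a b (f - g)"
  by (rule dseries_eqI) (simp add: coef_shift_op algebra_simps)

end

section \<open>Solution of the rescaled equation\<close>

lemma dweight_fact: "dweight j k = 3 ^ (j + k) * fact j * fact k / fact (j + k)"
proof -
  have "real ((j + k) choose k) = fact (j + k) / (fact k * fact j)"
    using binomial_fact[of k "j + k", where 'a = real] by simp
  then show ?thesis by (simp add: dweight_def)
qed

lemma dweight_Suc_le: "dweight j (Suc k) \<le> 3 * dweight j k"
proof -
  have "(j + k) choose k \<le> (j + Suc k) choose Suc k" by simp
  then have "1 / real ((j + Suc k) choose Suc k) \<le> 1 / real ((j + k) choose k)"
    by (intro divide_left_mono) (simp_all del: binomial_Suc_Suc)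
  then have "3 ^ (j + Suc k) * (1 / real ((j + Suc k) choose Suc k)) \<le> 3 ^ (j + Suc k) * (1 / real ((j + k) choose k))"
    by (rule mult_left_mono) simp
  then show ?thesis by (simp add: dweight_def)
qed

text \<open>The balance on which the method rests: the factor \<open>j + 1\<close> produced by an
  x-derivative becomes a factor \<open>k + 1\<close>, and this is absorbed by the denominators of
  the integration in r.\<close>

lemma dweight_shift: "real (Suc j) * dweight j (Suc k) = real (Suc k) * dweight (Suc j) k"
  by (simp add: dweight_fact)

text \<open>For a series \<open>g\<close> in \<open>x\<close> and \<open>r\<close>, \<open>inv_L m g\<close> is the solution \<open>W\<close> of
  \<open>W\<^sub>r\<^sub>r + (m / r) W\<^sub>r = g\<close> with \<open>W = W\<^sub>r = 0\<close> at \<open>r = 0\<close>; the other operators give the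
  derivatives of \<open>W\<close>, with \<open>inv_L_A\<close> for \<open>W\<^sub>r / r\<close>. The weights \<open>dweight\<close> make the second derivatives
  bounded, in spite of the loss of \<open>x\<close>-derivatives.\<close>

definition inv_L :: "nat \<Rightarrow> dseries \<Rightarrow> dseries" where
  "inv_L m = shift_op (\<lambda>j k. 1 / (real (k + 2) * real (k + 1 + m))) 0 2"
definition inv_L_A :: "nat \<Rightarrow> dseries \<Rightarrow> dseries" where
  "inv_L_A m = shift_op (\<lambda>j k. 1 / real (k + 1 + m)) 0 0"
definition inv_L_rr :: "nat \<Rightarrow> dseries \<Rightarrow> dseries" where
  "inv_L_rr m = shift_op (\<lambda>j k. real (k + 1) / real (k + 1 + m)) 0 0"
definition inv_L_x :: "nat \<Rightarrow> dseries \<Rightarrow> dseries" where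
  "inv_L_x m = shift_op (\<lambda>j k. real (j + 1) / (real (k + 2) * real (k + 1 + m))) 1 2"
definition inv_L_xx :: "nat \<Rightarrow> dseries \<Rightarrow> dseries" where
  "inv_L_xx m = shift_op (\<lambda>j k. real (j + 2) * real (j + 1) / (real (k + 2) * real (k + 1 + m))) 2 2"
definition inv_L_xr :: "nat \<Rightarrow> dseries \<Rightarrow> dseries" where
  "inv_L_xr m = shift_op (\<lambda>j k. real (j + 1) / real (k + 1 + m)) 1 1"

text \<open>The operator W_rr + (m / r) W_r maps \<open>r ^ (k + 2)\<close> to
  \<open>(k + 2) * (k + 1 + m)\<close> times \<open>r ^ k\<close>, whence the denominators. A shift
  by one in r raises the weight by at most 3, so two shifts by at most 9; each x-derivative is paid
  by one of the shifts through \<open>dweight_shift\<close>.\<close>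

lemma inv_L_bounds:
  shows "\<bar>1 / (real (k + 2) * real (k + 1 + m))\<bar> * dweight j (k + 2) \<le> 9 * dweight (j + 0) k" (is ?w)
    and "\<bar>1 / real (k + 1 + m)\<bar> * dweight j (k + 0) \<le> 9 * dweight (j + 0) k" (is ?A)
    and "\<bar>real (k + 1) / real (k + 1 + m)\<bar> * dweight j (k + 0) \<le> 9 * dweight (j + 0) k" (is ?rr)
    and "\<bar>real (j + 1) / (real (k + 2) * real (k + 1 + m))\<bar> * dweight j (k + 2) \<le> 9 * dweight (j + 1) k" (is ?x)
    and "\<bar>real (j + 2) * real (j + 1) / (real (k + 2) * real (k + 1 + m))\<bar> * dweight j (k + 2) \<le> 9 * dweight (j + 2) k" (is ?xx)
    and "\<bar>real (j + 1) / real (k + 1 + m)\<bar> * dweight j (k + 1) \<le> 9 * dweight (j + 1) k" (is ?xr)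
proof -
  have le: "c * a \<le> 9 * b" if "0 \<le> c" "c \<le> 1" "a \<le> 9 * b" "a \<ge> 0" for a b c :: real
    using mult_right_mono[OF that(2,4)] that(3) by simp
  have le1: "1 / real (k + 1 + m) \<le> 1" "1 / (real (k + 2) * real (k + 1 + m)) \<le> 1"
    "real (k + 1) / real (k + 1 + m) \<le> 1"
  proof -
    have "1 * 1 \<le> real (k + 2) * real (k + 1 + m)" by (intro mult_mono) auto
    then show "1 / (real (k + 2) * real (k + 1 + m)) \<le> 1" by (simp add: divide_le_eq_1)
  qed (auto simp: divide_le_eq_1)
  have n: "dweight j k \<ge> 0" for j k using dweight_pos[of j k] by simp
  have w1: "dweight j (Suc k) \<le> 3 * dweight j k" for j by (rule dweight_Suc_le)
  have w2: "dweight j (Suc (Suc k)) \<le> 9 * dweight j k" for j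
    using dweight_Suc_le[of j "Suc k"] dweight_Suc_le[of j k] by linarith
  show ?w using le[OF _ le1(2), of "dweight j (Suc (Suc k))" "dweight j k"] w2[of j] n[of j "Suc (Suc k)"] by simp
  show ?A using le[OF _ le1(1), of "dweight j k" "dweight j k"] n[of j k] by simp
  show ?rr using le[OF _ le1(3), of "dweight j k" "dweight j k"] n[of j k] by simp
  show ?xr
  proof -
    have "\<bar>real (j + 1) / real (k + 1 + m)\<bar> * dweight j (k + 1) = real (Suc j) * dweight j (Suc k) / real (k + 1 + m)" by simp
    also have "\<dots> = real (k + 1) / real (k + 1 + m) * dweight (j + 1) k" by (simp add: dweight_shift del: of_nat_Suc)
    also have "\<dots> \<le> 9 * dweight (j + 1) k" by (rule le[OF _ le1(3)]) (use n in auto)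
    finally show ?thesis .
  qed
  have 2: "real (Suc j) * dweight j (Suc (Suc k)) = real (k + 2) * dweight (Suc j) (Suc k)" for j
    using dweight_shift[of j "Suc k"] by simp
  show ?x
  proof -
    have "\<bar>real (j + 1) / (real (k + 2) * real (k + 1 + m))\<bar> * dweight j (k + 2)
        = real (Suc j) * dweight j (Suc (Suc k)) / (real (k + 2) * real (k + 1 + m))" by simp
    also have "\<dots> = 1 / real (k + 1 + m) * dweight (Suc j) (Suc k)" unfolding 2 by (simp add: divide_simps)
    also have "\<dots> \<le> 9 * dweight (j + 1) k"
      by (rule le[OF _ le1(1)]) (use n dweight_Suc_le[of "Suc j" k] order.trans[OF _ mult_right_mono[OF _ n[of "Suc j" k], of 3 9]] in auto)
    finally show ?thesis .
  qed
  show ?xx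
  proof -
    have "\<bar>real (j + 2) * real (j + 1) / (real (k + 2) * real (k + 1 + m))\<bar> * dweight j (k + 2)
        = real (j + 2) * (real (Suc j) * dweight j (Suc (Suc k))) / (real (k + 2) * real (k + 1 + m))" by simp
    also have "\<dots> = real (Suc (Suc j)) * dweight (Suc j) (Suc k) / real (k + 1 + m)" unfolding 2 by (simp add: divide_simps)
    also have "\<dots> = real (k + 1) / real (k + 1 + m) * dweight (j + 2) k"
      unfolding dweight_shift by simp
    also have "\<dots> \<le> 9 * dweight (j + 2) k" by (rule le[OF _ le1(3)]) (use n in auto)
    finally show ?thesis .
  qed
qed

lemmas inv_L_defs = inv_L_def inv_L_A_def inv_L_rr_def inv_L_x_def inv_L_xx_def inv_L_xr_def

lemma coef_inv_L:
  "coef (inv_L m f) j k = (if 2 \<le> k then 1 / (real (k - 2 + 2) * real (k - 2 + 1 + m)) * coef f (j + 0) (k - 2) else 0)"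
  "coef (inv_L_A m f) j k = (if 0 \<le> k then 1 / real (k - 0 + 1 + m) * coef f (j + 0) (k - 0) else 0)"
  "coef (inv_L_rr m f) j k = (if 0 \<le> k then real (k - 0 + 1) / real (k - 0 + 1 + m) * coef f (j + 0) (k - 0) else 0)"
  "coef (inv_L_x m f) j k = (if 2 \<le> k then real (j + 1) / (real (k - 2 + 2) * real (k - 2 + 1 + m)) * coef f (j + 1) (k - 2) else 0)"
  "coef (inv_L_xx m f) j k = (if 2 \<le> k then real (j + 2) * real (j + 1) / (real (k - 2 + 2) * real (k - 2 + 1 + m)) * coef f (j + 2) (k - 2) else 0)"
  "coef (inv_L_xr m f) j k = (if 1 \<le> k then real (j + 1) / real (k - 1 + 1 + m) * coef f (j + 1) (k - 1) else 0)"
  unfolding inv_L_defs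
  by (rule coef_shift_op[OF inv_L_bounds(1)] coef_shift_op[OF inv_L_bounds(2)]
      coef_shift_op[OF inv_L_bounds(3)] coef_shift_op[OF inv_L_bounds(4)]
      coef_shift_op[OF inv_L_bounds(5)] coef_shift_op[OF inv_L_bounds(6)])+

definition bounded_op :: "(dseries \<Rightarrow> dseries) \<Rightarrow> bool" where
  "bounded_op T \<longleftrightarrow> (\<forall>f. norm (T f) \<le> 9 * norm f) \<and> (\<forall>f g. T f - T g = T (f - g))"

lemma bounded_op_shift_op:
  assumes "\<And>j k. \<bar>\<mu> j k\<bar> * dweight j (k + b) \<le> 9 * dweight (j + a) k"
  shows "bounded_op (shift_op \<mu> a b)"
  using norm_shift_op[OF assms] shift_op_diff[OF assms] by (auto simp: bounded_op_def)

lemma bounded_op_inv_L: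
  "bounded_op (inv_L m)" "bounded_op (inv_L_A m)" "bounded_op (inv_L_rr m)" "bounded_op (inv_L_x m)"
  "bounded_op (inv_L_xx m)" "bounded_op (inv_L_xr m)"
  unfolding inv_L_defs by (rule bounded_op_shift_op[OF inv_L_bounds(1)] bounded_op_shift_op[OF inv_L_bounds(2)]
      bounded_op_shift_op[OF inv_L_bounds(3)] bounded_op_shift_op[OF inv_L_bounds(4)]
      bounded_op_shift_op[OF inv_L_bounds(5)] bounded_op_shift_op[OF inv_L_bounds(6)])+

text \<open>\<open>h e\<close> is the Lipschitz modulus on the ball of radius \<open>R\<close>:
  \<open>h e = e\<close> when the series enters through \<open>e\<close> times a bounded operator,
  \<open>h e = 1\<close> for such an operator itself. Uniformity in \<open>e\<close> allows a radius
  to be fixed before \<open>e\<close> is.\<close>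

definition lip_bound :: "(real \<Rightarrow> real) \<Rightarrow> real \<Rightarrow> (real \<Rightarrow> dseries \<Rightarrow> dseries) \<Rightarrow> real \<Rightarrow> bool" where
  "lip_bound h R \<Phi> B \<longleftrightarrow> 0 \<le> B \<and> (\<forall>e\<in>{0..1}. \<forall>f g. norm f \<le> R \<longrightarrow> norm g \<le> R \<longrightarrow>
      norm (\<Phi> e f) \<le> B \<and> norm (\<Phi> e f - \<Phi> e g) \<le> B * (h e * norm (f - g)))"

definition lip :: "(real \<Rightarrow> real) \<Rightarrow> real \<Rightarrow> (real \<Rightarrow> dseries \<Rightarrow> dseries) \<Rightarrow> bool" where
  "lip h R \<Phi> \<longleftrightarrow> (\<exists>B. lip_bound h R \<Phi> B)"

abbreviation "lipB \<equiv> lip (\<lambda>e. 1)"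
abbreviation "lipE \<equiv> lip (\<lambda>e. e)"

section \<open>Calculus of Lipschitz constants\<close>

lemma lip_add_aux:
  fixes a b a' b' :: "'a::real_normed_vector"
  assumes "norm a \<le> A" "norm b \<le> B" "norm (a - a') \<le> A * s" "norm (b - b') \<le> B * s"
  shows "norm (a + b) \<le> A + B \<and> norm ((a + b) - (a' + b')) \<le> (A + B) * s"
  using norm_triangle_le[of a b "A + B"] norm_triangle_le[of "a - a'" "b - b'" "(A + B) * s"] assms
  by (simp add: algebra_simps)

text \<open>The factor 2 collects the two terms of \<open>(a - a') * b + a' * (b - b')\<close>, so
  that one constant bounds both the size and the Lipschitz quotient.\<close>

lemma lip_mult_aux:
  fixes a b a' b' :: "'a::real_normed_algebra"
  assumes "norm a \<le> A" "norm b \<le> B" "norm a' \<le> A" "norm (a - a') \<le> A * s" "norm (b - b') \<le> B * s"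
    "A \<ge> 0" "B \<ge> 0" "s \<ge> 0"
  shows "norm (a * b) \<le> 2 * A * B \<and> norm (a * b - a' * b') \<le> (2 * A * B) * s"
proof
  have "norm (a * b) \<le> A * B" by (meson assms mult_mono norm_mult_ineq norm_ge_zero order_trans)
  then show "norm (a * b) \<le> 2 * A * B" using mult_nonneg_nonneg[OF assms(6,7)] by simp
  have "a * b - a' * b' = (a - a') * b + a' * (b - b')" by (simp add: algebra_simps)
  then have "norm (a * b - a' * b') \<le> norm ((a - a') * b) + norm (a' * (b - b'))" by (metis norm_triangle_ineq)
  also have "norm ((a - a') * b) \<le> (A * s) * B"
    by (meson assms mult_mono norm_mult_ineq norm_ge_zero order_trans mult_nonneg_nonneg)
  also have "norm (a' * (b - b')) \<le> A * (B * s)"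
    by (meson assms mult_mono norm_mult_ineq norm_ge_zero order_trans mult_nonneg_nonneg)
  finally show "norm (a * b - a' * b') \<le> (2 * A * B) * s" by (simp add: algebra_simps)
qed

lemma lip_mult:
  assumes "lip h R \<Phi>" "lip h R \<Psi>" and h: "\<And>e. e \<in> {0..1} \<Longrightarrow> 0 \<le> h e"
  shows "lip h R (\<lambda>e f. \<Phi> e f * \<Psi> e f)"
proof -
  obtain A B where "lip_bound h R \<Phi> A" "lip_bound h R \<Psi> B" using assms(1,2) by (auto simp: lip_def)
  then have "lip_bound h R (\<lambda>e f. \<Phi> e f * \<Psi> e f) (2 * A * B)"
    unfolding lip_bound_def
    by (intro conjI[OF _ ballI[OF allI[OF allI[OF impI[OF impI]]]]] lip_mult_aux) (use h in auto)
  then show ?thesis by (auto simp: lip_def)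
qed

lemma lip_add:
  assumes "lip h R \<Phi>" "lip h R \<Psi>"
  shows "lip h R (\<lambda>e f. \<Phi> e f + \<Psi> e f)"
proof -
  obtain A B where "lip_bound h R \<Phi> A" "lip_bound h R \<Psi> B" using assms by (auto simp: lip_def)
  then have "lip_bound h R (\<lambda>e f. \<Phi> e f + \<Psi> e f) (A + B)"
    unfolding lip_bound_def
    by (intro conjI[OF _ ballI[OF allI[OF allI[OF impI[OF impI]]]]] lip_add_aux) auto
  then show ?thesis by (auto simp: lip_def)
qed

lemma lip_const: "(\<And>e. e \<in> {0..1} \<Longrightarrow> 0 \<le> h e) \<Longrightarrow> lip h R (\<lambda>e f. a)"
  unfolding lip_def lip_bound_def by (intro exI[of _ "norm a"]) auto

lemma lip_scaleR:
  assumes "lip h R \<Phi>" "\<And>e. e \<in> {0..1} \<Longrightarrow> 0 \<le> h e"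
  shows "lip h R (\<lambda>e f. c *\<^sub>R \<Phi> e f)"
  using lip_mult[OF lip_const[of h R "c *\<^sub>R 1"] assms(1)] assms(2) by simp

lemma lip_diff:
  assumes "lip h R \<Phi>" "lip h R \<Psi>" "\<And>e. e \<in> {0..1} \<Longrightarrow> 0 \<le> h e"
  shows "lip h R (\<lambda>e f. \<Phi> e f - \<Psi> e f)"
  using lip_add[OF assms(1) lip_scaleR[OF assms(2,3), of "-1"]] by simp

lemma lipB_op: assumes "bounded_op T" shows "lipB R (\<lambda>e f. T f)"
  unfolding lip_def lip_bound_def
proof (intro exI[of _ "9 * max R 1"] conjI ballI allI impI)
  fix f g :: dseries assume fg: "norm f \<le> R" "norm g \<le> R"
  have 1: "norm (T f) \<le> 9 * norm f" "norm (T f - T g) \<le> 9 * norm (f - g)"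
    using assms by (auto simp: bounded_op_def)
  then show "norm (T f) \<le> 9 * max R 1" using fg by (simp add: max_def)
  have "9 * norm (f - g) \<le> 9 * max R 1 * norm (f - g)" by (intro mult_right_mono) auto
  then show "norm (T f - T g) \<le> 9 * max R 1 * (1 * norm (f - g))" using 1(2) by simp
qed auto

lemma lipE_scale_e: assumes "lipB R \<Phi>" shows "lipE R (\<lambda>e f. e *\<^sub>R \<Phi> e f)"
proof -
  obtain B where B: "lip_bound (\<lambda>e. 1) R \<Phi> B" using assms by (auto simp: lip_def)
  have "lip_bound (\<lambda>e. e) R (\<lambda>e f. e *\<^sub>R \<Phi> e f) B"
    unfolding lip_bound_def
  proof (intro conjI ballI allI impI)
    show "0 \<le> B" using B by (simp add: lip_bound_def)
    fix e :: real and f g :: dseries assume e: "e \<in> {0..1}" and fg: "norm f \<le> R" "norm g \<le> R"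
    have b: "norm (\<Phi> e f) \<le> B" "norm (\<Phi> e f - \<Phi> e g) \<le> B * norm (f - g)" "0 \<le> B"
      using B e fg by (simp_all add: lip_bound_def)
    show "norm (e *\<^sub>R \<Phi> e f) \<le> B" using b(1,3) e mult_mono[of e 1 "norm (\<Phi> e f)" B] by simp
    show "norm (e *\<^sub>R \<Phi> e f - e *\<^sub>R \<Phi> e g) \<le> B * (e * norm (f - g))"
      using e mult_left_mono[OF b(2), of e] by (simp add: mult_ac flip: scaleR_diff_right)
  qed
  then show ?thesis by (auto simp: lip_def)
qed

lemma lipE_imp_lipB: assumes "lipE R \<Phi>" shows "lipB R \<Phi>"
proof -
  obtain B where B: "lip_bound (\<lambda>e. e) R \<Phi> B" using assms by (auto simp: lip_def)
  have "B * (e * norm (f - g)) \<le> B * (1 * norm (f - g))" if "e \<in> {0..1}" for e :: real and f g :: dseries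
    using that B by (intro mult_left_mono mult_right_mono) (auto simp: lip_bound_def)
  then have "lip_bound (\<lambda>e. 1) R \<Phi> B" using B unfolding lip_bound_def by (meson order_trans)
  then show ?thesis by (auto simp: lip_def)
qed

section \<open>Parity in r, which makes the solution a function of r^2 and hence smooth across the
  axis\<close>

definition evenr :: "dseries \<Rightarrow> bool" where "evenr f \<longleftrightarrow> (\<forall>j k. odd k \<longrightarrow> coef f j k = 0)"
definition oddr :: "dseries \<Rightarrow> bool" where "oddr f \<longleftrightarrow> (\<forall>j k. even k \<longrightarrow> coef f j k = 0)"

lemma parity_mult:
  "evenr f \<Longrightarrow> evenr g \<Longrightarrow> evenr (f * g)"
  "oddr f \<Longrightarrow> oddr g \<Longrightarrow> evenr (f * g)"
  "evenr f \<Longrightarrow> oddr g \<Longrightarrow> oddr (f * g)"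
  "oddr f \<Longrightarrow> evenr g \<Longrightarrow> oddr (f * g)"
  unfolding evenr_def oddr_def coef_mult
  by (auto intro!: sum.neutral) (metis even_diff_nat le_add_diff_inverse even_add mult_eq_0_iff)+

lemma parity_linear:
  "evenr f \<Longrightarrow> evenr g \<Longrightarrow> evenr (f + g)" "evenr f \<Longrightarrow> evenr g \<Longrightarrow> evenr (f - g)" "evenr f \<Longrightarrow> evenr (c *\<^sub>R f)"
  "oddr f \<Longrightarrow> oddr g \<Longrightarrow> oddr (f + g)" "oddr f \<Longrightarrow> oddr g \<Longrightarrow> oddr (f - g)" "oddr f \<Longrightarrow> oddr (c *\<^sub>R f)"
  "evenr 1" "evenr 0"
  by (auto simp: evenr_def oddr_def coef_one)

lemma parity_monom2: "even b \<Longrightarrow> evenr (monom2 a b)" "odd b \<Longrightarrow> oddr (monom2 a b)"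
  by (auto simp: evenr_def oddr_def coef_monom2)

lemma parity_inv_L:
  assumes "evenr g"
  shows "evenr (inv_L m g)" "evenr (inv_L_A m g)" "evenr (inv_L_rr m g)" "evenr (inv_L_x m g)"
    "evenr (inv_L_xx m g)" "oddr (inv_L_xr m g)"
  using assms unfolding evenr_def oddr_def coef_inv_L by auto

lemma closed_evenr: "closed {f. evenr f}"
proof (rule closed_sequential_limits[THEN iffD2], safe)
  fix X and l :: dseries assume X: "\<forall>n. X n \<in> {f. evenr f}" "X \<longlonglongrightarrow> l"
  show "evenr l"
    unfolding evenr_def
  proof (intro allI impI)
    fix j k :: nat assume k: "odd k"
    have "(\<lambda>n. norm (l - X n)) \<longlonglongrightarrow> 0"
      using tendsto_norm[OF tendsto_diff[OF tendsto_const[of l] X(2)]] by simp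
    moreover have "\<bar>coef l j k\<bar> * dweight j k \<le> norm (l - X n)" for n
      using coef_bound[of "l - X n" j k] X(1) k by (auto simp: evenr_def)
    ultimately have "\<bar>coef l j k\<bar> * dweight j k \<le> 0"
      by (meson LIMSEQ_le_const)
    then show "coef l j k = 0" using dweight_pos[of j k] by (simp add: mult_le_0_iff)
  qed
qed

text \<open>The size of \<open>\<Phi> e 0\<close> is bounded independently of \<open>e\<close>,
  which fixes a ball; on that ball the Lipschitz constant is proportional to \<open>e\<close>, so
  for small \<open>e\<close> Banach's theorem applies. Even series form a closed invariant set, and
  the iteration takes place inside it.\<close>

lemma small_parameter_fixed_point:
  fixes \<Phi> :: "real \<Rightarrow> dseries \<Rightarrow> dseries"
  assumes lip: "\<And>R. lipE R \<Phi>" and deval: "\<And>e f. evenr f \<Longrightarrow> evenr (\<Phi> e f)"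
  shows "\<exists>e0 R. 0 < e0 \<and> e0 \<le> 1 \<and> (\<forall>e. 0 < e \<and> e \<le> e0 \<longrightarrow> (\<exists>g. evenr g \<and> norm g \<le> R \<and> \<Phi> e g = g))"
proof -
  obtain B0 where B0: "B0 \<ge> 0" "\<And>e. e \<in> {0..1} \<Longrightarrow> norm (\<Phi> e 0) \<le> B0"
    using lip[of 0] unfolding lip_def lip_bound_def by (metis norm_zero order_refl)
  define R where "R = B0 + 1"
  obtain B where B: "B \<ge> 0" "\<And>e f g. e \<in> {0..1} \<Longrightarrow> norm f \<le> R \<Longrightarrow> norm g \<le> R \<Longrightarrow>
      norm (\<Phi> e f - \<Phi> e g) \<le> B * (e * norm (f - g))"
    using lip[of R] unfolding lip_def lip_bound_def by blast
  \<comment> \<open>This makes \<open>B * R * e\<close> and \<open>B * e\<close> at most 1/2 for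
    \<open>e\<close> up to \<open>e0\<close>. The first, with \<open>R = B0 + 1\<close>, maps the
    ball into itself; the second gives the contraction factor.\<close>
  define e0 where "e0 = 1 / (2 * (B * R + B + 1))"
  have R1: "R \<ge> 1" using B0(1) by (simp add: R_def)
  have BR: "B * R \<ge> 0" using B(1) R1 by simp
  have e0: "0 < e0" "e0 \<le> 1" using B(1) BR by (simp_all add: e0_def divide_le_eq_1)
  have "\<exists>g. evenr g \<and> norm g \<le> R \<and> \<Phi> e g = g" if e: "0 < e" "e \<le> e0" for e
  proof -
    have e1: "e \<in> {0..1}" using e e0 by auto
    have small: "B * R * e \<le> 1 / 2" "B * e \<le> 1 / 2"
    proof -
      have "e * (2 * (B * R + B + 1)) \<le> 1" using e(2) B(1) BR by (simp add: e0_def field_simps)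
      moreover have "e * (B * R) \<ge> 0" "e * B \<ge> 0" using e B(1) BR by simp_all
      ultimately show "B * R * e \<le> 1 / 2" "B * e \<le> 1 / 2" using e(1) by (simp_all add: algebra_simps)
    qed
    define S where "S = {f. evenr f} \<inter> cball 0 R"
    have S: "complete S" "S \<noteq> {}"
      using closed_evenr R1 parity_linear(8) by (auto simp: S_def complete_eq_closed disjoint_iff intro!: exI[of _ 0])
    have into: "\<Phi> e ` S \<subseteq> S"
    proof safe
      fix f assume f: "f \<in> S"
      have "norm (\<Phi> e f) \<le> norm (\<Phi> e 0) + norm (\<Phi> e f - \<Phi> e 0)" by (metis add.commute norm_triangle_sub)
      also have "norm (\<Phi> e f - \<Phi> e 0) \<le> B * (e * norm (f - 0))"
        using B(2)[OF e1, of f 0] f R1 by (simp add: S_def)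
      also have "B * (e * norm (f - 0)) \<le> B * (e * R)"
        using f e B(1) by (intro mult_left_mono) (auto simp: S_def)
      finally have "norm (\<Phi> e f) \<le> R" using B0(2)[OF e1] small(1) by (simp add: mult.commute[of e R] mult.assoc) (simp add: R_def)
      then show "\<Phi> e f \<in> S" using f deval by (simp add: S_def)
    qed
    have "dist (\<Phi> e f) (\<Phi> e g) \<le> 1 / 2 * dist f g" if "f \<in> S" "g \<in> S" for f g
    proof -
      have "norm (\<Phi> e f - \<Phi> e g) \<le> B * (e * norm (f - g))" using B(2)[OF e1] that by (simp add: S_def)
      also have "\<dots> \<le> 1 / 2 * norm (f - g)" using mult_right_mono[OF small(2), of "norm (f - g)"] by (simp add: mult_ac)
      finally show ?thesis by (simp add: dist_norm)
    qed
    then have "\<exists>!g\<in>S. \<Phi> e g = g" using Banach_fix[OF S _ _ into, of "1 / 2"] by simp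
    then show ?thesis by (auto simp: S_def)
  qed
  then show ?thesis using e0 by blast
qed


lemma deval_simps:
  assumes "\<bar>x\<bar> + \<bar>r\<bar> \<le> 3"
  shows "deval x r (f + g) = deval x r f + deval x r g" "deval x r (f - g) = deval x r f - deval x r g"
    "deval x r (f * g) = deval x r f * deval x r g" "deval x r (c *\<^sub>R f) = c * deval x r f" "deval x r 1 = 1"
    "deval x r (monom2 a b) = x ^ a * r ^ b"
  using assms by (rule deval_add deval_diff deval_mult deval_scaleR deval_one deval_monom2)+

text \<open>For \<open>u = e V(x, r)\<close> with \<open>r = |x'| / sqrt e\<close>, the equation \<open>\<sigma>\<^sub>2(\<kappa>) = (1 + |Du|\<^sup>2)\<^sup>-\<^sup>2\<close> in dimension
  \<open>m + 2\<close> reads as follows, where \<open>a, b, A, p, k, h\<close> are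
  \<open>V\<^sub>x, V\<^sub>x\<^sub>x, V\<^sub>r / r, V\<^sub>r, V\<^sub>x\<^sub>r, V\<^sub>r\<^sub>r\<close>. At \<open>e = 0\<close> it degenerates to an equation in \<open>r\<close> alone, solved by
  \<open>c (r\<^sup>2 / 2 - q(x))\<close> for every \<open>q\<close>.\<close>

definition reduced_equation :: "real \<Rightarrow> real \<Rightarrow> real \<Rightarrow> real \<Rightarrow> real \<Rightarrow> real \<Rightarrow> real \<Rightarrow> real \<Rightarrow> bool" where
  "reduced_equation m e a b A p k h \<longleftrightarrow>
    e * (b * h - k\<^sup>2) + m * A * ((1 + e * p\<^sup>2) * (e * b) - 2 * e\<^sup>2 * a * p * k + (1 + e\<^sup>2 * a\<^sup>2) * h)
      + m * (m - 1) / 2 * A\<^sup>2 * (1 + e\<^sup>2 * a\<^sup>2 + e * p\<^sup>2) = 1"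

text \<open>A derivative of an element of the weighted algebra need not lie in the algebra again.
  The derivatives are therefore separate elements, tied to \<open>V\<close> by their coefficients;
  \<open>A\<close> is V_r / r.\<close>

definition series_profile :: "nat \<Rightarrow> real \<Rightarrow> real \<Rightarrow> real \<Rightarrow> real \<Rightarrow>
    dseries \<Rightarrow> dseries \<Rightarrow> dseries \<Rightarrow> dseries \<Rightarrow> dseries \<Rightarrow> dseries \<Rightarrow> bool" where
  "series_profile m c d e \<delta> V Vx Vxx A Vrr Vxr \<longleftrightarrow>
    evenr V \<and> evenr A \<and> evenr Vrr \<and> evenr Vx \<and> evenr Vxx \<and> oddr Vxr \<and>
    (\<forall>j k. coef Vx j k = real (j + 1) * coef V (j + 1) k) \<and>
    (\<forall>j k. coef Vxx j k = real (j + 2) * real (j + 1) * coef V (j + 2) k) \<and>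
    (\<forall>j k. coef A j k = real (k + 2) * coef V j (k + 2)) \<and>
    (\<forall>j k. coef Vrr j k = real (k + 2) * real (k + 1) * coef V j (k + 2)) \<and>
    (\<forall>j k. coef Vxr j k = real (j + 1) * real (k + 1) * coef V (j + 1) (k + 1)) \<and>
    (\<forall>x r. \<bar>x\<bar> + \<bar>r\<bar> \<le> 3 \<longrightarrow>
      \<bar>deval x r V - c * (r\<^sup>2 / 2 - x * (x - d) * (1 - x))\<bar> \<le> \<delta> \<and>
      \<bar>deval x r Vx - c * (3 * x\<^sup>2 - 2 * (1 + d) * x + d)\<bar> \<le> \<delta> \<and>
      \<bar>deval x r Vxx - c * (6 * x - 2 * (1 + d))\<bar> \<le> \<delta> \<and>
      \<bar>deval x r A - c\<bar> \<le> \<delta> \<and> \<bar>deval x r Vrr - c\<bar> \<le> \<delta> \<and> \<bar>deval x r Vxr\<bar> \<le> \<delta> \<and>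
      reduced_equation (real m) e (deval x r Vx) (deval x r Vxx) (deval x r A) (r * deval x r A) (deval x r Vxr) (deval x r Vrr)) \<and>
    (\<forall>x. \<bar>x\<bar> \<le> 3 \<longrightarrow> deval x 0 V = - c * (x * (x - d) * (1 - x)))"

text \<open>Insert V = \<open>pV\<close> + e W with W = \<open>inv_L m g\<close>. The part of order
  zero cancels because m c^2 + m (m - 1) / 2 c^2 = 1, which is the origin of \<open>c\<close>; the
  linear part of the degenerate terms is m c (W_rr + (m / r) W_r) = m c g. After division by
  \<open>e\<close> there remains g = - N / (m c), a fixed point equation whose right-hand side has a
  Lipschitz constant proportional to \<open>e\<close>.\<close>

theorem exists_profile_solution:
  fixes m :: nat and d :: real
  assumes m: "m \<ge> 1"
  defines "c \<equiv> sqrt (2 / (real m * (real m + 1)))"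
  shows "\<exists>e0 K. 0 < e0 \<and> e0 \<le> 1 \<and> K \<ge> 0 \<and> (\<forall>e. 0 < e \<and> e \<le> e0 \<longrightarrow>
    (\<exists>V Vx Vxx A Vrr Vxr. series_profile m c d e (e * K) V Vx Vxx A Vrr Vxr))"
proof -
  define M where "M = real m"
  have M: "M \<ge> 1" using m by (simp add: M_def)
  have c0: "c > 0" using M by (simp add: c_def M_def)
  have c2: "c\<^sup>2 * (M * (M + 1)) = 2" using M by (simp add: c_def flip: M_def)
  define C where "C = M * (M - 1) / 2"
  define X where "X = monom2 1 0"
  define r1 where "r1 = monom2 0 1"
  define pV where "pV = c *\<^sub>R ((1/2) *\<^sub>R monom2 0 2 + monom2 3 0 - (1 + d) *\<^sub>R monom2 2 0 + d *\<^sub>R monom2 1 0)"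
  define px where "px = c *\<^sub>R (3 *\<^sub>R monom2 2 0 - (2 * (1 + d)) *\<^sub>R monom2 1 0 + d *\<^sub>R 1)"
  define pxx where "pxx = c *\<^sub>R (6 *\<^sub>R monom2 1 0 - (2 * (1 + d)) *\<^sub>R 1)"
  define Vx where "Vx e g = px + e *\<^sub>R inv_L_x m g" for e g
  define Vxx where "Vxx e g = pxx + e *\<^sub>R inv_L_xx m g" for e g
  define A where "A e g = c *\<^sub>R 1 + e *\<^sub>R inv_L_A m g" for e g
  define Vrr where "Vrr e g = c *\<^sub>R 1 + e *\<^sub>R inv_L_rr m g" for e g
  define Vxr where "Vxr e g = e *\<^sub>R inv_L_xr m g" for e g
  define Vr where "Vr e g = r1 * A e g" for e g
  define V where "V e g = pV + e *\<^sub>R inv_L m g" for e g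
  \<comment> \<open>The equation divided by \<open>e\<close>, without its order-zero and linear
    parts. The last summand is the quadratic remainder of the degenerate expression in
    \<open>A\<close> and \<open>Vrr\<close>; a factor \<open>e\<close> survives in it.\<close>
  define N where "N e g = Vxx e g * Vrr e g - Vxr e g * Vxr e g
     + M *\<^sub>R (A e g * ((1 + e *\<^sub>R (Vr e g * Vr e g)) * Vxx e g
         - 2 *\<^sub>R (Vx e g * Vr e g * (e *\<^sub>R Vxr e g)) + e *\<^sub>R (Vx e g * Vx e g * Vrr e g)))
     + C *\<^sub>R (A e g * A e g * (e *\<^sub>R (Vx e g * Vx e g) + Vr e g * Vr e g))
     + e *\<^sub>R (M *\<^sub>R (inv_L_A m g * inv_L_rr m g) + C *\<^sub>R (inv_L_A m g * inv_L_A m g))" for e g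
  define \<Phi> where "\<Phi> e g = (- 1 / (M * c)) *\<^sub>R N e g" for e g
  note ops = bounded_op_inv_L[of m]
  have lip: "lipE R Vx" "lipE R Vxx" "lipE R A" "lipE R Vrr" "lipE R Vxr" for R
    unfolding Vx_def Vxx_def A_def Vrr_def Vxr_def
    by (intro lip_add lip_const lipE_scale_e lipB_op ops; simp)+
  then have lipr: "lipE R Vr" for R
    unfolding Vr_def by (intro lip_mult lip_const; simp)
  have lip\<Phi>: "lipE R \<Phi>" for R
    unfolding \<Phi>_def N_def
    by (intro lip_scaleR lip_add lip_diff lip_mult lip_const lipE_scale_e lipB_op
        lipE_imp_lipB lip lipr ops) auto
  have par: "evenr (Vx e g)" "evenr (Vxx e g)" "evenr (A e g)" "evenr (Vrr e g)" "oddr (Vxr e g)" "evenr (V e g)"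
    "oddr (Vr e g)" if "evenr g" for e g
    unfolding Vx_def Vxx_def A_def Vrr_def Vxr_def V_def Vr_def px_def pxx_def pV_def r1_def
    by (intro parity_linear parity_mult parity_monom2 parity_inv_L that; simp)+
  have deval\<Phi>: "evenr (\<Phi> e g)" if "evenr g" for e g
  proof -
    have "evenr (Vxr e g * Vxr e g)" "evenr (Vr e g * Vr e g)" "evenr (Vx e g * Vr e g * (e *\<^sub>R Vxr e g))"
      by (rule par[OF that] parity_mult(2) parity_mult(3) parity_linear(6))+
    then show ?thesis
      unfolding \<Phi>_def N_def using par[OF that] parity_inv_L[OF that]
      by - (assumption | rule parity_linear(1-3,7) parity_mult(1))+
  qed
  obtain e0 R where e0: "0 < e0" "e0 \<le> 1"
    and fix_ex: "\<And>e. 0 < e \<Longrightarrow> e \<le> e0 \<Longrightarrow> \<exists>g. evenr g \<and> norm g \<le> R \<and> \<Phi> e g = g"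
    using small_parameter_fixed_point[of \<Phi>, OF lip\<Phi> deval\<Phi>] by blast
  \<comment> \<open>Each quantity differs from its unperturbed value by \<open>e\<close> times an
    operator of norm at most 9 applied to \<open>g\<close>.\<close>
  define K where "K = 9 * max R 0"
  have K0: "K \<ge> 0" by (simp add: K_def)
  have main: "\<exists>V Vx Vxx A Vrr Vxr. series_profile m c d e (e * K) V Vx Vxx A Vrr Vxr"
    if e: "0 < e" "e \<le> e0" for e
  proof -
    obtain g where g: "evenr g" "norm g \<le> R" "\<Phi> e g = g" using fix_ex[OF e] by blast
    have bnd: "\<bar>e * deval x r (T g)\<bar> \<le> e * K" if "bounded_op T" "\<bar>x\<bar> + \<bar>r\<bar> \<le> 3" for T x r
    proof -
      have "\<bar>deval x r (T g)\<bar> \<le> 9 * norm g" using abs_deval_le[OF that(2), of "T g"] that(1) by (smt (verit) bounded_op_def)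
      also have "\<dots> \<le> K" using g(2) by (simp add: K_def)
      finally show ?thesis using e by (simp add: abs_mult)
    qed
    have coefs:
      "coef (Vx e g) j k = real (j + 1) * coef (V e g) (j + 1) k"
      "coef (Vxx e g) j k = real (j + 2) * real (j + 1) * coef (V e g) (j + 2) k"
      "coef (A e g) j k = real (k + 2) * coef (V e g) j (k + 2)"
      "coef (Vrr e g) j k = real (k + 2) * real (k + 1) * coef (V e g) j (k + 2)"
      "coef (Vxr e g) j k = real (j + 1) * real (k + 1) * coef (V e g) (j + 1) (k + 1)" for j k
    proof -
      have p: "coef px j k = real (j + 1) * coef pV (j + 1) k"
        "coef pxx j k = real (j + 2) * real (j + 1) * coef pV (j + 2) k"
        "coef (c *\<^sub>R 1) j k = real (k + 2) * coef pV j (k + 2)"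
        "coef (c *\<^sub>R 1) j k = real (k + 2) * real (k + 1) * coef pV j (k + 2)"
        "0 = real (j + 1) * real (k + 1) * coef pV (j + 1) (k + 1)"
        by (auto simp: px_def pxx_def pV_def coef_monom2 coef_one algebra_simps)
      have w: "coef (inv_L_x m g) j k = real (j + 1) * coef (inv_L m g) (j + 1) k"
        "coef (inv_L_xx m g) j k = real (j + 2) * real (j + 1) * coef (inv_L m g) (j + 2) k"
        "coef (inv_L_A m g) j k = real (k + 2) * coef (inv_L m g) j (k + 2)"
        "coef (inv_L_rr m g) j k = real (k + 2) * real (k + 1) * coef (inv_L m g) j (k + 2)"
        "coef (inv_L_xr m g) j k = real (j + 1) * real (k + 1) * coef (inv_L m g) (j + 1) (k + 1)"
        by (cases k; simp add: coef_inv_L divide_simps)+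
      show "coef (Vx e g) j k = real (j + 1) * coef (V e g) (j + 1) k"
        unfolding Vx_def V_def coef_simps coef_scaleR p w by (simp only: distrib_left mult.left_commute mult.assoc)
      show "coef (Vxx e g) j k = real (j + 2) * real (j + 1) * coef (V e g) (j + 2) k"
        unfolding Vxx_def V_def coef_simps coef_scaleR p w by (simp only: distrib_left mult.left_commute mult.assoc)
      show "coef (A e g) j k = real (k + 2) * coef (V e g) j (k + 2)"
        unfolding A_def V_def coef_simps(2) p(3) coef_scaleR[of e] w by (simp only: distrib_left mult.left_commute mult.assoc)
      show "coef (Vrr e g) j k = real (k + 2) * real (k + 1) * coef (V e g) j (k + 2)"
        unfolding Vrr_def V_def coef_simps(2) p(4) coef_scaleR[of e] w by (simp only: distrib_left mult.left_commute mult.assoc)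
      show "coef (Vxr e g) j k = real (j + 1) * real (k + 1) * coef (V e g) (j + 1) (k + 1)"
        using p(5) unfolding Vxr_def V_def coef_simps coef_scaleR w distrib_left by simp
    qed
    have near: "\<bar>deval x r (V e g) - c * (r\<^sup>2 / 2 - x * (x - d) * (1 - x))\<bar> \<le> e * K"
        "\<bar>deval x r (Vx e g) - c * (3 * x\<^sup>2 - 2 * (1 + d) * x + d)\<bar> \<le> e * K"
        "\<bar>deval x r (Vxx e g) - c * (6 * x - 2 * (1 + d))\<bar> \<le> e * K"
        "\<bar>deval x r (A e g) - c\<bar> \<le> e * K" "\<bar>deval x r (Vrr e g) - c\<bar> \<le> e * K" "\<bar>deval x r (Vxr e g)\<bar> \<le> e * K"
      if xr: "\<bar>x\<bar> + \<bar>r\<bar> \<le> 3" for x r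
    proof -
      have "deval x r (V e g) - c * (r\<^sup>2 / 2 - x * (x - d) * (1 - x)) = e * deval x r (inv_L m g)"
        by (simp add: V_def pV_def deval_simps[OF xr] algebra_simps power2_eq_square power3_eq_cube)
      then show "\<bar>deval x r (V e g) - c * (r\<^sup>2 / 2 - x * (x - d) * (1 - x))\<bar> \<le> e * K" using bnd[OF ops(1) xr] by simp
      have "deval x r (Vx e g) - c * (3 * x\<^sup>2 - 2 * (1 + d) * x + d) = e * deval x r (inv_L_x m g)"
        by (simp add: Vx_def px_def deval_simps[OF xr])
      then show "\<bar>deval x r (Vx e g) - c * (3 * x\<^sup>2 - 2 * (1 + d) * x + d)\<bar> \<le> e * K" using bnd[OF ops(4) xr] by simp
      have "deval x r (Vxx e g) - c * (6 * x - 2 * (1 + d)) = e * deval x r (inv_L_xx m g)"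
        by (simp add: Vxx_def pxx_def deval_simps[OF xr])
      then show "\<bar>deval x r (Vxx e g) - c * (6 * x - 2 * (1 + d))\<bar> \<le> e * K" using bnd[OF ops(5) xr] by simp
      show "\<bar>deval x r (A e g) - c\<bar> \<le> e * K" "\<bar>deval x r (Vrr e g) - c\<bar> \<le> e * K" "\<bar>deval x r (Vxr e g)\<bar> \<le> e * K"
        using bnd[OF ops(2) xr] bnd[OF ops(3) xr] bnd[OF ops(6) xr]
        by (simp_all add: A_def Vrr_def Vxr_def deval_simps[OF xr])
    qed
    have axis: "deval x 0 (V e g) = - c * (x * (x - d) * (1 - x))" if "\<bar>x\<bar> \<le> 3" for x
    proof -
      have xr: "\<bar>x\<bar> + \<bar>0\<bar> \<le> 3" using that by simp
      \<comment> \<open>\<open>inv_L\<close> produces only powers of r from the second on, so the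
        correction leaves the axis values untouched.\<close>
      have "deval x 0 (inv_L m g) = 0"
        unfolding deval_def by (rule infsum_0) (auto simp: coef_inv_L)
      then show ?thesis
        by (simp add: V_def pV_def deval_simps[OF xr] algebra_simps power2_eq_square power3_eq_cube)
    qed
    have Leq: "inv_L_rr m g + M *\<^sub>R inv_L_A m g = g"
    proof (rule dseries_eqI)
      fix j k
      have "real (k + 1) / real (k + 1 + m) + M / real (k + 1 + m) = 1"
        by (simp add: M_def flip: add_divide_distrib)
      moreover have "coef (inv_L_rr m g + M *\<^sub>R inv_L_A m g) j k
          = (real (k + 1) / real (k + 1 + m) + M / real (k + 1 + m)) * coef g j k"
        by (simp add: coef_inv_L distrib_right)
      ultimately show "coef (inv_L_rr m g + M *\<^sub>R inv_L_A m g) j k = coef g j k" by simp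
    qed
    have pde: "reduced_equation (real m) e (deval x r (Vx e g)) (deval x r (Vxx e g)) (deval x r (A e g)) (r * deval x r (A e g))
        (deval x r (Vxr e g)) (deval x r (Vrr e g))"
      if xr: "\<bar>x\<bar> + \<bar>r\<bar> \<le> 3" for x r
    proof -
      define a where "a = deval x r (Vx e g)"
      define b where "b = deval x r (Vxx e g)"
      define A' where "A' = deval x r (A e g)"
      define h where "h = deval x r (Vrr e g)"
      define k' where "k' = deval x r (inv_L_xr m g)"
      define wA where "wA = deval x r (inv_L_A m g)"
      define wr where "wr = deval x r (inv_L_rr m g)"
      have k: "deval x r (Vxr e g) = e * k'" by (simp add: Vxr_def k'_def deval_simps[OF xr])
      have A': "A' = c + e * wA" and h: "h = c + e * wr"
        by (simp_all add: A'_def h_def wA_def wr_def A_def Vrr_def deval_simps[OF xr])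
      have "- (M * c) *\<^sub>R \<Phi> e g = N e g" using M c0 by (simp add: \<Phi>_def)
      then have "N e g = - (M * c) *\<^sub>R g" using g(3) by simp
      then have "deval x r (N e g) = - (M * c) * deval x r g" using deval_scaleR[OF xr, of "- (M * c)" g] by simp
      moreover have "deval x r (N e g) = b * h - (e * k')\<^sup>2
          + M * (A' * ((1 + e * (r * A')\<^sup>2) * b - 2 * (a * (r * A') * (e * (e * k'))) + e * (a\<^sup>2 * h)))
          + C * (A'\<^sup>2 * (e * a\<^sup>2 + (r * A')\<^sup>2)) + e * (M * (wA * wr) + C * wA\<^sup>2)"
        by (simp add: N_def deval_simps[OF xr] Vr_def r1_def k power2_eq_square
            flip: a_def b_def A'_def h_def k'_def wA_def wr_def)
      moreover have "deval x r g = wr + M * wA"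
        by (subst Leq[symmetric]) (simp add: deval_simps[OF xr] wA_def wr_def)
      ultimately have eq: "b * h - (e * k')\<^sup>2
          + M * (A' * ((1 + e * (r * A')\<^sup>2) * b - 2 * (a * (r * A') * (e * (e * k'))) + e * (a\<^sup>2 * h)))
          + C * (A'\<^sup>2 * (e * a\<^sup>2 + (r * A')\<^sup>2)) + e * (M * (wA * wr) + C * wA\<^sup>2) = - (M * c) * (wr + M * wA)" by simp
      \<comment> \<open>Expansion of the degenerate part at \<open>c + e * wA\<close> and
        \<open>c + e * wr\<close>: the constant term is 1 by the choice of \<open>c\<close>, and the
        linear term is the operator that \<open>inv_L\<close> inverts.\<close>
      have zero: "M * A' * h + C * A'\<^sup>2 = 1 + e * ((M * c) * (wr + M * wA)) + e\<^sup>2 * (M * (wA * wr) + C * wA\<^sup>2)"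
      proof -
        have "2 * (M * A' * h + C * A'\<^sup>2) = c\<^sup>2 * (M * (M + 1)) + 2 * (e * ((M * c) * (wr + M * wA))) + 2 * (e\<^sup>2 * (M * (wA * wr) + C * wA\<^sup>2))"
          unfolding A' h C_def by (simp add: algebra_simps power2_eq_square add_divide_distrib diff_divide_distrib)
        then show ?thesis using c2 by simp
      qed
      have "e * (b * h - (e * k')\<^sup>2) + M * A' * ((1 + e * (r * A')\<^sup>2) * (e * b) - 2 * e\<^sup>2 * a * (r * A') * (e * k') + (1 + e\<^sup>2 * a\<^sup>2) * h)
         + C * A'\<^sup>2 * (1 + e\<^sup>2 * a\<^sup>2 + e * (r * A')\<^sup>2)
        = e * (b * h - (e * k')\<^sup>2
          + M * (A' * ((1 + e * (r * A')\<^sup>2) * b - 2 * (a * (r * A') * (e * (e * k'))) + e * (a\<^sup>2 * h)))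
          + C * (A'\<^sup>2 * (e * a\<^sup>2 + (r * A')\<^sup>2))) + (M * A' * h + C * A'\<^sup>2)"
        by (simp add: algebra_simps power2_eq_square)
      also have "\<dots> = e * (- (M * c) * (wr + M * wA) - e * (M * (wA * wr) + C * wA\<^sup>2)) + (M * A' * h + C * A'\<^sup>2)"
        unfolding eq[symmetric] add_diff_cancel_right' by (rule refl)
      also have "\<dots> = 1" unfolding zero by (simp add: algebra_simps power2_eq_square)
      finally show ?thesis
        by (simp add: reduced_equation_def k C_def M_def flip: a_def b_def A'_def h_def)
    qed
    show ?thesis
      unfolding series_profile_def
      by (intro exI[of _ "V e g"] exI[of _ "Vx e g"] exI[of _ "Vxx e g"] exI[of _ "A e g"] exI[of _ "Vrr e g"] exI[of _ "Vxr e g"]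
          conjI allI impI coefs near axis pde par g(1))
  qed
  then show ?thesis using e0 K0 by blast
qed

section \<open>Convex sublevel domains\<close>

lemma partial_deriv_eq:
  assumes "(f has_derivative f') (at x)"
  shows "partial_deriv i f x = f' (axis i 1)"
  unfolding partial_deriv_def using frechet_derivative_at[OF assms] by simp

lemma partial_deriv_cong:
  assumes "open S" "x \<in> S" "\<And>y. y \<in> S \<Longrightarrow> f y = g y"
  shows "partial_deriv i f x = partial_deriv i g x"
proof -
  have "(f has_derivative D) (at x) \<longleftrightarrow> (g has_derivative D) (at x)" for D
    using has_derivative_transform_within_open[OF _ assms(1,2)] assms(3) by metis
  then show ?thesis by (simp add: partial_deriv_def frechet_derivative_def)
qed

text \<open>Induction on the order of differentiability, for functions that agree on
  \<open>S\<close> with a member of \<open>G\<close>; agreement on an open set suffices since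
  partial derivatives are local. Smoothness is thereby reduced to exhibiting a class closed under
  partial differentiation.\<close>

lemma smooth_on_coinduct:
  assumes S: "open S" and "f \<in> G"
    and diff: "\<And>f. f \<in> G \<Longrightarrow> f differentiable_on S"
    and deriv: "\<And>f i. f \<in> G \<Longrightarrow> \<exists>g\<in>G. \<forall>x\<in>S. partial_deriv i f x = g x"
  shows "smooth_on f S"
proof -
  have "Ck_on k h S" if "f \<in> G" "\<forall>x\<in>S. h x = f x" for k f h
    using that
  proof (induction k arbitrary: f h)
    case 0
    then show ?case
      using differentiable_imp_continuous_on[OF diff] by (simp cong: continuous_on_cong)
  next
    case (Suc k)
    have "h differentiable_on S"
      unfolding differentiable_on_def
    proof
      fix x assume "x \<in> S"
      then have "f differentiable (at x within S)" using diff[OF Suc.prems(1)] by (simp add: differentiable_on_def)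
      then show "h differentiable (at x within S)"
        by (rule differentiable_transform_within[where d = 1]) (use Suc.prems(2) \<open>x \<in> S\<close> in auto)
    qed
    moreover have "Ck_on k (partial_deriv i h) S" for i
    proof -
      obtain g where g: "g \<in> G" "\<forall>x\<in>S. partial_deriv i f x = g x" using deriv[OF Suc.prems(1)] by blast
      have "\<forall>x\<in>S. partial_deriv i h x = g x"
        using partial_deriv_cong[OF S] Suc.prems(2) g(2) by metis
      then show ?thesis by (rule Suc.IH[OF g(1)])
    qed
    ultimately show ?case by simp
  qed
  then show ?thesis using assms(2) by (auto simp: smooth_on_def)
qed

lemma smooth_on_subset:
  assumes "smooth_on f S" "T \<subseteq> S"
  shows "smooth_on f T"
proof -
  have "Ck_on k f T" if "Ck_on k f S" for k f
    using that by (induction k arbitrary: f) (auto intro: continuous_on_subset[OF _ assms(2)] differentiable_on_subset[OF _ assms(2)])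
  then show ?thesis using assms(1) by (simp add: smooth_on_def)
qed

section \<open>Gradient and Hessian as total derivatives\<close>

lemma has_derivative_grad:
  fixes f :: "real ^ 'n::finite \<Rightarrow> real"
  assumes "f differentiable (at x)"
  shows "(f has_derivative (\<lambda>h. grad f x \<bullet> h)) (at x)"
proof -
  have D: "(f has_derivative frechet_derivative f (at x)) (at x)"
    using assms frechet_derivative_works by blast
  have "frechet_derivative f (at x) h = grad f x \<bullet> h" for h
  proof -
    interpret linear "frechet_derivative f (at x)" using D has_derivative_linear by blast
    have "frechet_derivative f (at x) (\<Sum>i\<in>UNIV. h $ i *s axis i 1) = (\<Sum>i\<in>UNIV. h $ i * frechet_derivative f (at x) (axis i 1))"
      by (simp add: sum scale scalar_mult_eq_scaleR)
    then show ?thesis by (simp add: basis_expansion grad_def partial_deriv_def inner_vec_def mult.commute)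
  qed
  then show ?thesis using D by (metis (no_types, lifting) ext)
qed

context
  fixes f :: "real ^ 'n::finite \<Rightarrow> real" and S :: "(real ^ 'n) set" and x :: "real ^ 'n"
  assumes sm: "smooth_on f S" and S: "open S" and x: "x \<in> S"
begin

lemma smooth_has_derivative: "(f has_derivative (\<lambda>h. grad f x \<bullet> h)) (at x)"
proof -
  have "Ck_on 1 f S" using sm by (simp add: smooth_on_def del: One_nat_def)
  then have "f differentiable_on S" by simp
  then show ?thesis using S x has_derivative_grad by (metis differentiable_on_eq_differentiable_at)
qed

lemma smooth_grad_has_derivative: "(grad f has_derivative (\<lambda>h. hessian f x *v h)) (at x)"
proof -
  have "Ck_on 2 f S" using sm by (simp add: smooth_on_def)
  then have "partial_deriv i f differentiable_on S" for i by (simp add: numeral_2_eq_2)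
  then have "(partial_deriv i f has_derivative (\<lambda>h. grad (partial_deriv i f) x \<bullet> h)) (at x)" for i
    using S x has_derivative_grad by (metis differentiable_on_eq_differentiable_at)
  then have "((\<lambda>y. \<chi> i. partial_deriv i f y) has_derivative (\<lambda>h. \<chi> i. grad (partial_deriv i f) x \<bullet> h)) (at x)"
    by (subst has_derivative_componentwise_within)
      (auto simp: Basis_vec_def inner_axis intro: has_derivative_at_withinI)
  moreover have "(\<lambda>h. \<chi> i. grad (partial_deriv i f) x \<bullet> h) = (\<lambda>h. hessian f x *v h)"
    by (simp add: fun_eq_iff vec_eq_iff hessian_def grad_def matrix_vector_mult_def inner_vec_def)
  moreover have "(\<lambda>y. \<chi> i. partial_deriv i f y) = grad f" by (simp add: fun_eq_iff grad_def)
  ultimately show ?thesis by simp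
qed

end

lemma smooth_grad_continuous:
  fixes f :: "real ^ 'n::finite \<Rightarrow> real"
  assumes "smooth_on f S" "open S"
  shows "continuous_on S (grad f)"
  using smooth_grad_has_derivative[OF assms] assms(2)
  by (meson continuous_at_imp_continuous_on has_derivative_continuous)

text \<open>Along the segment the derivative is nondecreasing, and the mean value theorem compares
  the increment with its initial value.\<close>

lemma convex_function_tangent:
  fixes f :: "real ^ 'n::finite \<Rightarrow> real"
  assumes sm: "smooth_on f B" and B: "open B" "convex B"
    and H: "\<And>x v. x \<in> B \<Longrightarrow> 0 \<le> v \<bullet> (hessian f x *v v)"
    and xy: "x \<in> B" "y \<in> B"
  shows "f y \<ge> f x + grad f x \<bullet> (y - x)"
proof -
  define \<phi> where "\<phi> s = f (x + s *\<^sub>R (y - x))" for s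
  define \<phi>' where "\<phi>' s = grad f (x + s *\<^sub>R (y - x)) \<bullet> (y - x)" for s
  have inB: "x + s *\<^sub>R (y - x) \<in> B" if "0 \<le> s" "s \<le> 1" for s
    using convexD_alt[OF B(2) xy(1) xy(2), of s] that by (simp add: algebra_simps)
  have d1: "(\<phi> has_real_derivative \<phi>' s) (at s)" if "0 \<le> s" "s \<le> 1" for s
  proof -
    have "(\<phi> has_derivative (\<lambda>h. grad f (x + s *\<^sub>R (y - x)) \<bullet> (h *\<^sub>R (y - x)))) (at s)"
      unfolding \<phi>_def
      by (rule has_derivative_compose[where f = "\<lambda>s. x + s *\<^sub>R (y - x)", OF _ smooth_has_derivative[OF sm B(1) inB[OF that]]])
        (auto intro!: derivative_eq_intros)
    then show ?thesis by (simp add: has_field_derivative_def \<phi>'_def mult_commute_abs)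
  qed
  have d2: "(\<phi>' has_real_derivative (y - x) \<bullet> (hessian f (x + s *\<^sub>R (y - x)) *v (y - x))) (at s)"
    if "0 \<le> s" "s \<le> 1" for s
  proof -
    have "(\<phi>' has_derivative (\<lambda>h. (hessian f (x + s *\<^sub>R (y - x)) *v (h *\<^sub>R (y - x))) \<bullet> (y - x))) (at s)"
      unfolding \<phi>'_def
      by (rule has_derivative_inner_left,
          rule has_derivative_compose[where f = "\<lambda>s. x + s *\<^sub>R (y - x)", OF _ smooth_grad_has_derivative[OF sm B(1) inB[OF that]]])
        (auto intro!: derivative_eq_intros)
    then show ?thesis
      by (simp add: has_field_derivative_def mult_commute_abs matrix_vector_mult_scaleR inner_commute)
  qed
  have mono: "\<phi>' 0 \<le> \<phi>' s" if "0 \<le> s" "s \<le> 1" for s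
    by (rule DERIV_nonneg_imp_nondecreasing[OF that(1)]) (use d2 H inB that in \<open>force\<close>)
  obtain z where z: "0 < z" "z < 1" "\<phi> 1 - \<phi> 0 = (1 - 0) * \<phi>' z"
    using MVT2[of 0 1 \<phi> \<phi>'] d1 by auto
  then have "\<phi> 1 - \<phi> 0 \<ge> \<phi>' 0" using mono[of z] by simp
  then show ?thesis by (simp add: \<phi>_def \<phi>'_def)
qed

text \<open>Convexity of \<open>f\<close> takes the place of a description of the boundary. The
  tangent inequality gives convexity of \<open>\<Omega>\<close> and, tested against the interior
  point \<open>z\<close>, a nonzero gradient on the frontier. Boundary curvatures are values of the
  Hessian divided by the norm of the gradient, which is bounded on the compact frontier. The
  assumption on the closure keeps the zero set away from the edge of \<open>B\<close>, where
  \<open>f\<close> is no longer controlled.\<close>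

lemma sublevel_domain:
  fixes f :: "real ^ 'n::finite \<Rightarrow> real"
  assumes sm: "smooth_on f B" and B: "open B" "convex B" "bounded B"
    and \<theta>: "\<theta> > 0" and H: "\<And>x v. x \<in> B \<Longrightarrow> \<theta> * (v \<bullet> v) \<le> v \<bullet> (hessian f x *v v)"
    and cl: "closure {x \<in> B. f x < 0} \<subseteq> B" and ne: "z \<in> B" "f z < 0"
  defines "\<Omega> \<equiv> {x \<in> B. f x < 0}"
  shows "bounded_smooth_domain \<Omega>" "uniformly_convex_domain \<Omega>" "\<And>x. x \<in> frontier \<Omega> \<Longrightarrow> x \<in> B \<and> f x = 0"
    "open \<Omega>"
proof -
  have H0: "0 \<le> v \<bullet> (hessian f x *v v)" if "x \<in> B" for x v
    using H[OF that, of v] \<theta> by (smt (verit) inner_ge_zero mult_nonneg_nonneg)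
  have tangent: "f y \<ge> f x + grad f x \<bullet> (y - x)" if "x \<in> B" "y \<in> B" for x y
    by (rule convex_function_tangent[OF sm B(1,2) H0 that])
  have cont: "continuous_on B f"
    using smooth_has_derivative[OF sm B(1)] B(1) by (meson continuous_at_imp_continuous_on has_derivative_continuous)
  have "openin (top_of_set B) (B \<inter> f -` {..<0})"
    using cont by (rule continuous_openin_preimage_gen) simp
  moreover have \<Omega>_eq: "\<Omega> = B \<inter> f -` {..<0}" by (auto simp: \<Omega>_def)
  ultimately show op: "open \<Omega>" using B(1) by (simp add: openin_open_trans openin_open_eq)
  have conv: "convex \<Omega>"
  proof (rule convexI)
    fix x y and a b :: real assume xy: "x \<in> \<Omega>" "y \<in> \<Omega>" and ab: "0 \<le> a" "0 \<le> b" "a + b = 1"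
    let ?w = "a *\<^sub>R x + b *\<^sub>R y"
    have w: "?w \<in> B" using convexD[OF B(2)] xy ab by (simp add: \<Omega>_def)
    have "a * f x + b * f y \<ge> a * (f ?w + grad f ?w \<bullet> (x - ?w)) + b * (f ?w + grad f ?w \<bullet> (y - ?w))"
      using xy w ab tangent[OF w] by (intro add_mono mult_left_mono) (auto simp: \<Omega>_def)
    also have "a * (f ?w + grad f ?w \<bullet> (x - ?w)) + b * (f ?w + grad f ?w \<bullet> (y - ?w))
        = (a + b) * f ?w + grad f ?w \<bullet> ((a *\<^sub>R x + b *\<^sub>R y) - (a + b) *\<^sub>R ?w)"
      by (simp add: inner_diff_right inner_add_right algebra_simps)
    also have "\<dots> = f ?w" using ab by simp
    finally have "f ?w \<le> a * f x + b * f y" .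
    also have "\<dots> < 0"
      using xy ab unfolding \<Omega>_def
      by (smt (verit, del_insts) mem_Collect_eq mult_nonneg_nonpos mult_pos_neg)
    finally show "?w \<in> \<Omega>" using w by (simp add: \<Omega>_def)
  qed
  show front: "x \<in> B \<and> f x = 0" if "x \<in> frontier \<Omega>" for x
  proof
    have xc: "x \<in> closure \<Omega>" "x \<notin> \<Omega>" using that op by (auto simp: frontier_def interior_open)
    show xB: "x \<in> B" using xc(1) cl by (auto simp: \<Omega>_def)
    have "f x \<ge> 0" using xc(2) xB by (auto simp: \<Omega>_def)
    moreover have "f x \<le> 0"
      using continuous_le_on_closure[of \<Omega> f x 0] cont xc(1) cl
      by (metis (no_types, lifting) \<Omega>_def continuous_on_subset less_eq_real_def mem_Collect_eq)
    ultimately show "f x = 0" by simp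
  qed
  \<comment> \<open>One neighbourhood serves for all frontier points: off its critical points
    \<open>f\<close> is a defining function itself.\<close>
  define U where "U = {x \<in> B. grad f x \<noteq> 0}"
  have gc: "continuous_on B (grad f)" by (rule smooth_grad_continuous[OF sm B(1)])
  have opU: "open U"
  proof -
    have "U = B \<inter> grad f -` (- {0})" by (auto simp: U_def)
    moreover have "openin (top_of_set B) (B \<inter> grad f -` (- {0}))"
      using gc by (rule continuous_openin_preimage_gen) auto
    ultimately show ?thesis using B(1) by (simp add: openin_open_trans openin_open_eq)
  qed
  have ldf: "local_defining_function \<Omega> p U f" if p: "p \<in> frontier \<Omega>" for p
  proof -
    have pB: "p \<in> B" "f p = 0" using front[OF p] by auto
    have "grad f p \<noteq> 0" using tangent[OF pB(1) ne(1)] pB(2) ne(2) by auto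
    then have "p \<in> U" using pB by (simp add: U_def)
    moreover have "smooth_on f U" by (rule smooth_on_subset[OF sm]) (auto simp: U_def)
    moreover have "\<Omega> \<inter> U = {x \<in> U. f x < 0}" by (auto simp: \<Omega>_def U_def)
    ultimately show ?thesis unfolding local_defining_function_def using opU by (auto simp: U_def)
  qed
  have bd: "bounded \<Omega>" using B(3) by (rule bounded_subset) (auto simp: \<Omega>_def)
  show "bounded_smooth_domain \<Omega>"
    unfolding bounded_smooth_domain_def
    using op bd convex_connected[OF conv] ne ldf by (auto simp: \<Omega>_def)
  have "compact (grad f ` frontier \<Omega>)"
    by (rule compact_continuous_image) (use bd front gc in \<open>auto intro: continuous_on_subset compact_frontier_bounded\<close>)
  then obtain M where M: "M > 0" "\<And>p. p \<in> frontier \<Omega> \<Longrightarrow> norm (grad f p) \<le> M"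
    using compact_imp_bounded bounded_pos by (metis imageI)
  show "uniformly_convex_domain \<Omega>"
    unfolding uniformly_convex_domain_def
  proof (intro conjI conv exI[of _ "\<theta> / M"] ballI)
    show "\<theta> / M > 0" using \<theta> M by simp
    fix p assume p: "p \<in> frontier \<Omega>"
    have pB: "p \<in> B" and pU: "p \<in> U" using front[OF p] ldf[OF p] by (auto simp: local_defining_function_def)
    have g0: "grad f p \<noteq> 0" using pU by (simp add: U_def)
    have "\<theta> / M \<le> k" if k: "level_set_curvature f p k" for k
    proof -
      obtain v where v: "v \<noteq> 0" "v \<bullet> grad f p = 0"
        and eig: "frechet_derivative (\<lambda>x. grad f x /\<^sub>R norm (grad f x)) (at p) v = k *\<^sub>R v"
        using k unfolding level_set_curvature_def by blast
      note dg = smooth_grad_has_derivative[OF sm B(1) pB]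
      have dn: "((\<lambda>x. norm (grad f x)) has_derivative (\<lambda>h. (hessian f p *v h) \<bullet> sgn (grad f p))) (at p)"
        using has_derivative_compose[OF dg has_derivative_norm[OF g0]] by simp
      have di: "((\<lambda>x. inverse (norm (grad f x))) has_derivative
          (\<lambda>h. - (inverse (norm (grad f p)) * ((hessian f p *v h) \<bullet> sgn (grad f p)) * inverse (norm (grad f p))))) (at p)"
        by (rule Deriv.has_derivative_inverse[OF _ dn]) (use g0 in simp)
      have "((\<lambda>x. grad f x /\<^sub>R norm (grad f x)) has_derivative
          (\<lambda>h. inverse (norm (grad f p)) *\<^sub>R (hessian f p *v h) +
            (- (inverse (norm (grad f p)) * ((hessian f p *v h) \<bullet> sgn (grad f p)) * inverse (norm (grad f p)))) *\<^sub>R grad f p)) (at p)"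
        by (rule has_derivative_scaleR[OF di dg])
      from trans[OF fun_cong[OF frechet_derivative_at[OF this], of v] eig]
      have "inverse (norm (grad f p)) *\<^sub>R (hessian f p *v v) +
            (- (inverse (norm (grad f p)) * ((hessian f p *v v) \<bullet> sgn (grad f p)) * inverse (norm (grad f p)))) *\<^sub>R grad f p
          = k *\<^sub>R v" .
      \<comment> \<open>Pairing with the tangent vector \<open>v\<close> removes the term along
        \<open>grad f p\<close>, which stems from differentiating the normalising factor.\<close>
      then have "v \<bullet> (inverse (norm (grad f p)) *\<^sub>R (hessian f p *v v) +
            (- (inverse (norm (grad f p)) * ((hessian f p *v v) \<bullet> sgn (grad f p)) * inverse (norm (grad f p)))) *\<^sub>R grad f p)
          = v \<bullet> (k *\<^sub>R v)" by simp
      then have "inverse (norm (grad f p)) * (v \<bullet> (hessian f p *v v)) = k * (v \<bullet> v)"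
        using v(2) by (simp add: inner_diff_right)
      moreover have "inverse M * (\<theta> * (v \<bullet> v)) \<le> inverse (norm (grad f p)) * (v \<bullet> (hessian f p *v v))"
        using M(2)[OF p] g0 H[OF pB] \<theta> by (intro mult_mono le_imp_inverse_le) auto
      ultimately have "(\<theta> / M) * (v \<bullet> v) \<le> k * (v \<bullet> v)" by (simp add: divide_inverse mult_ac)
      moreover have "v \<bullet> v > 0" using v(1) by simp
      ultimately show ?thesis by (rule mult_right_le_imp_le)
    qed
    then show "\<exists>U \<rho>. local_defining_function \<Omega> p U \<rho> \<and> (\<forall>k. level_set_curvature \<rho> p k \<longrightarrow> \<theta> / M \<le> k)"
      using ldf[OF p] by blast
  qed
qed

section \<open>Differentiation of double power series\<close>

definition pow2 :: "(nat \<Rightarrow> nat \<Rightarrow> real) \<Rightarrow> real \<Rightarrow> real \<Rightarrow> real" where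
  "pow2 a x t = infsum (\<lambda>(j, k). a j k * (x ^ j * t ^ k)) UNIV"

text \<open>Absolute convergence on an open bidisc is, unlike membership in the weighted algebra,
  inherited by all derivatives with the same radii, as smoothness requires.\<close>

definition conv2 :: "real \<Rightarrow> real \<Rightarrow> (nat \<Rightarrow> nat \<Rightarrow> real) \<Rightarrow> bool" where
  "conv2 X T a \<longleftrightarrow> (\<forall>x t. 0 \<le> x \<and> x < X \<and> 0 \<le> t \<and> t < T \<longrightarrow> (\<lambda>(j, k). \<bar>a j k\<bar> * (x ^ j * t ^ k)) summable_on UNIV)"

definition ddx :: "(nat \<Rightarrow> nat \<Rightarrow> real) \<Rightarrow> nat \<Rightarrow> nat \<Rightarrow> real" where
  "ddx a j k = real (j + 1) * a (j + 1) k"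

definition ddt :: "(nat \<Rightarrow> nat \<Rightarrow> real) \<Rightarrow> nat \<Rightarrow> nat \<Rightarrow> real" where
  "ddt a j k = real (k + 1) * a j (k + 1)"

lemma conv2D:
  assumes "conv2 X T a" "0 \<le> x" "x < X" "0 \<le> t" "t < T"
  shows "(\<lambda>(j, k). \<bar>a j k\<bar> * (x ^ j * t ^ k)) summable_on UNIV"
  using assms unfolding conv2_def by blast

lemma pow2_has_sum:
  assumes "conv2 X T a" "\<bar>x\<bar> < X" "\<bar>t\<bar> < T"
  shows "((\<lambda>(j, k). a j k * (x ^ j * t ^ k)) has_sum pow2 a x t) UNIV"
proof -
  have "(\<lambda>p. norm ((\<lambda>(j, k). a j k * (x ^ j * t ^ k)) p)) = (\<lambda>(j, k). \<bar>a j k\<bar> * (\<bar>x\<bar> ^ j * \<bar>t\<bar> ^ k))"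
    by (auto simp: fun_eq_iff abs_mult power_abs)
  then have "(\<lambda>p. norm ((\<lambda>(j, k). a j k * (x ^ j * t ^ k)) p)) summable_on UNIV"
    using conv2D[OF assms(1) abs_ge_zero assms(2) abs_ge_zero assms(3)] by simp
  then show ?thesis unfolding pow2_def by (rule has_sum_infsum[OF abs_summable_summable])
qed

text \<open>The slope of a power at \<open>x\<close> lies below its secant slope to
  \<open>y\<close>. Thus a differentiated series at \<open>x\<close> is dominated by the original
  series at a larger point \<open>y\<close>.\<close>

lemma mult_power_le_diff_power:
  fixes x y :: real
  assumes "0 \<le> x" "x \<le> y"
  shows "real (j + 1) * x ^ j * (y - x) \<le> y ^ (j + 1) - x ^ (j + 1)"
proof (induction j)
  case (Suc j)
  have "real (Suc j + 1) * x ^ Suc j * (y - x) = x * (real (j + 1) * x ^ j * (y - x)) + x ^ (j + 1) * (y - x)"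
    by (simp add: algebra_simps)
  also have "\<dots> \<le> x * (y ^ (j + 1) - x ^ (j + 1)) + x ^ (j + 1) * (y - x)"
    by (rule add_right_mono, rule mult_left_mono[OF Suc assms(1)])
  also have "\<dots> \<le> y * (y ^ (j + 1) - x ^ (j + 1)) + x ^ (j + 1) * (y - x)"
    using power_mono[OF assms(2,1), of "j + 1"] by (intro add_right_mono mult_right_mono assms(2)) linarith
  also have "\<dots> = y ^ (Suc j + 1) - x ^ (Suc j + 1)" by (simp add: algebra_simps)
  finally show ?case .
qed simp

lemma inj_shift: "inj (\<lambda>(j :: nat, k :: nat). (j + 1, k))" "inj (\<lambda>(j :: nat, k :: nat). (j, k + 1))"
  by (auto simp: inj_on_def)

lemma shift_summable:
  assumes "f summable_on (UNIV :: (nat \<times> nat) set)"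
  shows "(\<lambda>(j, k). (f (j + 1, k) :: real)) summable_on UNIV" "(\<lambda>(j, k). f (j, k + 1)) summable_on UNIV"
proof -
  have "(f \<circ> (\<lambda>(j, k). (j + 1, k))) summable_on UNIV" "(f \<circ> (\<lambda>(j, k). (j, k + 1))) summable_on UNIV"
    by (rule summable_on_reindex[OF inj_shift(1), THEN iffD1, OF summable_on_subset[OF assms subset_UNIV]]
        summable_on_reindex[OF inj_shift(2), THEN iffD1, OF summable_on_subset[OF assms subset_UNIV]])+
  then show "(\<lambda>(j, k). (f (j + 1, k) :: real)) summable_on UNIV" "(\<lambda>(j, k). f (j, k + 1)) summable_on UNIV"
    by (simp_all add: o_def case_prod_unfold)
qed

lemma conv2_ddx: assumes "conv2 X T a" shows "conv2 X T (ddx a)"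
  unfolding conv2_def
proof (intro allI impI)
  fix x t :: real assume xt: "0 \<le> x \<and> x < X \<and> 0 \<le> t \<and> t < T"
  \<comment> \<open>Any point strictly between \<open>x\<close> and \<open>X\<close> would do: the
    original series still converges there.\<close>
  define y where "y = (x + X) / 2"
  have y: "x < y" "y < X" "0 \<le> y" using xt by (auto simp: y_def)
  have "(\<lambda>(j, k). \<bar>a j k\<bar> * (y ^ j * t ^ k)) summable_on UNIV"
    using conv2D[OF assms] xt y by simp
  from shift_summable(1)[OF this]
  have "(\<lambda>(j, k). \<bar>a (j + 1) k\<bar> * (y ^ (j + 1) * t ^ k)) summable_on UNIV" by simp
  then have "(\<lambda>p. (1 / (y - x)) * (\<lambda>(j, k). \<bar>a (j + 1) k\<bar> * (y ^ (j + 1) * t ^ k)) p) summable_on UNIV"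
    by (rule summable_on_cmult_right)
  then show "(\<lambda>(j, k). \<bar>ddx a j k\<bar> * (x ^ j * t ^ k)) summable_on UNIV"
  proof (rule summable_on_comparison_test)
    fix p :: "nat \<times> nat"
    obtain j k where p: "p = (j, k)" by force
    have "real (j + 1) * x ^ j * (y - x) \<le> y ^ (j + 1)"
      using mult_power_le_diff_power[of x y j] xt y by (smt (verit) zero_le_power)
    then have "real (j + 1) * x ^ j \<le> y ^ (j + 1) / (y - x)" using y by (simp add: field_simps)
    then have "\<bar>a (j + 1) k\<bar> * (real (j + 1) * x ^ j) * t ^ k \<le> \<bar>a (j + 1) k\<bar> * (y ^ (j + 1) / (y - x)) * t ^ k"
      using xt by (intro mult_right_mono mult_left_mono) auto
    then show "(case p of (j, k) \<Rightarrow> \<bar>ddx a j k\<bar> * (x ^ j * t ^ k)) \<le> (1 / (y - x)) * (case p of (j, k) \<Rightarrow> \<bar>a (j + 1) k\<bar> * (y ^ (j + 1) * t ^ k))"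
      by (simp add: p ddx_def abs_mult mult_ac)
  qed (use xt in auto)
qed

lemma conv2_swap: "conv2 X T a \<longleftrightarrow> conv2 T X (\<lambda>j k. a k j)"
proof -
  have "conv2 T X (\<lambda>j k. a k j)" if "conv2 X T a" for X T a
    unfolding conv2_def
  proof (intro allI impI)
    fix x t :: real assume "0 \<le> x \<and> x < T \<and> 0 \<le> t \<and> t < X"
    then have "(\<lambda>(j, k). \<bar>a j k\<bar> * (t ^ j * x ^ k)) summable_on UNIV" using conv2D[OF that] by simp
    then have "((\<lambda>(j, k). \<bar>a j k\<bar> * (t ^ j * x ^ k)) \<circ> prod.swap) summable_on UNIV"
      by (subst summable_on_reindex[symmetric]) auto
    then show "(\<lambda>(j, k). \<bar>a k j\<bar> * (x ^ j * t ^ k)) summable_on UNIV"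
      by (simp add: o_def case_prod_unfold mult_ac)
  qed
  from this[of X T a] this[of T X "\<lambda>j k. a k j"] show ?thesis by auto
qed

lemma conv2_ddt: assumes "conv2 X T a" shows "conv2 X T (ddt a)"
  using conv2_ddx[OF assms[unfolded conv2_swap[of X T a]]] by (subst conv2_swap) (simp add: ddx_def[abs_def] ddt_def)

lemma has_sum_shift:
  fixes f :: "nat \<times> nat \<Rightarrow> real"
  shows "((\<lambda>(j, k). f (j + 1, k)) has_sum s) UNIV \<Longrightarrow> (\<And>k. f (0, k) = 0) \<Longrightarrow> (f has_sum s) UNIV"
    and "((\<lambda>(j, k). f (j, k + 1)) has_sum s) UNIV \<Longrightarrow> (\<And>j. f (j, 0) = 0) \<Longrightarrow> (f has_sum s) UNIV"
proof -
  have 1: "p \<in> range (\<lambda>(j, k). (j + 1, k))" if "fst p \<noteq> 0" for p :: "nat \<times> nat"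
    using that by (intro image_eqI[of _ _ "(fst p - 1, snd p)"]) (auto simp: prod_eq_iff)
  have 2: "p \<in> range (\<lambda>(j, k). (j, k + 1))" if "snd p \<noteq> 0" for p :: "nat \<times> nat"
    using that by (intro image_eqI[of _ _ "(fst p, snd p - 1)"]) (auto simp: prod_eq_iff)
  show "(f has_sum s) UNIV" if a: "((\<lambda>(j, k). f (j + 1, k)) has_sum s) UNIV" and 0: "\<And>k. f (0, k) = 0"
  proof -
    have "f p = 0" if "p \<notin> range (\<lambda>(j, k). (j + 1, k))" for p
      using 0[of "snd p"] 1[of p] that by (cases p) auto
    then show ?thesis
      using a has_sum_UNIV_reindex[OF inj_shift(1), of f] by (simp add: o_def case_prod_unfold)
  qed
  show "(f has_sum s) UNIV" if a: "((\<lambda>(j, k). f (j, k + 1)) has_sum s) UNIV" and 0: "\<And>j. f (j, 0) = 0"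
  proof -
    have "f p = 0" if "p \<notin> range (\<lambda>(j, k). (j, k + 1))" for p
      using 0[of "fst p"] 2[of p] that by (cases p) auto
    then show ?thesis
      using a has_sum_UNIV_reindex[OF inj_shift(2), of f] by (simp add: o_def case_prod_unfold)
  qed
qed

text \<open>Shifting the index turns the derived coefficients into termwise derivatives. At exponent
  0 the truncated subtraction \<open>j - 1\<close> is harmless, as the factor \<open>real j\<close>
  vanishes.\<close>

lemma pow2_deriv_has_sum:
  assumes a: "conv2 X T a" and xt: "\<bar>x\<bar> < X" "\<bar>t\<bar> < T"
  shows "((\<lambda>(j, k). a j k * (real j * x ^ (j - 1) * t ^ k)) has_sum pow2 (ddx a) x t) UNIV"
    and "((\<lambda>(j, k). a j k * (x ^ j * (real k * t ^ (k - 1)))) has_sum pow2 (ddt a) x t) UNIV"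
proof -
  show "((\<lambda>(j, k). a j k * (real j * x ^ (j - 1) * t ^ k)) has_sum pow2 (ddx a) x t) UNIV"
    by (rule has_sum_shift(1))
      (use pow2_has_sum[OF conv2_ddx[OF a] xt] in \<open>simp_all add: ddx_def mult_ac\<close>)
  show "((\<lambda>(j, k). a j k * (x ^ j * (real k * t ^ (k - 1)))) has_sum pow2 (ddt a) x t) UNIV"
    by (rule has_sum_shift(2))
      (use pow2_has_sum[OF conv2_ddt[OF a] xt] in \<open>simp_all add: ddt_def mult_ac\<close>)
qed

lemma has_sum_imp_sums_decode:
  fixes f :: "nat \<times> nat \<Rightarrow> real"
  assumes "(f has_sum s) UNIV"
  shows "(\<lambda>n. f (prod_decode n)) sums s"
proof -
  have "((f \<circ> prod_decode) has_sum s) UNIV"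
    using assms has_sum_reindex[OF inj_prod_decode[of UNIV], of f] by (simp add: surj_prod_decode)
  then show ?thesis using has_sum_imp_sums by (simp add: o_def)
qed


text \<open>The double series is enumerated by \<open>prod_decode\<close>. On a slightly smaller box
  its termwise derivatives are dominated by their absolute values at the corner
  \<open>(x1, t1)\<close>, so they converge uniformly and differentiation under the sum is
  justified.\<close>

lemma pow2_has_derivative:
  assumes a: "conv2 X T a" and xt: "\<bar>x\<bar> < X" "\<bar>t\<bar> < T"
  shows "((\<lambda>p. pow2 a (fst p) (snd p)) has_derivative (\<lambda>h. pow2 (ddx a) x t * fst h + pow2 (ddt a) x t * snd h)) (at (x, t))"
proof -
  obtain x1 where x1: "\<bar>x\<bar> < x1" "x1 < X" using dense[OF xt(1)] by blast
  obtain t1 where t1: "\<bar>t\<bar> < t1" "t1 < T" using dense[OF xt(2)] by blast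
  define S where "S = {-x1<..<x1} \<times> {-t1<..<t1}"
  have S: "open S" "convex S" "(x, t) \<in> S"
    using x1 t1 by (auto simp: S_def intro!: open_Times convex_Times)
  have inS: "\<bar>fst p\<bar> < X" "\<bar>snd p\<bar> < T" "\<bar>fst p\<bar> \<le> x1" "\<bar>snd p\<bar> \<le> t1" if "p \<in> S" for p
    using that x1 t1 by (auto simp: S_def)
  define c where "c n = a (fst (prod_decode n)) (snd (prod_decode n))" for n
  define J where "J n = fst (prod_decode n)" for n
  define K where "K n = snd (prod_decode n)" for n
  define f where "f n p = c n * (fst p ^ J n * snd p ^ K n)" for n and p :: "real \<times> real"
  define A where "A n p = c n * (real (J n) * fst p ^ (J n - 1) * snd p ^ K n)" for n and p :: "real \<times> real"
  define B where "B n p = c n * (fst p ^ J n * (real (K n) * snd p ^ (K n - 1)))" for n and p :: "real \<times> real"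
  define f' where "f' n p h = A n p * fst h + B n p * snd h" for n and p h :: "real \<times> real"
  have sums: "(\<lambda>n. f n p) sums pow2 a (fst p) (snd p)" "(\<lambda>n. A n p) sums pow2 (ddx a) (fst p) (snd p)"
    "(\<lambda>n. B n p) sums pow2 (ddt a) (fst p) (snd p)" if "p \<in> S" for p
    using has_sum_imp_sums_decode[OF pow2_has_sum[OF a inS(1,2)[OF that]]]
      has_sum_imp_sums_decode[OF pow2_deriv_has_sum(1)[OF a inS(1,2)[OF that]]]
      has_sum_imp_sums_decode[OF pow2_deriv_has_sum(2)[OF a inS(1,2)[OF that]]]
    by (simp_all add: f_def A_def B_def c_def J_def K_def case_prod_unfold)
  have x1t1: "\<bar>x1\<bar> < X" "\<bar>t1\<bar> < T" "0 \<le> x1" "0 \<le> t1" using x1 t1 by auto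
  define a' where "a' j k = \<bar>a j k\<bar>" for j k
  have a': "conv2 X T a'" using a by (simp add: conv2_def a'_def)
  define MA where "MA n = a' (J n) (K n) * (real (J n) * x1 ^ (J n - 1) * t1 ^ K n)" for n
  define MB where "MB n = a' (J n) (K n) * (x1 ^ J n * (real (K n) * t1 ^ (K n - 1)))" for n
  have M: "summable MA" "summable MB"
    using has_sum_imp_sums_decode[OF pow2_deriv_has_sum(1)[OF a' x1t1(1,2)]]
      has_sum_imp_sums_decode[OF pow2_deriv_has_sum(2)[OF a' x1t1(1,2)]]
    by (auto simp: MA_def[abs_def] MB_def[abs_def] J_def K_def case_prod_unfold sums_iff)
  have leA: "norm (A n p) \<le> MA n" and leB: "norm (B n p) \<le> MB n" if "p \<in> S" for n p
    using inS(3,4)[OF that] x1t1(3,4) unfolding A_def B_def MA_def MB_def a'_def c_def J_def K_def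
    by (auto simp: abs_mult power_abs intro!: mult_left_mono mult_mono power_mono)
  have uA: "uniform_limit S (\<lambda>n p. \<Sum>i<n. A i p) (\<lambda>p. \<Sum>i. A i p) sequentially"
    by (rule Weierstrass_m_test[OF leA M(1)])
  have uB: "uniform_limit S (\<lambda>n p. \<Sum>i<n. B i p) (\<lambda>p. \<Sum>i. B i p) sequentially"
    by (rule Weierstrass_m_test[OF leB M(2)])
  define g' where "g' p h = pow2 (ddx a) (fst p) (snd p) * fst h + pow2 (ddt a) (fst p) (snd p) * snd h" for p h :: "real \<times> real"
  have "\<exists>g. \<forall>p\<in>S. (\<lambda>n. f n p) sums g p \<and> (g has_derivative g' p) (at p within S)"
  proof (rule has_derivative_series[where f = f and f' = f' and g' = g', OF S(2) _ _ S(3) sums(1)[OF S(3)]])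
    fix n p assume "p \<in> S"
    show "(f n has_derivative f' n p) (at p within S)"
      unfolding f_def[abs_def] f'_def[abs_def] A_def B_def
      by (auto intro!: derivative_eq_intros simp: algebra_simps)
  next
    fix e :: real assume e: "e > 0"
    have "\<forall>\<^sub>F n in sequentially. (\<forall>p\<in>S. dist (\<Sum>i<n. A i p) (\<Sum>i. A i p) < e / 2) \<and> (\<forall>p\<in>S. dist (\<Sum>i<n. B i p) (\<Sum>i. B i p) < e / 2)"
      using uniform_limitD[OF uA, of "e / 2"] uniform_limitD[OF uB, of "e / 2"] e by (simp add: eventually_conj)
    then show "\<forall>\<^sub>F n in sequentially. \<forall>p\<in>S. \<forall>h. norm ((\<Sum>i<n. f' i p h) - g' p h) \<le> e * norm h"
    proof eventually_elim
      case (elim n)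
      show ?case
      proof (intro ballI allI)
        fix p h assume p: "p \<in> S"
        have s: "(\<Sum>i. A i p) = pow2 (ddx a) (fst p) (snd p)" "(\<Sum>i. B i p) = pow2 (ddt a) (fst p) (snd p)"
          using sums[OF p] by (auto simp: sums_iff)
        have "(\<Sum>i<n. f' i p h) - g' p h = ((\<Sum>i<n. A i p) - (\<Sum>i. A i p)) * fst h + ((\<Sum>i<n. B i p) - (\<Sum>i. B i p)) * snd h"
          unfolding f'_def g'_def s by (simp add: sum.distrib left_diff_distrib flip: sum_distrib_right)
        also have "norm \<dots> \<le> e / 2 * norm h + e / 2 * norm h"
        proof (rule norm_triangle_mono)
          have fs: "\<bar>fst h\<bar> \<le> norm h" "\<bar>snd h\<bar> \<le> norm h"
            using norm_fst_le[of "fst h" "snd h"] norm_snd_le[of "snd h" "fst h"] by simp_all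
          have small: "\<bar>(\<Sum>i<n. A i p) - (\<Sum>i. A i p)\<bar> \<le> e / 2" "\<bar>(\<Sum>i<n. B i p) - (\<Sum>i. B i p)\<bar> \<le> e / 2"
            using elim p by (auto simp: dist_real_def less_imp_le)
          show "norm (((\<Sum>i<n. A i p) - (\<Sum>i. A i p)) * fst h) \<le> e / 2 * norm h"
            unfolding real_norm_def abs_mult by (rule mult_mono[OF small(1) fs(1)]) (use e in auto)
          show "norm (((\<Sum>i<n. B i p) - (\<Sum>i. B i p)) * snd h) \<le> e / 2 * norm h"
            unfolding real_norm_def abs_mult by (rule mult_mono[OF small(2) fs(2)]) (use e in auto)
        qed
        finally show "norm ((\<Sum>i<n. f' i p h) - g' p h) \<le> e * norm h" by (simp add: algebra_simps)
      qed
    qed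
  qed
  then obtain g where g: "\<And>p. p \<in> S \<Longrightarrow> (\<lambda>n. f n p) sums g p" "\<And>p. p \<in> S \<Longrightarrow> (g has_derivative g' p) (at p within S)" by blast
  have "(g has_derivative g' (x, t)) (at (x, t))" using g(2)[OF S(3)] unfolding at_within_open[OF S(3,1)] .
  then have "((\<lambda>p. pow2 a (fst p) (snd p)) has_derivative g' (x, t)) (at (x, t))"
    by (rule has_derivative_transform_within_open[OF _ S(1,3)]) (rule sums_unique2[OF g(1) sums(1)])
  then show ?thesis by (simp add: g'_def[abs_def])
qed

section \<open>Axially symmetric functions\<close>

lemma inj_even_odd: "inj (\<lambda>(j :: nat, k :: nat). (j, 2 * k))" "inj (\<lambda>(j :: nat, k :: nat). (j, 2 * k + 1))"
  by (auto simp: inj_on_def)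

lemma has_sum_parity:
  fixes f :: "nat \<times> nat \<Rightarrow> real"
  assumes "(f has_sum s) UNIV"
  shows "(\<And>j k. odd k \<Longrightarrow> f (j, k) = 0) \<Longrightarrow> ((\<lambda>(j, k). f (j, 2 * k)) has_sum s) UNIV"
    and "(\<And>j k. even k \<Longrightarrow> f (j, k) = 0) \<Longrightarrow> ((\<lambda>(j, k). f (j, 2 * k + 1)) has_sum s) UNIV"
proof -
  have 1: "p \<in> range (\<lambda>(j, k). (j, 2 * k))" if "even (snd p)" for p :: "nat \<times> nat"
    using that by (intro image_eqI[of _ _ "(fst p, snd p div 2)"]) (auto simp: prod_eq_iff)
  have 2: "p \<in> range (\<lambda>(j, k). (j, 2 * k + 1))" if "odd (snd p)" for p :: "nat \<times> nat"
    using that by (intro image_eqI[of _ _ "(fst p, snd p div 2)"]) (auto simp: prod_eq_iff)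
  show "((\<lambda>(j, k). f (j, 2 * k)) has_sum s) UNIV" if 0: "\<And>j k. odd k \<Longrightarrow> f (j, k) = 0"
  proof -
    have "f p = 0" if "p \<notin> range (\<lambda>(j, k). (j, 2 * k))" for p using 0[of "snd p" "fst p"] 1[of p] that by (cases p) auto
    then show ?thesis
      using assms has_sum_UNIV_reindex[OF inj_even_odd(1), of f] by (simp add: o_def case_prod_unfold)
  qed
  show "((\<lambda>(j, k). f (j, 2 * k + 1)) has_sum s) UNIV" if 0: "\<And>j k. even k \<Longrightarrow> f (j, k) = 0"
  proof -
    have "f p = 0" if "p \<notin> range (\<lambda>(j, k). (j, 2 * k + 1))" for p using 0[of "snd p" "fst p"] 2[of p] that by (cases p) auto
    then show ?thesis
      using assms has_sum_UNIV_reindex[OF inj_even_odd(2), of f] by (simp add: o_def case_prod_unfold)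
  qed
qed

lemma pow2_even:
  assumes "evenr f" "\<bar>x\<bar> + \<bar>r\<bar> \<le> 3"
  shows "pow2 (\<lambda>j k. coef f j (2 * k)) x (r\<^sup>2) = deval x r f"
proof -
  have "((\<lambda>(j, k). coef f j (2 * k) * (x ^ j * r ^ (2 * k))) has_sum deval x r f) UNIV"
    using has_sum_parity(1)[OF deval_has_sum[OF assms(2), of f]] assms(1) by (simp add: evenr_def)
  then show ?thesis unfolding pow2_def by (simp add: power_mult infsumI)
qed

lemma pow2_odd:
  assumes "oddr f" "\<bar>x\<bar> + \<bar>r\<bar> \<le> 3" "((\<lambda>(j, k). b j k * (x ^ j * r\<^sup>2 ^ k)) has_sum s) UNIV"
    "\<And>j k. b j k = coef f j (2 * k + 1)"
  shows "r * s = deval x r f"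
proof -
  have "((\<lambda>(j, k). coef f j (2 * k + 1) * (x ^ j * r ^ (2 * k + 1))) has_sum deval x r f) UNIV"
    using has_sum_parity(2)[OF deval_has_sum[OF assms(2), of f]] assms(1) by (simp add: oddr_def)
  moreover have "((\<lambda>(j, k). coef f j (2 * k + 1) * (x ^ j * r ^ (2 * k + 1))) has_sum r * s) UNIV"
  proof -
    have "r * (b j k * (x ^ j * r\<^sup>2 ^ k)) = coef f j (2 * k + 1) * (x ^ j * r ^ (2 * k + 1))" for j k
      by (simp add: assms(4) power_add power_mult)
    then show ?thesis using has_sum_cmult_right[OF assms(3), of r] by (simp only: case_prod_unfold)
  qed
  ultimately show ?thesis using has_sum_unique by blast
qed

text \<open>The radii come from 7/4 + 5/4 = 3 and (5/4)^2 = 25/16: with t = r^2 the box lies in the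
  region |x| + |r| <= 3.\<close>

lemma conv2_even: "conv2 (7/4) (25/16) (\<lambda>j k. coef f j (2 * k))"
  unfolding conv2_def
proof (intro allI impI)
  fix x t :: real assume xt: "0 \<le> x \<and> x < 7/4 \<and> 0 \<le> t \<and> t < 25/16"
  have "sqrt t \<le> sqrt ((5/4)\<^sup>2)" using xt by (intro real_sqrt_le_mono) (simp add: power2_eq_square)
  then have r: "\<bar>x\<bar> + \<bar>sqrt t\<bar> \<le> 3" using xt by simp
  define n where "n = (\<lambda>(j, k). \<bar>coef f j k\<bar> * dweight j k)"
  have "n summable_on UNIV" unfolding n_def by (rule has_sum_imp_summable[OF norm_has_sum])
  then have "(n \<circ> (\<lambda>(j, k). (j, 2 * k))) summable_on UNIV"
    by (rule summable_on_reindex[OF inj_even_odd(1), THEN iffD1, OF summable_on_subset[OF _ subset_UNIV]])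
  then show "(\<lambda>(j, k). \<bar>coef f j (2 * k)\<bar> * (x ^ j * t ^ k)) summable_on UNIV"
  proof (rule summable_on_comparison_test)
    fix p :: "nat \<times> nat"
    obtain j k where p: "p = (j, k)" by force
    have "x ^ j * t ^ k = \<bar>x\<bar> ^ j * \<bar>sqrt t\<bar> ^ (2 * k)" using xt by (simp add: power_mult)
    also have "\<dots> \<le> dweight j (2 * k)" by (rule monomial_le_dweight[OF r])
    finally show "(case p of (j, k) \<Rightarrow> \<bar>coef f j (2 * k)\<bar> * (x ^ j * t ^ k)) \<le> (n \<circ> (\<lambda>(j, k). (j, 2 * k))) p"
      by (simp add: p n_def mult_left_mono)
  qed (use xt in auto)
qed

text \<open>The arguments \<open>f, a, b, A, k, D\<close> stand for \<open>v, v\<^sub>x, v\<^sub>x\<^sub>x, 2 v\<^sub>t, 2 v\<^sub>x\<^sub>t, 4 v\<^sub>t\<^sub>t\<close>, so that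
  \<open>V(x, r) = v(x, r\<^sup>2)\<close> has \<open>V\<^sub>r = r A\<close>, \<open>V\<^sub>x\<^sub>r = r k\<close> and \<open>V\<^sub>r\<^sub>r = A + r\<^sup>2 D\<close>. The unperturbed profile is
  \<open>c (t / 2 - q(x))\<close> with \<open>q(x) = x (x - d) (1 - x)\<close>.\<close>

definition near_profile :: "real \<Rightarrow> real \<Rightarrow> real \<Rightarrow> real \<Rightarrow> real \<Rightarrow> real \<Rightarrow> real \<Rightarrow> real \<Rightarrow> real \<Rightarrow> real \<Rightarrow> real \<Rightarrow> bool" where
  "near_profile c d \<delta> x t f a b A k D \<longleftrightarrow>
    \<bar>f - c * (t / 2 - x * (x - d) * (1 - x))\<bar> \<le> \<delta> \<and>
    \<bar>a - c * (3 * x\<^sup>2 - 2 * (1 + d) * x + d)\<bar> \<le> \<delta> \<and>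
    \<bar>b - c * (6 * x - 2 * (1 + d))\<bar> \<le> \<delta> \<and>
    \<bar>A - c\<bar> \<le> \<delta> \<and> \<bar>A + t * D - c\<bar> \<le> \<delta> \<and> t * k\<^sup>2 \<le> \<delta>\<^sup>2"

definition axisym_profile :: "nat \<Rightarrow> real \<Rightarrow> real \<Rightarrow> real \<Rightarrow> real \<Rightarrow> (nat \<Rightarrow> nat \<Rightarrow> real) \<Rightarrow> bool" where
  "axisym_profile m c d e \<delta> v \<longleftrightarrow> conv2 (7/4) (25/16) v \<and>
    (\<forall>x. 0 \<le> x \<and> x \<le> 7/4 \<longrightarrow> pow2 v x 0 = - c * (x * (x - d) * (1 - x))) \<and>
    (\<forall>x t f a b A k D. 0 \<le> x \<and> x < 7/4 \<and> 0 \<le> t \<and> t < 25/16 \<and> f = pow2 v x t \<and> a = pow2 (ddx v) x t \<and>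
        b = pow2 (ddx (ddx v)) x t \<and> A = 2 * pow2 (ddt v) x t \<and> k = 2 * pow2 (ddt (ddx v)) x t \<and> D = 4 * pow2 (ddt (ddt v)) x t \<longrightarrow>
      near_profile c d \<delta> x t f a b A k D \<and> reduced_equation (real m) e a b A (sqrt t * A) (sqrt t * k) (A + t * D))"

text \<open>For an even series t = r^2 is a legitimate variable, and V_r / r = 2 v_t transfers the
  bound on \<open>AA\<close>. The remaining second derivatives are controlled only with a factor t,
  through \<open>t * D\<close> = V_rr - V_r / r and \<open>t * k\<^sup>2\<close> = V_xr^2.\<close>

lemma axisym_profile_of_series:
  assumes "series_profile m c d e \<delta> V Vx Vxx AA Vrr Vxr"
  shows "axisym_profile m c d e \<delta> (\<lambda>j k. coef V j (2 * k))"
proof -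
  have par: "evenr V" "evenr AA" "evenr Vrr" "evenr Vx" "evenr Vxx" "oddr Vxr"
    and cx: "coef Vx j k = real (j + 1) * coef V (j + 1) k"
    and cxx: "coef Vxx j k = real (j + 2) * real (j + 1) * coef V (j + 2) k"
    and cA: "coef AA j k = real (k + 2) * coef V j (k + 2)"
    and crr: "coef Vrr j k = real (k + 2) * real (k + 1) * coef V j (k + 2)"
    and cxr: "coef Vxr j k = real (j + 1) * real (k + 1) * coef V (j + 1) (k + 1)"
    and axis: "\<bar>x\<bar> \<le> 3 \<Longrightarrow> deval x 0 V = - c * (x * (x - d) * (1 - x))" for j k x
    using assms unfolding series_profile_def by simp_all
  have near: "\<bar>deval x r V - c * (r\<^sup>2 / 2 - x * (x - d) * (1 - x))\<bar> \<le> \<delta>"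
      "\<bar>deval x r Vx - c * (3 * x\<^sup>2 - 2 * (1 + d) * x + d)\<bar> \<le> \<delta>"
      "\<bar>deval x r Vxx - c * (6 * x - 2 * (1 + d))\<bar> \<le> \<delta>"
      "\<bar>deval x r AA - c\<bar> \<le> \<delta>" "\<bar>deval x r Vrr - c\<bar> \<le> \<delta>" "\<bar>deval x r Vxr\<bar> \<le> \<delta>"
      "reduced_equation (real m) e (deval x r Vx) (deval x r Vxx) (deval x r AA) (r * deval x r AA) (deval x r Vxr) (deval x r Vrr)"
    if "\<bar>x\<bar> + \<bar>r\<bar> \<le> 3" for x r
    using assms that unfolding series_profile_def by blast+
  define v where "v j k = coef V j (2 * k)" for j k
  have cv: "conv2 (7/4) (25/16) v" unfolding v_def by (rule conv2_even)
  have ax: "\<forall>x. 0 \<le> x \<and> x \<le> 7/4 \<longrightarrow> pow2 v x 0 = - c * (x * (x - d) * (1 - x))"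
    using axis pow2_even[OF par(1), of _ 0] by (simp add: v_def[abs_def])
  have main: "near_profile c d \<delta> x t f a b A k D \<and> reduced_equation (real m) e a b A (sqrt t * A) (sqrt t * k) (A + t * D)"
    if H: "0 \<le> x \<and> x < 7/4 \<and> 0 \<le> t \<and> t < 25/16 \<and> f = pow2 v x t \<and> a = pow2 (ddx v) x t \<and>
        b = pow2 (ddx (ddx v)) x t \<and> A = 2 * pow2 (ddt v) x t \<and> k = 2 * pow2 (ddt (ddx v)) x t \<and> D = 4 * pow2 (ddt (ddt v)) x t"
    for x t f a b A k D
  proof -
    define r where "r = sqrt t"
    have t: "t = r\<^sup>2" "t \<ge> 0" "\<bar>x\<bar> < 7/4" "\<bar>t\<bar> < 25/16" using H by (auto simp: r_def)
    have "sqrt t \<le> sqrt ((5/4)\<^sup>2)" using H by (intro real_sqrt_le_mono) (simp add: power2_eq_square)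
    then have xr: "\<bar>x\<bar> + \<bar>r\<bar> \<le> 3" using H by (simp add: r_def)
    have f: "f = deval x r V" using H pow2_even[OF par(1) xr] by (simp add: v_def[abs_def] t(1))
    have a: "a = deval x r Vx"
    proof -
      have "ddx v = (\<lambda>j k. coef Vx j (2 * k))" by (simp add: fun_eq_iff ddx_def v_def cx)
      then show ?thesis using H pow2_even[OF par(4) xr] by (simp add: t(1))
    qed
    have b: "b = deval x r Vxx"
    proof -
      have "ddx (ddx v) = (\<lambda>j k. coef Vxx j (2 * k))" by (simp add: fun_eq_iff ddx_def v_def cxx)
      then show ?thesis using H pow2_even[OF par(5) xr] by (simp add: t(1))
    qed
    note hs = pow2_has_sum[OF _ t(3,4)]
    have A: "A = deval x r AA"
    proof -
      have "((\<lambda>(j, k). coef AA j (2 * k) * (x ^ j * t ^ k)) has_sum 2 * pow2 (ddt v) x t) UNIV"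
        using has_sum_cmult_right[OF hs[OF conv2_ddt[OF cv]], of 2]
        by (simp add: case_prod_unfold ddt_def v_def cA algebra_simps)
      then have "pow2 (\<lambda>j k. coef AA j (2 * k)) x t = A" using H by (simp add: pow2_def infsumI)
      then show ?thesis using pow2_even[OF par(2) xr] by (simp add: t(1))
    qed
    \<comment> \<open>The factor \<open>t\<close> in front of \<open>D\<close> moves its
      coefficients up by one index, hence the default value 0 at \<open>k = 0\<close>.\<close>
    have h: "A + t * D = deval x r Vrr"
    proof -
      have 2: "((\<lambda>(j, k). (if k = 0 then 0 else 4 * ddt (ddt v) j (k - 1)) * (x ^ j * t ^ k)) has_sum t * D) UNIV"
        by (rule has_sum_shift(2))
          (use has_sum_cmult_right[OF hs[OF conv2_ddt[OF conv2_ddt[OF cv]]], of "4 * t"] H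
            in \<open>simp_all add: case_prod_unfold mult_ac\<close>)
      have 1: "((\<lambda>(j, k). 2 * ddt v j k * (x ^ j * t ^ k)) has_sum A) UNIV"
        using has_sum_cmult_right[OF hs[OF conv2_ddt[OF cv]], of 2] H by (simp add: case_prod_unfold mult_ac)
      have eq: "2 * ddt v j k + (if k = 0 then 0 else 4 * ddt (ddt v) j (k - 1)) = coef Vrr j (2 * k)" for j k
        by (cases k) (simp_all add: ddt_def v_def crr algebra_simps)
      have "((\<lambda>(j, k). coef Vrr j (2 * k) * (x ^ j * t ^ k)) has_sum A + t * D) UNIV"
        using has_sum_add[OF 1 2] by (simp add: case_prod_unfold flip: eq distrib_right)
      then have "pow2 (\<lambda>j k. coef Vrr j (2 * k)) x t = A + t * D" by (simp add: pow2_def infsumI)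
      then show ?thesis using pow2_even[OF par(3) xr] by (simp add: t(1))
    qed
    have k: "r * k = deval x r Vxr"
    proof (rule pow2_odd[OF par(6) xr])
      show "((\<lambda>(j, k). 2 * ddt (ddx v) j k * (x ^ j * r\<^sup>2 ^ k)) has_sum k) UNIV"
        using has_sum_cmult_right[OF hs[OF conv2_ddt[OF conv2_ddx[OF cv]]], of 2] H
        by (simp add: case_prod_unfold mult_ac flip: t(1))
      show "2 * ddt (ddx v) j k = coef Vxr j (2 * k + 1)" for j k
        by (simp add: ddt_def ddx_def v_def cxr algebra_simps)
    qed
    have rk: "t * k\<^sup>2 = (r * k)\<^sup>2" by (simp add: t(1) power_mult_distrib)
    have "\<bar>r * k\<bar> \<le> \<delta>" using near(6)[OF xr] k by simp
    then have "(r * k)\<^sup>2 \<le> \<delta>\<^sup>2" by (metis abs_ge_zero power2_abs power_mono)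
    then show ?thesis
      unfolding near_profile_def rk f a b h r_def[symmetric] k
      using near[OF xr] by (simp only: t(1) A k simp_thms)
  qed
  show ?thesis
    unfolding axisym_profile_def v_def[symmetric] using cv ax main by blast
qed

section \<open>Functions of the axial coordinate and the scaled squared radius\<close>

definition perp_sq :: "'n::finite \<Rightarrow> real \<Rightarrow> real ^ 'n \<Rightarrow> real" where
  "perp_sq i0 e x = (\<Sum>i\<in>UNIV - {i0}. (x $ i)\<^sup>2) / e"

definition axisym :: "'n::finite \<Rightarrow> real \<Rightarrow> (nat \<Rightarrow> nat \<Rightarrow> real) \<Rightarrow> real ^ 'n \<Rightarrow> real" where
  "axisym i0 e a x = pow2 a (x $ i0) (perp_sq i0 e x)"

definition axisym_region :: "'n::finite \<Rightarrow> real \<Rightarrow> real \<Rightarrow> real \<Rightarrow> (real ^ 'n) set" where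
  "axisym_region i0 e X T = {x. 0 < x $ i0 \<and> x $ i0 < X \<and> perp_sq i0 e x < T}"

lemma continuous_perp_sq: "continuous_on S (perp_sq i0 e)"
  unfolding perp_sq_def[abs_def] divide_inverse by (intro continuous_intros)

lemma open_axisym_region: "open (axisym_region i0 e X T)"
  unfolding axisym_region_def
  by (intro open_Collect_conj open_Collect_less continuous_intros continuous_perp_sq)

lemma perp_sq_nonneg: "e > 0 \<Longrightarrow> 0 \<le> perp_sq i0 e x"
  by (simp add: perp_sq_def sum_nonneg)

lemma perp_sq_has_derivative:
  "(perp_sq i0 e has_derivative (\<lambda>h. \<Sum>i\<in>UNIV - {i0}. 2 / e * x $ i * h $ i)) (at x)"
proof -
  have nth: "((\<lambda>x. x $ i) has_derivative (\<lambda>h. h $ i)) (at x)" for i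
    by (rule bounded_linear_imp_has_derivative) (rule bounded_linear_vec_nth)
  have "((\<lambda>x. (\<Sum>i\<in>UNIV - {i0}. (x $ i)\<^sup>2) * inverse e) has_derivative
      (\<lambda>h. (\<Sum>i\<in>UNIV - {i0}. real 2 * h $ i * (x $ i) ^ (2 - 1)) * inverse e)) (at x)"
    by (intro has_derivative_mult_left has_derivative_sum has_derivative_power nth)
  then show ?thesis
    unfolding perp_sq_def[abs_def] divide_inverse by (simp add: sum_distrib_left mult_ac)
qed

lemma axisym_has_derivative:
  assumes a: "conv2 X T a" and e: "e > 0" and x: "x \<in> axisym_region i0 e X T"
  shows "(axisym i0 e a has_derivative
    (\<lambda>h. axisym i0 e (ddx a) x * h $ i0 + axisym i0 e (ddt a) x * (\<Sum>i\<in>UNIV - {i0}. 2 / e * x $ i * h $ i))) (at x)"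
proof -
  have xt: "\<bar>x $ i0\<bar> < X" "\<bar>perp_sq i0 e x\<bar> < T"
    using x perp_sq_nonneg[OF e, of i0 x] by (auto simp: axisym_region_def)
  have nth: "((\<lambda>x. x $ i0) has_derivative (\<lambda>h. h $ i0)) (at x)"
    by (rule bounded_linear_imp_has_derivative) (rule bounded_linear_vec_nth)
  have "((\<lambda>x. (x $ i0, perp_sq i0 e x)) has_derivative (\<lambda>h. (h $ i0, \<Sum>i\<in>UNIV - {i0}. 2 / e * x $ i * h $ i))) (at x)"
    by (rule has_derivative_Pair[OF nth perp_sq_has_derivative])
  from has_derivative_compose[OF this pow2_has_derivative[OF a xt]]
  show ?thesis by (simp add: axisym_def[abs_def])
qed

text \<open>A class closed under partial differentiation, made for
  \<open>smooth_on_coinduct\<close>. The reciprocal of the axial coordinate is included because of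
  the quotient u / x_1; it is harmless on the region, where that coordinate is positive.\<close>

inductive axisym_smooth :: "'n::finite \<Rightarrow> real \<Rightarrow> real \<Rightarrow> real \<Rightarrow> (real ^ 'n \<Rightarrow> real) \<Rightarrow> bool" for i0 e X T where
  const: "axisym_smooth i0 e X T (\<lambda>x. c)"
| coord: "axisym_smooth i0 e X T (\<lambda>x. x $ i)"
| axisym: "conv2 X T a \<Longrightarrow> axisym_smooth i0 e X T (axisym i0 e a)"
| inv: "axisym_smooth i0 e X T (\<lambda>x. inverse (x $ i0))"
| add: "axisym_smooth i0 e X T f \<Longrightarrow> axisym_smooth i0 e X T g \<Longrightarrow> axisym_smooth i0 e X T (\<lambda>x. f x + g x)"
| mult: "axisym_smooth i0 e X T f \<Longrightarrow> axisym_smooth i0 e X T g \<Longrightarrow> axisym_smooth i0 e X T (\<lambda>x. f x * g x)"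

lemma sum_axis: "(\<Sum>i\<in>UNIV. (if i = j then a else 0) * h $ i) = a * (h :: real ^ 'n::finite) $ j"
  by (simp add: if_distrib[of "\<lambda>z. z * _"] cong: if_cong)

lemma sum_split: "(\<Sum>i\<in>UNIV. f i) = f i0 + (\<Sum>i\<in>UNIV - {i0 :: 'n::finite}. f i :: real)"
  by (simp add: sum.remove)

lemma axisym_smooth_has_derivative:
  fixes i0 :: "'n::finite"
  assumes e: "e > 0" and "axisym_smooth i0 e X T f"
  shows "\<exists>g. (\<forall>i. axisym_smooth i0 e X T (g i)) \<and>
    (\<forall>x\<in>axisym_region i0 e X T. (f has_derivative (\<lambda>h. \<Sum>i\<in>UNIV. g i x * h $ i)) (at x))"
  using assms(2)
proof induction
  case (const c)
  show ?case
    by (rule exI[of _ "\<lambda>i x. 0"]) (auto intro: axisym_smooth.const)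
next
  case (coord j)
  have "((\<lambda>x. x $ j) has_derivative (\<lambda>h. \<Sum>i\<in>UNIV. (if i = j then 1 else 0) * h $ i)) (at x)" for x :: "real ^ 'n"
    unfolding sum_axis mult_1 by (rule bounded_linear_imp_has_derivative) (rule bounded_linear_vec_nth)
  then show ?case
    by (intro exI[of _ "\<lambda>i x. if i = j then 1 else 0"]) (auto intro: axisym_smooth.const)
next
  case (axisym a)
  define g where "g i = (if i = i0 then axisym i0 e (ddx a) else (\<lambda>x. (2 / e * x $ i) * axisym i0 e (ddt a) x))" for i
  have "axisym_smooth i0 e X T (g i)" for i
  proof (cases "i = i0")
    case True
    then have "g i = axisym i0 e (ddx a)" by (simp add: g_def)
    then show ?thesis using axisym_smooth.axisym[OF conv2_ddx[OF axisym]] by simp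
  next
    case False
    then have "g i = (\<lambda>x. (2 / e * x $ i) * axisym i0 e (ddt a) x)" by (simp add: g_def)
    moreover have "axisym_smooth i0 e X T (\<lambda>x. (2 / e * x $ i) * axisym i0 e (ddt a) x)"
      by (intro axisym_smooth.mult axisym_smooth.const axisym_smooth.coord axisym_smooth.axisym conv2_ddt axisym)
    ultimately show ?thesis by simp
  qed
  moreover have "(axisym i0 e a has_derivative (\<lambda>h. \<Sum>i\<in>UNIV. g i x * h $ i)) (at x)" if "x \<in> axisym_region i0 e X T" for x
  proof -
    have "(\<lambda>h. \<Sum>i\<in>UNIV. g i x * h $ i) =
      (\<lambda>h. axisym i0 e (ddx a) x * h $ i0 + axisym i0 e (ddt a) x * (\<Sum>i\<in>UNIV - {i0}. 2 / e * x $ i * h $ i))"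
      unfolding sum_split[of _ i0] by (auto simp: fun_eq_iff g_def sum_distrib_left intro!: sum.cong)
    then show ?thesis using axisym_has_derivative[OF axisym e that] by simp
  qed
  ultimately show ?case by blast
next
  case inv
  have "((\<lambda>x. inverse (x $ i0)) has_derivative (\<lambda>h. \<Sum>i\<in>UNIV. (if i = i0 then - 1 * (inverse (x $ i0) * inverse (x $ i0)) else 0) * h $ i)) (at x)"
    if "x \<in> axisym_region i0 e X T" for x
  proof -
    have nth: "((\<lambda>x. x $ i0) has_derivative (\<lambda>h. h $ i0)) (at x)"
      by (rule bounded_linear_imp_has_derivative) (rule bounded_linear_vec_nth)
    have "x $ i0 \<noteq> 0" using that by (simp add: axisym_region_def)
    from Deriv.has_derivative_inverse[OF this nth] show ?thesis
      unfolding sum_axis by (simp add: mult_ac)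
  qed
  moreover have "axisym_smooth i0 e X T (\<lambda>x. if i = i0 then - 1 * (inverse (x $ i0) * inverse (x $ i0)) else 0)" for i
  proof (cases "i = i0")
    case True
    have "axisym_smooth i0 e X T (\<lambda>x. - 1 * (inverse (x $ i0) * inverse (x $ i0)))"
      by (intro axisym_smooth.mult axisym_smooth.const axisym_smooth.inv)
    then show ?thesis using True by simp
  next
    case False
    then show ?thesis using axisym_smooth.const[of i0 e X T 0] by simp
  qed
  ultimately show ?case
    by (intro exI[of _ "\<lambda>i x. if i = i0 then - 1 * (inverse (x $ i0) * inverse (x $ i0)) else 0"]) blast
next
  case (add f g)
  then obtain f' g' where *: "\<And>i. axisym_smooth i0 e X T (f' i)" "\<And>i. axisym_smooth i0 e X T (g' i)"
    "\<And>x. x \<in> axisym_region i0 e X T \<Longrightarrow> (f has_derivative (\<lambda>h. \<Sum>i\<in>UNIV. f' i x * h $ i)) (at x)"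
    "\<And>x. x \<in> axisym_region i0 e X T \<Longrightarrow> (g has_derivative (\<lambda>h. \<Sum>i\<in>UNIV. g' i x * h $ i)) (at x)" by blast
  have "((\<lambda>x. f x + g x) has_derivative (\<lambda>h. \<Sum>i\<in>UNIV. (f' i x + g' i x) * h $ i)) (at x)"
    if "x \<in> axisym_region i0 e X T" for x
    using has_derivative_add[OF *(3,4)[OF that]] by (simp add: distrib_right sum.distrib)
  then show ?case
    by (intro exI[of _ "\<lambda>i x. f' i x + g' i x"]) (auto intro: axisym_smooth.add *)
next
  case (mult f g)
  then obtain f' g' where *: "\<And>i. axisym_smooth i0 e X T (f' i)" "\<And>i. axisym_smooth i0 e X T (g' i)"
    "\<And>x. x \<in> axisym_region i0 e X T \<Longrightarrow> (f has_derivative (\<lambda>h. \<Sum>i\<in>UNIV. f' i x * h $ i)) (at x)"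
    "\<And>x. x \<in> axisym_region i0 e X T \<Longrightarrow> (g has_derivative (\<lambda>h. \<Sum>i\<in>UNIV. g' i x * h $ i)) (at x)" by blast
  have "((\<lambda>x. f x * g x) has_derivative (\<lambda>h. \<Sum>i\<in>UNIV. (f x * g' i x + f' i x * g x) * h $ i)) (at x)"
    if "x \<in> axisym_region i0 e X T" for x
    using has_derivative_mult[OF *(3,4)[OF that]]
    by (simp add: distrib_left sum.distrib sum_distrib_left sum_distrib_right mult_ac)
  then show ?case
    by (intro exI[of _ "\<lambda>i x. f x * g' i x + f' i x * g x"]) (auto intro!: axisym_smooth.add axisym_smooth.mult * mult.hyps)
qed

lemma axisym_smooth_imp_smooth_on:
  assumes e: "e > 0" and "axisym_smooth i0 e X T f"
  shows "smooth_on f (axisym_region i0 e X T)"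
proof (rule smooth_on_coinduct[OF open_axisym_region, where G = "Collect (axisym_smooth i0 e X T)"])
  fix f assume "f \<in> Collect (axisym_smooth i0 e X T)"
  then obtain g where g: "\<And>i. axisym_smooth i0 e X T (g i)"
    "\<And>x. x \<in> axisym_region i0 e X T \<Longrightarrow> (f has_derivative (\<lambda>h. \<Sum>i\<in>UNIV. g i x * h $ i)) (at x)"
    using axisym_smooth_has_derivative[OF e] by blast
  show "f differentiable_on axisym_region i0 e X T"
    unfolding differentiable_on_eq_differentiable_at[OF open_axisym_region] differentiable_def using g(2) by blast
  show "\<exists>g\<in>Collect (axisym_smooth i0 e X T). \<forall>x\<in>axisym_region i0 e X T. partial_deriv i f x = g x" for i
  proof (intro bexI[of _ "g i"] ballI)
    fix x assume "x \<in> axisym_region i0 e X T"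
    then have "partial_deriv i f x = (\<Sum>j\<in>UNIV. g j x * axis i 1 $ j)"
      using partial_deriv_eq[OF g(2)] by blast
    then show "partial_deriv i f x = g i x" by (simp add: axis_def if_distrib cong: if_cong)
  qed (use g in auto)
qed (use assms in auto)

lemma axisym_has_derivative_inner:
  fixes i0 :: "'n::finite"
  assumes "e > 0" "conv2 X T a" "x \<in> axisym_region i0 e X T"
  shows "(axisym i0 e a has_derivative
    (\<lambda>h. (\<chi> i. if i = i0 then axisym i0 e (ddx a) x else 2 / e * x $ i * axisym i0 e (ddt a) x) \<bullet> h)) (at x)"
proof -
  have "(\<lambda>h. axisym i0 e (ddx a) x * h $ i0 + axisym i0 e (ddt a) x * (\<Sum>i\<in>UNIV - {i0}. 2 / e * x $ i * h $ i))
    = (\<lambda>h. (\<chi> i. if i = i0 then axisym i0 e (ddx a) x else 2 / e * x $ i * axisym i0 e (ddt a) x) \<bullet> h)"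
    unfolding inner_vec_def sum_split[of _ i0] by (auto simp: fun_eq_iff sum_distrib_left intro!: sum.cong)
  then show ?thesis using axisym_has_derivative[OF assms(2,1,3)] by simp
qed

text \<open>Chain rule with t = |x'|^2 / e. The outer factor \<open>e\<close> cancels the 1 / e of a
  transverse derivative, so transverse second derivatives have order one and the axial one has order
  \<open>e\<close>. The rank-one terms isolate the plane of the axis and x'; elsewhere the Hessian
  is a multiple of the identity.\<close>

lemma grad_hessian_axisym:
  fixes i0 :: "'n::finite"
  assumes e: "e > 0" and v: "conv2 X T v" and x: "x \<in> axisym_region i0 e X T"
  defines "u \<equiv> \<lambda>x. e * axisym i0 e v x"
  defines "y \<equiv> \<chi> i. if i = i0 then 0 else x $ i" and "a1 \<equiv> axis i0 (1::real)"
  shows "grad u x = (e * axisym i0 e (ddx v) x) *\<^sub>R a1 + (2 * axisym i0 e (ddt v) x) *\<^sub>R y"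
    and "hessian u x = (e * axisym i0 e (ddx (ddx v)) x - 2 * axisym i0 e (ddt v) x) *\<^sub>R outer a1 a1
      + (2 * axisym i0 e (ddt (ddx v)) x) *\<^sub>R (outer a1 y + outer y a1)
      + (2 * axisym i0 e (ddt v) x) *\<^sub>R mat 1 + (4 * axisym i0 e (ddt (ddt v)) x / e) *\<^sub>R outer y y"
proof -
  note cv = conv2_ddx[OF v] conv2_ddt[OF v]
  define g where "g i = (if i = i0 then (\<lambda>x. e * axisym i0 e (ddx v) x) else (\<lambda>x. 2 * (x $ i * axisym i0 e (ddt v) x)))" for i
  have pu: "partial_deriv i u z = g i z" if z: "z \<in> axisym_region i0 e X T" for i z
  proof -
    have "(u has_derivative (\<lambda>h. e * ((\<chi> i. if i = i0 then axisym i0 e (ddx v) z else 2 / e * z $ i * axisym i0 e (ddt v) z) \<bullet> h))) (at z)"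
      unfolding u_def by (intro has_derivative_mult_right axisym_has_derivative_inner[OF e v z])
    from partial_deriv_eq[OF this, of i] show ?thesis using e by (simp add: g_def inner_axis)
  qed
  show "grad u x = (e * axisym i0 e (ddx v) x) *\<^sub>R a1 + (2 * axisym i0 e (ddt v) x) *\<^sub>R y"
    by (simp add: vec_eq_iff grad_def pu[OF x] g_def a1_def y_def axis_def)
  have dtx: "ddt (ddx v) = ddx (ddt v)" by (simp add: fun_eq_iff ddt_def ddx_def)
  have ppu: "partial_deriv j (partial_deriv i u) x = partial_deriv j (g i) x" for i j
    by (rule partial_deriv_cong[OF open_axisym_region x pu])
  have g0: "partial_deriv j (g i0) x = (if j = i0 then e * axisym i0 e (ddx (ddx v)) x else 2 * x $ j * axisym i0 e (ddt (ddx v)) x)" for j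
  proof -
    have "(g i0 has_derivative (\<lambda>h. e * ((\<chi> i. if i = i0 then axisym i0 e (ddx (ddx v)) x else 2 / e * x $ i * axisym i0 e (ddt (ddx v)) x) \<bullet> h))) (at x)"
      unfolding g_def by simp (intro has_derivative_mult_right axisym_has_derivative_inner[OF e cv(1) x])
    from partial_deriv_eq[OF this, of j] show ?thesis using e by (simp add: inner_axis)
  qed
  have gi: "partial_deriv j (g i) x = (if j = i0 then 2 * x $ i * axisym i0 e (ddt (ddx v)) x
      else 4 / e * x $ i * x $ j * axisym i0 e (ddt (ddt v)) x + (if i = j then 2 * axisym i0 e (ddt v) x else 0))" if "i \<noteq> i0" for i j
  proof -
    have nth: "((\<lambda>x. x $ i) has_derivative (\<lambda>h. h $ i)) (at x)"
      by (rule bounded_linear_imp_has_derivative) (rule bounded_linear_vec_nth)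
    have gi_eq: "g i = (\<lambda>x. 2 * (x $ i * axisym i0 e (ddt v) x))" using that by (simp add: g_def)
    have "(g i has_derivative (\<lambda>h. 2 * (x $ i * ((\<chi> i. if i = i0 then axisym i0 e (ddx (ddt v)) x else 2 / e * x $ i * axisym i0 e (ddt (ddt v)) x) \<bullet> h)
        + h $ i * axisym i0 e (ddt v) x))) (at x)"
      unfolding gi_eq
      by (intro has_derivative_mult_right has_derivative_mult nth axisym_has_derivative_inner[OF e cv(2) x])
    moreover have ax: "axis j (1::real) $ i = (if i = j then 1 else 0)" by (simp add: axis_def)
    ultimately show ?thesis
      using partial_deriv_eq[of "g i" _ x j] e that by (auto simp: inner_axis dtx ax)
  qed
  show "hessian u x = (e * axisym i0 e (ddx (ddx v)) x - 2 * axisym i0 e (ddt v) x) *\<^sub>R outer a1 a1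
      + (2 * axisym i0 e (ddt (ddx v)) x) *\<^sub>R (outer a1 y + outer y a1)
      + (2 * axisym i0 e (ddt v) x) *\<^sub>R mat 1 + (4 * axisym i0 e (ddt (ddt v)) x / e) *\<^sub>R outer y y"
  proof -
    have "hessian u x $ i $ j = ((e * axisym i0 e (ddx (ddx v)) x - 2 * axisym i0 e (ddt v) x) *\<^sub>R outer a1 a1
      + (2 * axisym i0 e (ddt (ddx v)) x) *\<^sub>R (outer a1 y + outer y a1)
      + (2 * axisym i0 e (ddt v) x) *\<^sub>R mat 1 + (4 * axisym i0 e (ddt (ddt v)) x / e) *\<^sub>R outer y y) $ i $ j" for i j
      unfolding hessian_def using ppu[of j i] g0[of j] gi[of i j]
      by (cases "i = i0"; cases "j = i0") (auto simp: outer_def a1_def y_def axis_def mat_def)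
    then show ?thesis by (simp add: vec_eq_iff)
  qed
qed

text \<open>This is \<open>sigma1\<close> of the graph curvatures times (1 + |Du|^2)^(3/2), in the
  reduced variables.\<close>

definition reduced_mean_curvature :: "real \<Rightarrow> real \<Rightarrow> real \<Rightarrow> real \<Rightarrow> real \<Rightarrow> real \<Rightarrow> real \<Rightarrow> real \<Rightarrow> real" where
  "reduced_mean_curvature m e t a b A k D =
    (1 + e * t * A\<^sup>2) * (e * b) - 2 * e\<^sup>2 * a * t * A * k + (1 + e\<^sup>2 * a\<^sup>2) * (A + t * D)
      + m * A * (1 + e\<^sup>2 * a\<^sup>2 + e * t * A\<^sup>2)"

text \<open>On the orthogonal complement of \<open>a1\<close> and \<open>y\<close> the Hessian is
  multiplication by \<open>A\<close>, so all traces and forms follow from its action on these two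
  vectors, the dimension entering through the trace of the identity. Positivity of
  \<open>sigma2\<close> is a consequence of the equation; that of \<open>sigma1\<close> comes from
  \<open>pos\<close>.\<close>

lemma axisymmetric_sigma:
  fixes y a1 :: "real ^ 'n::finite"
  assumes e: "e > 0" and a1: "a1 \<bullet> a1 = 1" "a1 \<bullet> y = 0" and yy: "y \<bullet> y = e * t" and n: "real CARD('n) = m + 2"
    and g: "grad u x = (e * a) *\<^sub>R a1 + A *\<^sub>R y"
    and H: "hessian u x = (e * b - A) *\<^sub>R outer a1 a1 + k *\<^sub>R (outer a1 y + outer y a1) + A *\<^sub>R mat 1 + (D / e) *\<^sub>R outer y y"
    and t: "t \<ge> 0" and eqn: "reduced_equation m e a b A (sqrt t * A) (sqrt t * k) (A + t * D)"
    and pos: "0 < reduced_mean_curvature m e t a b A k D"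
  shows "sigma2 (graph_curvatures u x) = (1 + (norm (grad u x))\<^sup>2) powi (-2)" "graph_curvatures u x \<in> Gamma2"
proof -
  have pde: "e * (b * (A + t * D) - t * k\<^sup>2)
         + m * A * ((1 + e * t * A\<^sup>2) * (e * b) - 2 * e\<^sup>2 * a * t * A * k + (1 + e\<^sup>2 * a\<^sup>2) * (A + t * D))
         + m * (m - 1) / 2 * A\<^sup>2 * (1 + e\<^sup>2 * a\<^sup>2 + e * t * A\<^sup>2) = 1"
  proof -
    have "2 * e\<^sup>2 * a * (sqrt t * A) * (sqrt t * k) = 2 * e\<^sup>2 * a * (sqrt t * sqrt t) * A * k" by (simp only: mult_ac)
    also have "\<dots> = 2 * e\<^sup>2 * a * t * A * k" using t by simp
    finally have 1: "2 * e\<^sup>2 * a * (sqrt t * A) * (sqrt t * k) = 2 * e\<^sup>2 * a * t * A * k" .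
    have 2: "e * (sqrt t * A)\<^sup>2 = e * t * A\<^sup>2" "(sqrt t * k)\<^sup>2 = t * k\<^sup>2" using t by (simp_all add: power_mult_distrib)
    show ?thesis using eqn unfolding reduced_equation_def 1 2 .
  qed
  define H' where "H' = hessian u x"
  define p where "p = grad u x"
  define w where "w = 1 + (norm p)\<^sup>2"
  have sym: "transpose H' = H'"
    unfolding H'_def H by (simp add: transpose_def outer_def vec_eq_iff mat_def algebra_simps)
  have ya: "y \<bullet> a1 = 0" using a1(2) by (simp add: inner_commute)
  have Hv: "H' *v z = (e * b - A) *\<^sub>R ((a1 \<bullet> z) *\<^sub>R a1) + k *\<^sub>R ((y \<bullet> z) *\<^sub>R a1 + (a1 \<bullet> z) *\<^sub>R y) + A *\<^sub>R z + (D / e) *\<^sub>R ((y \<bullet> z) *\<^sub>R y)" for z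
    unfolding H'_def H by (simp add: matrix_vector_mult_add_rdistrib outer_mult_vec flip: scaleR_matrix_vector_assoc)
  have Ha: "H' *v a1 = (e * b) *\<^sub>R a1 + k *\<^sub>R y"
    unfolding Hv by (simp add: a1 ya algebra_simps)
  have Hy: "H' *v y = (k * (e * t)) *\<^sub>R a1 + (A + D * t) *\<^sub>R y"
    unfolding Hv using e by (simp add: a1 yy scaleR_add_left)
  have w: "w = 1 + e\<^sup>2 * a\<^sup>2 + e * t * A\<^sup>2"
    unfolding w_def p_def g power2_norm_eq_inner by (simp add: inner_add_left inner_add_right a1 ya yy power2_eq_square)
  have Hp: "H' *v p = (e * a * (e * b) + A * (k * (e * t))) *\<^sub>R a1 + (e * a * k + A * (A + D * t)) *\<^sub>R y"
    unfolding p_def g by (simp add: matrix_vector_right_distrib matrix_vector_mult_scaleR Ha Hy algebra_simps)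
  have pHp: "p \<bullet> (H' *v p) = (e * a) * (e * a * (e * b) + A * (k * (e * t))) + A * (e * a * k + A * (A + D * t)) * (e * t)"
    unfolding Hp unfolding p_def g by (simp add: inner_add_left inner_add_right a1 ya yy)
  have Hp2: "(norm (H' *v p))\<^sup>2 = (e * a * (e * b) + A * (k * (e * t)))\<^sup>2 + (e * a * k + A * (A + D * t))\<^sup>2 * (e * t)"
    unfolding Hp power2_norm_eq_inner by (simp add: inner_add_left inner_add_right a1 ya yy power2_eq_square)
  have trs: "trace (c *\<^sub>R N) = c * trace N" for c and N :: "real ^ 'n ^ 'n"
    by (simp add: trace_def sum_distrib_left)
  have tro: "trace (N ** outer c z) = z \<bullet> (N *v c)" for c z and N :: "real ^ 'n ^ 'n"
  proof -
    have "trace (N ** outer c z) = (\<Sum>i\<in>UNIV. \<Sum>j\<in>UNIV. z $ i * (N $ i $ j * c $ j))"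
      by (simp add: trace_def matrix_matrix_mult_def outer_def mult_ac)
    then show ?thesis by (simp add: inner_vec_def matrix_vector_mult_def sum_distrib_left)
  qed
  have tro1: "trace (outer c z) = z \<bullet> c" for c z :: "real ^ 'n"
    using tro[of "mat 1" c z] by simp
  have tr: "trace H' = e * b + (m + 1) * A + D * t"
  proof -
    have "trace H' = (e * b - A) + A * trace (mat 1 :: real ^ 'n ^ 'n) + (D / e) * (e * t)"
      unfolding H'_def H by (simp add: trace_add trs tro1 a1 ya yy)
    moreover have "trace (mat 1 :: real ^ 'n ^ 'n) = m + 2" using n by (simp add: trace_I)
    ultimately show ?thesis using e by (simp add: algebra_simps)
  qed
  have trHH: "trace (H' ** H') = (e * b - A) * (e * b) + 2 * k\<^sup>2 * (e * t) + A * trace H' + D * t * (A + D * t)"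
  proof -
    have "H' ** H' = (e * b - A) *\<^sub>R (H' ** outer a1 a1) + k *\<^sub>R (H' ** outer a1 y + H' ** outer y a1) + A *\<^sub>R H' + (D / e) *\<^sub>R (H' ** outer y y)"
      unfolding matrix_eq
    proof
      fix z
      have "(H' ** H') *v z = H' *v (H' *v z)" by (simp add: matrix_vector_mul_assoc)
      also have "\<dots> = H' *v ((e * b - A) *\<^sub>R (outer a1 a1 *v z) + k *\<^sub>R (outer a1 y *v z + outer y a1 *v z) + A *\<^sub>R z + (D / e) *\<^sub>R (outer y y *v z))"
        unfolding Hv[of z] outer_mult_vec by simp
      also have "\<dots> = ((e * b - A) *\<^sub>R (H' ** outer a1 a1) + k *\<^sub>R (H' ** outer a1 y + H' ** outer y a1) + A *\<^sub>R H' + (D / e) *\<^sub>R (H' ** outer y y)) *v z"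
        by (simp add: matrix_vector_right_distrib matrix_vector_mult_scaleR matrix_vector_mult_add_rdistrib
            matrix_vector_mul_assoc flip: scaleR_matrix_vector_assoc)
      finally show "(H' ** H') *v z = \<dots>" .
    qed
    then have "trace (H' ** H') = (e * b - A) * (a1 \<bullet> (H' *v a1)) + k * (y \<bullet> (H' *v a1) + a1 \<bullet> (H' *v y)) + A * trace H' + (D / e) * (y \<bullet> (H' *v y))"
      by (simp add: trace_add trs tro)
    also have "\<dots> = (e * b - A) * (e * b) + k * (k * (e * t) + k * (e * t)) + A * trace H' + (D / e) * ((A + D * t) * (e * t))"
      unfolding Ha Hy by (simp add: inner_add_right a1 ya yy)
    finally show ?thesis using e by (simp add: algebra_simps power2_eq_square)
  qed
  note gc = graph_curvatures_formulas[OF sym[unfolded H'_def], folded H'_def p_def, folded w_def]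
  have w1: "w \<ge> 1" by (simp add: w_def)
  have s2: "sigma2 (graph_curvatures u x) * w\<^sup>2 = 1"
  proof -
    define Z where "Z = (trace H')\<^sup>2 - trace (H' ** H')"
    define R where "R = A\<^sup>2 * (1 + e\<^sup>2 * a\<^sup>2 + e * t * A\<^sup>2)"
    have "w * Z - 2 * (trace H' * (p \<bullet> (H' *v p))) + 2 * (norm (H' *v p))\<^sup>2
       = 2 * (e * (b * (A + t * D) - t * k\<^sup>2))
         + 2 * (m * A * ((1 + e * t * A\<^sup>2) * (e * b) - 2 * e\<^sup>2 * a * t * A * k + (1 + e\<^sup>2 * a\<^sup>2) * (A + t * D)))
         + m * (m - 1) * R"
      unfolding Z_def R_def trHH tr pHp Hp2 w by (simp add: algebra_simps power2_eq_square)
    moreover have "m * (m - 1) / 2 * A\<^sup>2 * (1 + e\<^sup>2 * a\<^sup>2 + e * t * A\<^sup>2) = m * (m - 1) * R / 2" by (simp add: R_def)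
    moreover have "sigma2 (graph_curvatures u x) * w\<^sup>2 = w * Z / 2 - trace H' * (p \<bullet> (H' *v p)) + (norm (H' *v p))\<^sup>2"
      using gc(2) by (simp add: Z_def)
    ultimately show ?thesis using pde by linarith
  qed
  show sig2: "sigma2 (graph_curvatures u x) = (1 + (norm (grad u x))\<^sup>2) powi (-2)"
    using s2 w1 unfolding p_def[symmetric] w_def[symmetric]
    by (simp add: power_int_minus divide_simps)
  have "w * (trace H' - (p \<bullet> (H' *v p)) / w) = w * trace H' - p \<bullet> (H' *v p)"
    using w1 by (simp add: algebra_simps)
  also have "\<dots> = reduced_mean_curvature m e t a b A k D"
    unfolding reduced_mean_curvature_def tr pHp w by (simp add: algebra_simps power2_eq_square)
  finally have "w * (trace H' - (p \<bullet> (H' *v p)) / w) > 0" using pos by simp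
  then have "trace H' - (p \<bullet> (H' *v p)) / w > 0" using w1 by (simp add: zero_less_mult_iff)
  then have "sigma1 (graph_curvatures u x) > 0" using gc(1) w1 by simp
  moreover have "sigma2 (graph_curvatures u x) > 0"
    using s2 by (metis mult_nonpos_nonneg not_less zero_le_power2 zero_less_one)
  ultimately show "graph_curvatures u x \<in> Gamma2" by (simp add: Gamma2_def)
qed

section \<open>The counterexample\<close>

text \<open>The form is obtained by differentiating twice in the fixed direction \<open>w\<close>.
  It sees the transverse part w' through two numbers: the scaled inner product
  \<open>\<sigma>\<close> with x' and the scaled square \<open>N\<close>.\<close>

lemma quotient_hessian_form:
  fixes i0 :: "'n::finite" and w :: "real ^ 'n"
  assumes e: "e > 0" and v: "conv2 X T v" and x: "x \<in> axisym_region i0 e X T"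
  defines "F \<equiv> \<lambda>x. axisym i0 e v x * inverse (x $ i0)"
    and "\<xi> \<equiv> w $ i0" and "\<sigma> \<equiv> (\<Sum>i\<in>UNIV - {i0}. x $ i * w $ i) / e" and "N \<equiv> (\<Sum>i\<in>UNIV - {i0}. (w $ i)\<^sup>2) / e"
    and "z \<equiv> inverse (x $ i0)"
  shows "w \<bullet> (hessian F x *v w) = (axisym i0 e (ddx (ddx v)) x * \<xi>\<^sup>2 + 2 * (2 * axisym i0 e (ddt (ddx v)) x) * \<xi> * \<sigma>
      + (4 * axisym i0 e (ddt (ddt v)) x) * \<sigma>\<^sup>2 + (2 * axisym i0 e (ddt v) x) * N) * z
      - 2 * (axisym i0 e (ddx v) x * \<xi> + (2 * axisym i0 e (ddt v) x) * \<sigma>) * \<xi> * z\<^sup>2 + 2 * axisym i0 e v x * \<xi>\<^sup>2 * z ^ 3"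
proof -
  let ?R = "axisym_region i0 e X T"
  note cv = v conv2_ddx[OF v] conv2_ddt[OF v]
  have smF: "smooth_on F ?R"
    unfolding F_def by (intro axisym_smooth_imp_smooth_on e axisym_smooth.mult axisym_smooth.axisym axisym_smooth.inv v)
  define S where "S y h = (\<Sum>i\<in>UNIV - {i0}. 2 / e * y $ i * h $ i)" for y h :: "real ^ 'n"
  have nth: "((\<lambda>y. y $ i) has_derivative (\<lambda>h. h $ i)) (at y)" for i :: 'n and y
    by (rule bounded_linear_imp_has_derivative) (rule bounded_linear_vec_nth)
  have inv: "((\<lambda>y. inverse (y $ i0)) has_derivative (\<lambda>h. - (inverse (y $ i0) * h $ i0 * inverse (y $ i0)))) (at y)"
    if "y \<in> ?R" for y
    using that by (intro Deriv.has_derivative_inverse nth) (auto simp: axisym_region_def)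
  have ld: "(axisym i0 e a has_derivative (\<lambda>h. axisym i0 e (ddx a) y * h $ i0 + axisym i0 e (ddt a) y * S y h)) (at y)"
    if "conv2 X T a" "y \<in> ?R" for a y
    using axisym_has_derivative[OF that(1) e that(2)] by (simp add: S_def)
  define \<phi> where "\<phi> y = axisym i0 e v y * - (inverse (y $ i0) * w $ i0 * inverse (y $ i0))
      + (axisym i0 e (ddx v) y * w $ i0 + axisym i0 e (ddt v) y * S y w) * inverse (y $ i0)" for y
  have gF: "grad F y \<bullet> w = \<phi> y" if y: "y \<in> ?R" for y
  proof -
    have "(F has_derivative (\<lambda>h. axisym i0 e v y * - (inverse (y $ i0) * h $ i0 * inverse (y $ i0))
      + (axisym i0 e (ddx v) y * h $ i0 + axisym i0 e (ddt v) y * S y h) * inverse (y $ i0))) (at y)"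
      unfolding F_def by (rule has_derivative_mult[OF ld[OF v y] inv[OF y]])
    from has_derivative_unique[OF smooth_has_derivative[OF smF open_axisym_region y] this]
    show ?thesis by (simp add: \<phi>_def fun_eq_iff)
  qed
  have d1: "(\<phi> has_derivative (\<lambda>h. (hessian F x *v h) \<bullet> w)) (at x)"
  proof -
    have "((\<lambda>y. grad F y \<bullet> w) has_derivative (\<lambda>h. (hessian F x *v h) \<bullet> w)) (at x)"
      by (rule has_derivative_inner_left[OF smooth_grad_has_derivative[OF smF open_axisym_region x]])
    then show ?thesis
      by (rule has_derivative_transform_within_open[OF _ open_axisym_region x]) (rule gF)
  qed
  have dS: "((\<lambda>y. S y w) has_derivative (\<lambda>h. S h w)) (at x)"
    unfolding S_def by (intro has_derivative_sum has_derivative_mult_left has_derivative_mult_right nth)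
  define I where "I h = - (inverse (x $ i0) * h $ i0 * inverse (x $ i0))" for h :: "real ^ 'n"
  define L where "L a h = axisym i0 e (ddx a) x * h $ i0 + axisym i0 e (ddt a) x * S x h" for a h
  have inv': "((\<lambda>y. inverse (y $ i0)) has_derivative I) (at x)"
    unfolding I_def[abs_def] by (rule inv[OF x])
  have ld': "(axisym i0 e a has_derivative L a) (at x)" if "conv2 X T a" for a
    unfolding L_def[abs_def] by (rule ld[OF that x])
  have "(\<phi> has_derivative (\<lambda>h.
      axisym i0 e v x * - (inverse (x $ i0) * w $ i0 * I h + I h * w $ i0 * inverse (x $ i0))
       + L v h * - (inverse (x $ i0) * w $ i0 * inverse (x $ i0))
      + ((axisym i0 e (ddx v) x * w $ i0 + axisym i0 e (ddt v) x * S x w) * I h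
       + (L (ddx v) h * w $ i0 + (axisym i0 e (ddt v) x * S h w + L (ddt v) h * S x w)) * inverse (x $ i0)))) (at x)"
    unfolding \<phi>_def[abs_def]
    by (intro has_derivative_add has_derivative_mult has_derivative_minus has_derivative_mult_left ld' cv inv' dS)
  from has_derivative_unique[OF d1 this]
  have "(hessian F x *v w) \<bullet> w =
      axisym i0 e v x * - (inverse (x $ i0) * w $ i0 * I w + I w * w $ i0 * inverse (x $ i0))
       + L v w * - (inverse (x $ i0) * w $ i0 * inverse (x $ i0))
      + ((axisym i0 e (ddx v) x * w $ i0 + axisym i0 e (ddt v) x * S x w) * I w
       + (L (ddx v) w * w $ i0 + (axisym i0 e (ddt v) x * S w w + L (ddt v) w * S x w)) * inverse (x $ i0))"
    by (simp add: fun_eq_iff)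
  moreover have "S x w = 2 * \<sigma>" "S w w = 2 * N"
    by (simp_all add: S_def \<sigma>_def N_def sum_divide_distrib sum_distrib_left power2_eq_square mult_ac)
  moreover have "ddx (ddt v) = ddt (ddx v)" by (simp add: fun_eq_iff ddt_def ddx_def)
  ultimately show ?thesis
    by (simp add: I_def L_def inner_commute[of w] flip: \<xi>_def z_def)
      (simp add: algebra_simps power2_eq_square power3_eq_cube)
qed

text \<open>For the unperturbed profile the form equals c (2 \<xi>^2 + G z). Here 2 \<xi>^2 comes
  from the quadratic - (x - d) (1 - x), and G = |w' - (\<xi> / x) x'|^2 / e is the square in the
  Hessian of the perspective function r^2 / (2 x). It vanishes along rays through the origin, where
  2 \<xi>^2 takes over. The perturbation is at most 7 \<iota>^3 \<delta> (\<xi>^2 + N) and uses up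
  half of the resulting bound.\<close>

lemma quotient_form_lower_bound:
  fixes a b f k A D N c d t x \<delta> \<xi> \<sigma> :: real
  assumes d: "0 < d" "d \<le> 1/4" and x: "d / 2 < x" "x < 3/2" and t: "0 \<le> t" "t \<le> 1"
    and \<sigma>: "\<sigma>\<^sup>2 \<le> t * N" "0 \<le> N" and c: "c > 0"
    and near: "near_profile c d \<delta> x t f a b A k D"
  defines "\<iota> \<equiv> 2 / d" and "z \<equiv> inverse x"
  assumes \<delta>: "7 * \<iota> ^ 3 * \<delta> \<le> c / (8 * \<iota>\<^sup>2)"
  shows "c / (8 * \<iota>\<^sup>2) * (\<xi>\<^sup>2 + N) \<le> (b * \<xi>\<^sup>2 + 2 * k * \<xi> * \<sigma> + D * \<sigma>\<^sup>2 + A * N) * z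
    - 2 * (a * \<xi> + A * \<sigma>) * \<xi> * z\<^sup>2 + 2 * f * \<xi>\<^sup>2 * z ^ 3"
proof -
  have f: "\<bar>f - c * (t / 2 - x * (x - d) * (1 - x))\<bar> \<le> \<delta>"
    and a: "\<bar>a - c * (3 * x\<^sup>2 - 2 * (1 + d) * x + d)\<bar> \<le> \<delta>"
    and b: "\<bar>b - c * (6 * x - 2 * (1 + d))\<bar> \<le> \<delta>"
    and A: "\<bar>A - c\<bar> \<le> \<delta>" and D: "\<bar>A + t * D - c\<bar> \<le> \<delta>" and k: "t * k\<^sup>2 \<le> \<delta>\<^sup>2"
    using near by (simp_all add: near_profile_def)
  have x0: "x > 0" using d x by linarith
  have \<iota>: "\<iota> \<ge> 8" using d by (simp add: \<iota>_def field_simps)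
  have z: "0 < z" "2/3 \<le> z" "z \<le> \<iota>" using x0 x d by (auto simp: z_def \<iota>_def field_simps)
  have xz: "x * z = 1" using x0 by (simp add: z_def)
  have \<delta>0: "\<delta> \<ge> 0" using A by linarith
  define \<beta>1 where "\<beta>1 = b - c * (6 * x - 2 * (1 + d))"
  define \<beta>2 where "\<beta>2 = a - c * (3 * x\<^sup>2 - 2 * (1 + d) * x + d)"
  define \<beta>3 where "\<beta>3 = A - c"
  define \<beta>4 where "\<beta>4 = f - c * (t / 2 - x * (x - d) * (1 - x))"
  define G where "G = N - 2 * \<sigma> * \<xi> * z + t * \<xi>\<^sup>2 * z\<^sup>2"
  define R where "R = (\<beta>1 * \<xi>\<^sup>2 + 2 * k * \<xi> * \<sigma> + D * \<sigma>\<^sup>2 + \<beta>3 * N) * z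
    - 2 * (\<beta>2 * \<xi> + \<beta>3 * \<sigma>) * \<xi> * z\<^sup>2 + 2 * \<beta>4 * \<xi>\<^sup>2 * z ^ 3"
  have base: "(6 * x - 2 * (1 + d)) * z - 2 * (3 * x\<^sup>2 - 2 * (1 + d) * x + d) * z\<^sup>2 + 2 * (t / 2 - x * (x - d) * (1 - x)) * z ^ 3
      = 2 + t * z ^ 3"
    using x0 by (simp add: z_def divide_simps) (simp add: algebra_simps power2_eq_square power3_eq_cube)
  have split: "(b * \<xi>\<^sup>2 + 2 * k * \<xi> * \<sigma> + D * \<sigma>\<^sup>2 + A * N) * z
    - 2 * (a * \<xi> + A * \<sigma>) * \<xi> * z\<^sup>2 + 2 * f * \<xi>\<^sup>2 * z ^ 3 = c * (2 * \<xi>\<^sup>2 + G * z) + R"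
  proof -
    have "(b * \<xi>\<^sup>2 + 2 * k * \<xi> * \<sigma> + D * \<sigma>\<^sup>2 + A * N) * z
      - 2 * (a * \<xi> + A * \<sigma>) * \<xi> * z\<^sup>2 + 2 * f * \<xi>\<^sup>2 * z ^ 3 - R
      = c * (\<xi>\<^sup>2 * ((6 * x - 2 * (1 + d)) * z - 2 * (3 * x\<^sup>2 - 2 * (1 + d) * x + d) * z\<^sup>2 + 2 * (t / 2 - x * (x - d) * (1 - x)) * z ^ 3)
        + N * z - 2 * \<sigma> * \<xi> * z\<^sup>2)"
      unfolding R_def \<beta>1_def \<beta>2_def \<beta>3_def \<beta>4_def by algebra
    also have "\<dots> = c * (2 * \<xi>\<^sup>2 + G * z)"
      unfolding base G_def by (simp add: algebra_simps power2_eq_square power3_eq_cube)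
    finally show ?thesis by simp
  qed
  have \<iota>3: "z \<le> \<iota> ^ 3" "z\<^sup>2 \<le> \<iota> ^ 3" "z ^ 3 \<le> \<iota> ^ 3"
  proof -
    show "z ^ 3 \<le> \<iota> ^ 3" using z by (intro power_mono) auto
    have "z\<^sup>2 \<le> \<iota>\<^sup>2" using z by (intro power_mono) auto
    also have "\<dots> \<le> \<iota> ^ 3" using \<iota> by (intro power_increasing) auto
    finally show "z\<^sup>2 \<le> \<iota> ^ 3" .
    have "\<iota> ^ 1 \<le> \<iota> ^ 3" using \<iota> by (intro power_increasing) auto
    then show "z \<le> \<iota> ^ 3" using z by simp
  qed
  have \<sigma>N: "\<sigma>\<^sup>2 \<le> N" using \<sigma> t mult_left_le_one_le[of N t] by linarith
  have k\<sigma>: "\<bar>2 * k * \<xi> * \<sigma>\<bar> \<le> \<delta> * (\<xi>\<^sup>2 + N)"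
  proof -
    have "(k * \<sigma>)\<^sup>2 \<le> k\<^sup>2 * (t * N)" using \<sigma>(1) by (simp add: power_mult_distrib mult_left_mono)
    also have "\<dots> = (t * k\<^sup>2) * N" by simp
    also have "\<dots> \<le> \<delta>\<^sup>2 * N" by (rule mult_right_mono[OF k \<sigma>(2)])
    finally have "(k * \<sigma>)\<^sup>2 \<le> (\<delta> * sqrt N)\<^sup>2" using \<sigma>(2) by (simp add: power_mult_distrib)
    then have "\<bar>k * \<sigma>\<bar> \<le> \<bar>\<delta> * sqrt N\<bar>" by (rule abs_le_square_iff[THEN iffD2])
    then have ks: "\<bar>k * \<sigma>\<bar> \<le> \<delta> * sqrt N" using \<delta>0 \<sigma>(2) by simp
    have "2 * (\<bar>\<xi>\<bar> * sqrt N) \<le> \<xi>\<^sup>2 + N"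
      using zero_le_power2[of "\<bar>\<xi>\<bar> - sqrt N"] \<sigma>(2) by (simp add: power2_diff)
    then have "\<delta> * (2 * (\<bar>\<xi>\<bar> * sqrt N)) \<le> \<delta> * (\<xi>\<^sup>2 + N)" by (rule mult_left_mono[OF _ \<delta>0])
    moreover have "\<bar>2 * k * \<xi> * \<sigma>\<bar> = 2 * \<bar>\<xi>\<bar> * \<bar>k * \<sigma>\<bar>" by (simp add: abs_mult)
    moreover have "2 * \<bar>\<xi>\<bar> * \<bar>k * \<sigma>\<bar> \<le> 2 * \<bar>\<xi>\<bar> * (\<delta> * sqrt N)" by (rule mult_left_mono[OF ks]) simp
    ultimately show ?thesis by (simp add: mult_ac)
  qed
  \<comment> \<open>\<open>D\<close> alone is not bounded by \<open>near_profile\<close>. The factor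
    \<open>t\<close> in \<open>\<sigma>\<^sup>2 \<le> t * N\<close> rescues the term, as
    \<open>t * D\<close> is a difference of two quantities within \<open>\<delta>\<close> of
    \<open>c\<close>.\<close>
  have D\<sigma>: "\<bar>D * \<sigma>\<^sup>2\<bar> \<le> 2 * \<delta> * N"
  proof -
    have "\<bar>D * \<sigma>\<^sup>2\<bar> \<le> \<bar>D\<bar> * (t * N)" using \<sigma>(1) by (simp add: abs_mult mult_left_mono)
    also have "\<dots> = \<bar>t * D\<bar> * N" using t by (simp add: abs_mult)
    also have "\<dots> \<le> (2 * \<delta>) * N" using A D by (intro mult_right_mono \<sigma>(2)) linarith
    finally show ?thesis .
  qed
  have \<sigma>\<xi>: "\<bar>2 * \<sigma> * \<xi>\<bar> \<le> N + \<xi>\<^sup>2"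
    using \<sigma>N zero_le_power2[of "\<sigma> - \<xi>"] zero_le_power2[of "\<sigma> + \<xi>"] unfolding power2_diff power2_sum by linarith
  have \<xi>0: "\<xi>\<^sup>2 \<ge> 0" by simp
  have p1: "\<bar>\<beta>1 * \<xi>\<^sup>2\<bar> \<le> \<delta> * \<xi>\<^sup>2" "\<bar>\<beta>3 * N\<bar> \<le> \<delta> * N" "\<bar>\<beta>2 * \<xi>\<^sup>2\<bar> \<le> \<delta> * \<xi>\<^sup>2" "\<bar>\<beta>4 * \<xi>\<^sup>2\<bar> \<le> \<delta> * \<xi>\<^sup>2"
    using a b f A \<sigma>(2) unfolding \<beta>1_def \<beta>2_def \<beta>3_def \<beta>4_def by (auto simp: abs_mult intro!: mult_right_mono)
  have p2: "\<bar>\<beta>3 * (2 * \<sigma> * \<xi>)\<bar> \<le> \<delta> * (N + \<xi>\<^sup>2)"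
  proof -
    have "\<bar>\<beta>3\<bar> \<le> \<delta>" using A by (simp add: \<beta>3_def)
    then show ?thesis unfolding abs_mult[of \<beta>3] by (rule mult_mono) (use \<sigma>\<xi> \<delta>0 in auto)
  qed
  define P1 where "P1 = \<beta>1 * \<xi>\<^sup>2 + 2 * k * \<xi> * \<sigma> + D * \<sigma>\<^sup>2 + \<beta>3 * N"
  define P2 where "P2 = 2 * (\<beta>2 * \<xi>\<^sup>2) + \<beta>3 * (2 * \<sigma> * \<xi>)"
  define P3 where "P3 = 2 * (\<beta>4 * \<xi>\<^sup>2)"
  have "\<bar>P1\<bar> \<le> \<delta> * \<xi>\<^sup>2 + \<delta> * (\<xi>\<^sup>2 + N) + 2 * \<delta> * N + \<delta> * N"
    unfolding P1_def using p1 k\<sigma> D\<sigma> by linarith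
  then have P1: "\<bar>P1\<bar> \<le> \<delta> * (2 * \<xi>\<^sup>2 + 4 * N)" by (simp add: algebra_simps)
  have "\<bar>P2\<bar> \<le> 2 * (\<delta> * \<xi>\<^sup>2) + \<delta> * (N + \<xi>\<^sup>2)" unfolding P2_def using p1 p2 by linarith
  then have P2: "\<bar>P2\<bar> \<le> \<delta> * (3 * \<xi>\<^sup>2 + N)" by (simp add: algebra_simps)
  have P3: "\<bar>P3\<bar> \<le> \<delta> * (2 * \<xi>\<^sup>2)" unfolding P3_def using p1 by linarith
  have R: "R = P1 * z - P2 * z\<^sup>2 + P3 * z ^ 3"
    unfolding R_def P1_def P2_def P3_def by (simp add: algebra_simps power2_eq_square)
  have "\<bar>P1 * z\<bar> \<le> (\<delta> * (2 * \<xi>\<^sup>2 + 4 * N)) * \<iota> ^ 3" "\<bar>P2 * z\<^sup>2\<bar> \<le> (\<delta> * (3 * \<xi>\<^sup>2 + N)) * \<iota> ^ 3"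
    "\<bar>P3 * z ^ 3\<bar> \<le> (\<delta> * (2 * \<xi>\<^sup>2)) * \<iota> ^ 3"
    using P1 P2 P3 \<iota>3 z \<delta>0 \<sigma>(2) unfolding abs_mult by (auto intro!: mult_mono)
  then have "\<bar>R\<bar> \<le> (\<delta> * (2 * \<xi>\<^sup>2 + 4 * N)) * \<iota> ^ 3 + (\<delta> * (3 * \<xi>\<^sup>2 + N)) * \<iota> ^ 3 + (\<delta> * (2 * \<xi>\<^sup>2)) * \<iota> ^ 3"
    unfolding R by linarith
  also have "\<dots> = (\<iota> ^ 3 * \<delta>) * (7 * \<xi>\<^sup>2 + 5 * N)" by (simp add: algebra_simps)
  also have "\<dots> \<le> (\<iota> ^ 3 * \<delta>) * (7 * (\<xi>\<^sup>2 + N))" using \<iota> \<delta>0 \<sigma>(2) by (intro mult_left_mono) auto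
  also have "\<dots> = (7 * \<iota> ^ 3 * \<delta>) * (\<xi>\<^sup>2 + N)" by simp
  also have "\<dots> \<le> c / (8 * \<iota>\<^sup>2) * (\<xi>\<^sup>2 + N)" using \<sigma>(2) by (intro mult_right_mono \<delta>) auto
  finally have Rb: "\<bar>R\<bar> \<le> c / (8 * \<iota>\<^sup>2) * (\<xi>\<^sup>2 + N)" .
  define y where "y = \<xi> * z"
  \<comment> \<open>If \<open>G\<close> is small, then \<open>N\<close> is comparable to
    \<open>t * y\<^sup>2\<close>; this is Young's inequality 4 |\<sigma> y| <= N + 4 t y^2. The
    multiple of \<xi>^2 then pays for that part of \<open>N\<close>.\<close>
  have G1: "2 * G + 2 * (t * y\<^sup>2) \<ge> N"
  proof -
    have "\<bar>\<sigma>\<bar> \<le> sqrt (t * N)" using \<sigma>(1) by (simp add: real_le_rsqrt)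
    then have "\<bar>\<sigma> * y\<bar> \<le> sqrt (t * N) * \<bar>y\<bar>" unfolding abs_mult by (rule mult_right_mono) simp
    moreover have "0 \<le> (sqrt N - 2 * (sqrt t * \<bar>y\<bar>))\<^sup>2" by simp
    then have "4 * (sqrt (t * N) * \<bar>y\<bar>) \<le> N + 4 * (t * y\<^sup>2)"
      using \<sigma>(2) t by (simp add: power2_diff power_mult_distrib real_sqrt_mult mult_ac)
    moreover have "G = N - 2 * (\<sigma> * y) + t * y\<^sup>2" by (simp add: G_def y_def power_mult_distrib)
    ultimately show ?thesis by linarith
  qed
  have G0: "G \<ge> 0"
  proof -
    have "\<bar>\<sigma>\<bar> \<le> sqrt (t * N)" using \<sigma>(1) by (simp add: real_le_rsqrt)
    then have "\<bar>\<sigma> * y\<bar> \<le> sqrt (t * N) * \<bar>y\<bar>" unfolding abs_mult by (rule mult_right_mono) simp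
    moreover have "0 \<le> (sqrt N - sqrt t * \<bar>y\<bar>)\<^sup>2" by simp
    then have "2 * (sqrt (t * N) * \<bar>y\<bar>) \<le> N + t * y\<^sup>2"
      using \<sigma>(2) t by (simp add: power2_diff power_mult_distrib real_sqrt_mult mult_ac)
    moreover have "G = N - 2 * (\<sigma> * y) + t * y\<^sup>2" by (simp add: G_def y_def power_mult_distrib)
    ultimately show ?thesis by linarith
  qed
  have ty: "t * y\<^sup>2 \<le> \<iota>\<^sup>2 * \<xi>\<^sup>2"
  proof -
    have "t * y\<^sup>2 \<le> y\<^sup>2" using t by (simp add: mult_left_le_one_le)
    also have "y\<^sup>2 = \<xi>\<^sup>2 * z\<^sup>2" by (simp add: y_def power_mult_distrib)
    also have "\<dots> \<le> \<xi>\<^sup>2 * \<iota>\<^sup>2" using z by (intro mult_left_mono power_mono) auto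
    finally show ?thesis by (simp add: mult.commute)
  qed
  have i2: "\<iota>\<^sup>2 \<ge> 64" using power_mono[OF \<iota>, of 2] by simp
  have "2 * \<xi>\<^sup>2 + G * z \<ge> 1 / (4 * \<iota>\<^sup>2) * (\<xi>\<^sup>2 + N)"
  proof -
    have "N \<le> 2 * G + 2 * (\<iota>\<^sup>2 * \<xi>\<^sup>2)" using G1 ty by linarith
    then have "1 / (4 * \<iota>\<^sup>2) * N \<le> 1 / (4 * \<iota>\<^sup>2) * (2 * G + 2 * (\<iota>\<^sup>2 * \<xi>\<^sup>2))" by (rule mult_left_mono) simp
    also have "\<dots> = 1 / (2 * \<iota>\<^sup>2) * G + \<xi>\<^sup>2 / 2"
    proof -
      have "\<iota> \<noteq> 0" using \<iota> by auto
      then show ?thesis by (simp add: field_simps)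
    qed
    finally have 1: "1 / (4 * \<iota>\<^sup>2) * N \<le> 1 / (2 * \<iota>\<^sup>2) * G + \<xi>\<^sup>2 / 2" .
    have "1 / (2 * \<iota>\<^sup>2) \<le> 1 / 128" using i2 by (intro divide_left_mono) auto
    then have "1 / (2 * \<iota>\<^sup>2) \<le> z" using z(2) by linarith
    then have 2: "1 / (2 * \<iota>\<^sup>2) * G \<le> z * G" by (rule mult_right_mono[OF _ G0])
    have "1 / (4 * \<iota>\<^sup>2) \<le> 1 / 256" using i2 by (intro divide_left_mono) auto
    then have "1 / (4 * \<iota>\<^sup>2) \<le> 1" by linarith
    then have 3: "1 / (4 * \<iota>\<^sup>2) * \<xi>\<^sup>2 \<le> 1 * \<xi>\<^sup>2" by (rule mult_right_mono) simp
    show ?thesis using 1 2 3 \<xi>0 unfolding distrib_left mult.commute[of G z] by linarith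
  qed
  then have "c * (1 / (4 * \<iota>\<^sup>2) * (\<xi>\<^sup>2 + N)) \<le> c * (2 * \<xi>\<^sup>2 + G * z)" using c by (intro mult_left_mono) auto
  moreover have "c * (1 / (4 * \<iota>\<^sup>2) * (\<xi>\<^sup>2 + N)) = 2 * (c / (8 * \<iota>\<^sup>2) * (\<xi>\<^sup>2 + N))" by simp
  ultimately show ?thesis unfolding split using Rb by linarith
qed

text \<open>Two of the summands contribute at least c / 2 each. The possibly negative ones carry a
  factor \<open>e\<close> and amount to at most (117/4 + 18) e c, which is less than c for e <=
  1/60.\<close>

lemma mean_curvature_positive:
  fixes a b f k A D c d t x \<delta> e m :: real
  assumes d: "0 < d" "d \<le> 1/4" and x: "0 < x" "x < 3/2" and t: "0 \<le> t" "t \<le> 1"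
    and c: "0 < c" "c \<le> 1" and e: "0 < e" "e \<le> 1/60" and m: "m \<ge> 1" and \<delta>: "\<delta> \<le> c / 2"
    and near: "near_profile c d \<delta> x t f a b A k D"
  shows "0 < reduced_mean_curvature m e t a b A k D"
proof -
  have a: "\<bar>a - c * (3 * x\<^sup>2 - 2 * (1 + d) * x + d)\<bar> \<le> \<delta>"
    and b: "\<bar>b - c * (6 * x - 2 * (1 + d))\<bar> \<le> \<delta>"
    and A: "\<bar>A - c\<bar> \<le> \<delta>" and D: "\<bar>A + t * D - c\<bar> \<le> \<delta>" and k: "t * k\<^sup>2 \<le> \<delta>\<^sup>2"
    using near by (simp_all add: near_profile_def)
  have \<delta>0: "\<delta> \<ge> 0" using A by linarith
  have h: "A + t * D \<ge> c / 2" and A': "c / 2 \<le> A" "A \<le> 3 / 2 * c" using A D \<delta> by linarith+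
  have b': "\<bar>b\<bar> \<le> 9 * c"
  proof -
    have "\<bar>6 * x - 2 * (1 + d)\<bar> \<le> 8" using x d unfolding abs_le_iff by (auto simp: algebra_simps)
    then have "\<bar>c * (6 * x - 2 * (1 + d))\<bar> \<le> c * 8" using c unfolding abs_mult by (intro mult_mono) auto
    then show ?thesis using b \<delta> c by linarith
  qed
  have a': "\<bar>a\<bar> \<le> 12 * c"
  proof -
    have x2: "x\<^sup>2 \<le> 9/4" "x\<^sup>2 \<ge> 0" using power_mono[of x "3/2" 2] x by (auto simp: power2_eq_square)
    have ddx: "0 \<le> (1 + d) * x" "(1 + d) * x \<le> 5/4 * (3/2)"
      subgoal using x d by simp
      subgoal by (rule mult_mono) (use x d in auto)
      done
    have "\<bar>3 * x\<^sup>2 - 2 * (1 + d) * x + d\<bar> \<le> 11" using x2 ddx d unfolding abs_le_iff mult.assoc[of 2] by linarith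
    then have "\<bar>c * (3 * x\<^sup>2 - 2 * (1 + d) * x + d)\<bar> \<le> c * 11" using c unfolding abs_mult by (intro mult_mono) auto
    then show ?thesis using a \<delta> c by linarith
  qed
  have tk: "\<bar>t * k\<bar> \<le> c / 2"
  proof -
    have "(t * k)\<^sup>2 = t * (t * k\<^sup>2)" by (simp add: power2_eq_square)
    also have "\<dots> \<le> 1 * \<delta>\<^sup>2" using t k by (intro mult_mono) auto
    finally have "(t * k)\<^sup>2 \<le> \<delta>\<^sup>2" by simp
    then have "\<bar>t * k\<bar> \<le> \<bar>\<delta>\<bar>" by (rule abs_le_square_iff[THEN iffD2])
    then have "\<bar>t * k\<bar> \<le> \<delta>" using \<delta>0 by simp
    then show ?thesis using \<delta> by simp
  qed
  have A2: "A\<^sup>2 \<le> 9/4" using power_mono[of A "3/2" 2] A' c by (simp add: power2_eq_square)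
  have etA: "0 \<le> e * t * A\<^sup>2" "e * t * A\<^sup>2 \<le> 1 * 1 * (9/4)"
    subgoal using e t by simp
    subgoal by (intro mult_mono) (use e t A2 in auto)
    done
  have 1: "\<bar>(1 + e * t * A\<^sup>2) * (e * b)\<bar> \<le> (13/4) * (e * (9 * c))"
    using etA e b' c unfolding abs_mult by (intro mult_mono) auto
  have 2: "\<bar>2 * e\<^sup>2 * a * t * A * k\<bar> \<le> 18 * (e * c)"
  proof -
    have "\<bar>2 * e\<^sup>2 * a * t * A * k\<bar> = (2 * e\<^sup>2) * (\<bar>a\<bar> * (A * \<bar>t * k\<bar>))"
      using A' c by (simp add: abs_mult mult_ac)
    also have "\<dots> \<le> (2 * (e * 1)) * ((12 * c) * ((3/2) * (1/2)))"
    proof (intro mult_mono)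
      show "e\<^sup>2 \<le> e * 1" using e by (simp add: power2_eq_square)
      show "A \<le> 3 / 2" using A' c by linarith
      show "\<bar>t * k\<bar> \<le> 1/2" using tk c by linarith
      show "\<bar>a\<bar> \<le> 12 * c" by (rule a')
    qed (use e c A' in auto)
    finally show ?thesis by (simp add: mult_ac)
  qed
  have 3: "(1 + e\<^sup>2 * a\<^sup>2) * (A + t * D) \<ge> 1 * (c / 2)" using h c by (intro mult_mono) auto
  have 4: "m * A * (1 + e\<^sup>2 * a\<^sup>2 + e * t * A\<^sup>2) \<ge> (1 * (c / 2)) * 1"
    using m A' c etA by (intro mult_mono) (auto simp: add_nonneg_nonneg)
  have "e * c \<le> 1/60 * c" using e c by (intro mult_right_mono) auto
  then show ?thesis unfolding reduced_mean_curvature_def using 1 2 3 4 c by linarith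
qed

text \<open>The cubic q is at most 2 d^2 at 2 d and at least 1/16 at 1/2, so 2^\<gamma> d^(2
  \<gamma> - 1) < 16^(-\<gamma>) is enough; \<open>\<gamma> > 1/2\<close> makes the exponent of d
  positive. The factor \<open>d\<close> on the right is a lower bound for the weight of 1/2 in a
  convex combination representing 2 d.\<close>

lemma small_vertex_exists:
  fixes \<gamma> :: real
  assumes "\<gamma> > 1/2"
  shows "\<exists>d. 0 < d \<and> d \<le> 1/8 \<and> (2 * d * (2 * d - d) * (1 - 2 * d)) powr \<gamma> < d * (1/2 * (1/2 - d) * (1 - 1/2)) powr \<gamma>"
proof -
  \<comment> \<open>The power yields d^(2 \<gamma> - 1) <= 64^(-\<gamma>), and 2/64 < 1/16 leaves
    room for strictness.\<close>
  define d where "d = min (1/8) ((1/64) powr (\<gamma> / (2 * \<gamma> - 1)))"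
  have d: "0 < d" "d \<le> 1/8" "d \<le> (1/64) powr (\<gamma> / (2 * \<gamma> - 1))" by (auto simp: d_def)
  have "(2 * d * (2 * d - d) * (1 - 2 * d)) powr \<gamma> \<le> (2 * d\<^sup>2) powr \<gamma>"
    using d assms by (intro powr_mono2) (auto simp: power2_eq_square)
  also have "\<dots> = d * ((2 powr \<gamma>) * d powr (2 * \<gamma> - 1))"
  proof -
    have "d\<^sup>2 = d powr 2" using d(1) by simp
    then have "(d\<^sup>2) powr \<gamma> = d powr (2 * \<gamma>)" by (simp add: powr_powr)
    also have "\<dots> = d powr (1 + (2 * \<gamma> - 1))" by simp
    also have "\<dots> = d * d powr (2 * \<gamma> - 1)" using d(1) by (subst powr_add) simp
    finally show ?thesis by (simp add: powr_mult)
  qed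
  also have "\<dots> < d * (1/16) powr \<gamma>"
  proof -
    have "d powr (2 * \<gamma> - 1) \<le> ((1/64) powr (\<gamma> / (2 * \<gamma> - 1))) powr (2 * \<gamma> - 1)"
      using d assms by (intro powr_mono2) auto
    also have "\<dots> = (1/64) powr \<gamma>" using assms by (simp add: powr_powr)
    finally have "2 powr \<gamma> * d powr (2 * \<gamma> - 1) \<le> 2 powr \<gamma> * (1/64) powr \<gamma>" by (intro mult_left_mono) auto
    also have "\<dots> = (2 * (1/64)) powr \<gamma>" by (subst powr_mult) auto
    also have "\<dots> < (1/16) powr \<gamma>" using assms by (intro powr_less_mono2) auto
    finally show ?thesis using d(1) by simp
  qed
  also have "\<dots> \<le> d * (1/2 * (1/2 - d) * (1 - 1/2)) powr \<gamma>"
    using d assms by (intro mult_left_mono powr_mono2) auto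
  finally show ?thesis using d by blast
qed

lemma convex_perp_sq_ball:
  assumes "e > 0"
  shows "convex {x :: real ^ 'n::finite. perp_sq i0 e x < T}"
proof (rule convexI)
  fix x y :: "real ^ 'n" and a b :: real
  assume xy: "x \<in> {x. perp_sq i0 e x < T}" "y \<in> {x. perp_sq i0 e x < T}" and ab: "0 \<le> a" "0 \<le> b" "a + b = 1"
  have sq: "(a * p + b * q)\<^sup>2 \<le> a * p\<^sup>2 + b * q\<^sup>2" for p q :: real
  proof -
    have b: "b = 1 - a" using ab by simp
    have "a * p\<^sup>2 + b * q\<^sup>2 - (a * p + b * q)\<^sup>2 = a * b * (p - q)\<^sup>2"
      unfolding b by (simp add: algebra_simps power2_eq_square)
    then show ?thesis using ab by (smt (verit) mult_nonneg_nonneg zero_le_power2)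
  qed
  have "(\<Sum>i\<in>UNIV - {i0}. ((a *\<^sub>R x + b *\<^sub>R y) $ i)\<^sup>2) \<le> (\<Sum>i\<in>UNIV - {i0}. a * (x $ i)\<^sup>2 + b * (y $ i)\<^sup>2)"
    by (intro sum_mono) (simp add: sq)
  also have "\<dots> = a * (\<Sum>i\<in>UNIV - {i0}. (x $ i)\<^sup>2) + b * (\<Sum>i\<in>UNIV - {i0}. (y $ i)\<^sup>2)"
    by (simp add: sum.distrib sum_distrib_left)
  finally have "(\<Sum>i\<in>UNIV - {i0}. ((a *\<^sub>R x + b *\<^sub>R y) $ i)\<^sup>2) / e
      \<le> (a * (\<Sum>i\<in>UNIV - {i0}. (x $ i)\<^sup>2) + b * (\<Sum>i\<in>UNIV - {i0}. (y $ i)\<^sup>2)) / e"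
    using assms by (intro divide_right_mono) auto
  then have "perp_sq i0 e (a *\<^sub>R x + b *\<^sub>R y) \<le> a * perp_sq i0 e x + b * perp_sq i0 e y"
    by (simp add: perp_sq_def add_divide_distrib)
  also have "\<dots> < T"
  proof (cases "a = 0")
    case False
    then have "a * perp_sq i0 e x < a * T" using ab xy by simp
    moreover have "b * perp_sq i0 e y \<le> b * T" using ab xy by (intro mult_left_mono) auto
    ultimately have "a * perp_sq i0 e x + b * perp_sq i0 e y < (a + b) * T" by (simp add: distrib_right)
    then show ?thesis using ab by simp
  qed (use ab xy in auto)
  finally show "a *\<^sub>R x + b *\<^sub>R y \<in> {x. perp_sq i0 e x < T}" by simp
qed

lemma perp_sq_axis: "perp_sq i0 e (s *\<^sub>R axis i0 1) = 0"
  by (simp add: perp_sq_def axis_def)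

lemma inner_split: "x \<bullet> x = (x $ i0)\<^sup>2 + (\<Sum>i\<in>UNIV - {i0}. ((x :: real ^ 'n::finite) $ i)\<^sup>2)"
  unfolding inner_vec_def by (subst sum_split[of _ i0]) (simp add: power2_eq_square)

text \<open>The choices depend on each other in a fixed order: \<open>\<gamma>\<close> determines
  \<open>d\<close>, then \<open>d\<close> and the dimension determine the constant \<open>K\<close>
  and the tolerance \<open>\<eta>\<close>, and these determine \<open>e\<close>.\<close>

lemma exists_counterexample:
  fixes \<gamma> :: real
  assumes n: "CARD('n::finite) \<ge> 3" and \<gamma>: "\<gamma> > 1/2"
  shows "\<exists>(\<Omega> :: (real ^ 'n) set) u. bounded_smooth_domain \<Omega> \<and> uniformly_convex_domain \<Omega> \<and>
      admissible_solution \<Omega> u \<and> (\<forall>x\<in>\<Omega>. u x < 0) \<and> \<not> concave_on \<Omega> (\<lambda>x. (- u x) powr \<gamma>)"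
proof -
  obtain d where d: "0 < d" "d \<le> 1/8"
    and dg: "(2 * d * (2 * d - d) * (1 - 2 * d)) powr \<gamma> < d * (1/2 * (1/2 - d) * (1 - 1/2)) powr \<gamma>"
    using small_vertex_exists[OF \<gamma>] by blast
  define m where "m = CARD('n) - 2"
  have m: "m \<ge> 1" "real CARD('n) = real m + 2" using n by (simp_all add: m_def)
  define c where "c = sqrt (2 / (real m * (real m + 1)))"
  have mm: "real m * (real m + 1) \<ge> 1 * 2" using m by (intro mult_mono) auto
  have c: "0 < c" "c \<le> 1" using mm by (auto simp: c_def)
  define \<iota> where "\<iota> = 2 / d"
  have \<iota>: "\<iota> > 0" using d by (simp add: \<iota>_def)
  obtain e0 K where e0: "0 < e0" "e0 \<le> 1" "K \<ge> 0"
    and prof0: "\<forall>e. 0 < e \<and> e \<le> e0 \<longrightarrow> (\<exists>V Vx Vxx A Vrr Vxr. series_profile m c d e (e * K) V Vx Vxx A Vrr Vxr)"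
    using exists_profile_solution[OF m(1), of d, folded c_def] by (elim exE conjE) (rule that; assumption)
  have prof: "\<exists>v. axisym_profile m c d e (e * K) v" if "0 < e" "e \<le> e0" for e
    using prof0 that axisym_profile_of_series by metis
  \<comment> \<open>Three tolerances: for convexity of \<open>F\<close>, for positive mean
    curvature, and for confining \<open>\<Omega>\<close> to a compact part of
    \<open>B\<close>.\<close>
  define \<eta> where "\<eta> = Min {c / (8 * \<iota>\<^sup>2) / (7 * \<iota> ^ 3), c / 2, c * (d\<^sup>2 / 64)}"
  have \<eta>: "0 < \<eta>" "\<eta> \<le> c / (8 * \<iota>\<^sup>2) / (7 * \<iota> ^ 3)" "\<eta> \<le> c / 2" "\<eta> \<le> c * (d\<^sup>2 / 64)"
    using c d \<iota> unfolding \<eta>_def by (auto simp: Min_le_iff)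
  \<comment> \<open>The last entry gives \<open>e * K \<le> \<eta>\<close>; the denominator
    \<open>K + 1\<close> is positive even if \<open>K = 0\<close>.\<close>
  define e where "e = min e0 (min (1/60) (\<eta> / (K + 1)))"
  have e: "0 < e" "e \<le> e0" "e \<le> 1/60" "e \<le> \<eta> / (K + 1)"
  proof -
    show "0 < e" using e0 \<eta>(1) by (simp add: e_def)
    show "e \<le> e0" unfolding e_def by (rule min.cobounded1)
    show "e \<le> 1/60" unfolding e_def by (intro min.coboundedI2 min.cobounded1)
    show "e \<le> \<eta> / (K + 1)" unfolding e_def by (intro min.coboundedI2 min.cobounded2)
  qed
  define \<delta> where "\<delta> = e * K"
  have \<delta>: "0 \<le> \<delta>" "\<delta> \<le> \<eta>"
  proof -
    have "e * K \<le> \<eta> / (K + 1) * (K + 1)" using e e0 by (intro mult_mono) auto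
    then show "0 \<le> \<delta>" "\<delta> \<le> \<eta>" using e e0 by (auto simp: \<delta>_def)
  qed
  have \<delta>1: "7 * \<iota> ^ 3 * \<delta> \<le> c / (8 * \<iota>\<^sup>2)"
  proof -
    have "7 * \<iota> ^ 3 * \<delta> \<le> 7 * \<iota> ^ 3 * (c / (8 * \<iota>\<^sup>2) / (7 * \<iota> ^ 3))" using \<delta>(2) \<eta>(2) \<iota> by (intro mult_left_mono) auto
    also have "\<dots> = c / (8 * \<iota>\<^sup>2)" 
    proof -
      have "7 * \<iota> ^ 3 \<noteq> 0" using \<iota> by simp
      then show ?thesis by (metis mult.commute nonzero_eq_divide_eq)
    qed
    finally show ?thesis .
  qed
  obtain v where prof_v: "axisym_profile m c d e \<delta> v" using prof[OF e(1,2)] by (auto simp: \<delta>_def)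
  then have v: "conv2 (7/4) (25/16) v"
    and axis: "\<And>x. 0 \<le> x \<Longrightarrow> x \<le> 7/4 \<Longrightarrow> pow2 v x 0 = - c * (x * (x - d) * (1 - x))"
    by (simp_all add: axisym_profile_def)
  \<comment> \<open>An arbitrary coordinate serves as the axis.\<close>
  define i0 :: 'n where "i0 = undefined"
  define R where "R = axisym_region i0 e (7/4) (25/16)"
  define f where "f = axisym i0 e v"
  define u where "u x = e * f x" for x
  define F where "F x = f x * inverse (x $ i0)" for x
  \<comment> \<open>A convex box within the region of convergence. Its face at \<open>d / 2\<close>
    lies beyond the tip at \<open>d\<close> and still keeps 1 / x below 2 / d.\<close>
  define B where "B = {x :: real ^ 'n. d / 2 < x $ i0 \<and> x $ i0 < 3 / 2 \<and> perp_sq i0 e x < 1}"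
  have BR: "B \<subseteq> R" using d by (auto simp: B_def R_def axisym_region_def)
  have tQ: "0 \<le> perp_sq i0 e x" for x by (rule perp_sq_nonneg[OF e(1)])
  let ?t = "perp_sq i0 e" and ?vx = "axisym i0 e (ddx v)" and ?vxx = "axisym i0 e (ddx (ddx v))"
    and ?vt = "axisym i0 e (ddt v)" and ?vxt = "axisym i0 e (ddt (ddx v))" and ?vtt = "axisym i0 e (ddt (ddt v))"
  have at: "near_profile c d \<delta> (x $ i0) (?t x) (f x) (?vx x) (?vxx x) (2 * ?vt x) (2 * ?vxt x) (4 * ?vtt x)"
    "reduced_equation (real m) e (?vx x) (?vxx x) (2 * ?vt x) (sqrt (?t x) * (2 * ?vt x)) (sqrt (?t x) * (2 * ?vxt x))
      (2 * ?vt x + ?t x * (4 * ?vtt x))" if "x \<in> R" for x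
    using prof_v that tQ[of x] unfolding axisym_profile_def
    by (simp_all add: R_def axisym_region_def axisym_def f_def)
  have smF: "smooth_on F B"
    unfolding F_def[abs_def] f_def
    by (rule smooth_on_subset[OF axisym_smooth_imp_smooth_on[OF e(1)] BR[unfolded R_def]])
      (intro axisym_smooth.mult axisym_smooth.axisym axisym_smooth.inv v)
  have smu: "smooth_on u R"
    unfolding u_def[abs_def] f_def R_def
    by (rule axisym_smooth_imp_smooth_on[OF e(1)]) (intro axisym_smooth.mult axisym_smooth.axisym axisym_smooth.const v)
  have opB: "open B"
    unfolding B_def by (intro open_Collect_conj open_Collect_less continuous_intros continuous_perp_sq)
  have cvB: "convex B"
  proof -
    have "convex {x :: real ^ 'n. d / 2 < x $ i0}" "convex {x :: real ^ 'n. x $ i0 < 3/2}"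
      using convex_halfspace_gt[of "d/2" "axis i0 (1::real)"] convex_halfspace_lt[of "axis i0 (1::real)" "3/2"]
      by (simp_all add: inner_axis')
    moreover have "B = {x. d / 2 < x $ i0} \<inter> {x. x $ i0 < 3/2} \<inter> {x. perp_sq i0 e x < 1}" by (auto simp: B_def)
    ultimately show ?thesis using convex_perp_sq_ball[OF e(1)] by (auto intro!: convex_Int)
  qed
  have sumQ: "(\<Sum>i\<in>UNIV - {i0}. (x $ i)\<^sup>2) = e * perp_sq i0 e x" for x :: "real ^ 'n"
    using e by (simp add: perp_sq_def)
  have bdB: "bounded B"
  proof (rule boundedI)
    fix x assume "x \<in> B"
    then have x: "0 < x $ i0" "x $ i0 < 3/2" "perp_sq i0 e x < 1" using d by (auto simp: B_def)
    have "(x $ i0)\<^sup>2 \<le> (3/2)\<^sup>2" using x by (intro power_mono) auto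
    moreover have "e * perp_sq i0 e x \<le> 1 * 1" using x e tQ[of x] by (intro mult_mono) auto
    ultimately have "x \<bullet> x \<le> 2\<^sup>2" unfolding inner_split[of x i0] sumQ by (simp add: power2_eq_square)
    then show "norm x \<le> 2" by (simp add: norm_le_square)
  qed
  define \<theta> where "\<theta> = c / (8 * \<iota>\<^sup>2)"
  have \<theta>: "\<theta> > 0" using c \<iota> by (simp add: \<theta>_def)
  have hess: "\<theta> * (w \<bullet> w) \<le> w \<bullet> (hessian F x *v w)" if x: "x \<in> B" for x w
  proof -
    have xR: "x \<in> R" using x BR by blast
    define \<sigma> where "\<sigma> = (\<Sum>i\<in>UNIV - {i0}. x $ i * w $ i) / e"
    define N where "N = (\<Sum>i\<in>UNIV - {i0}. (w $ i)\<^sup>2) / e"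
    have N0: "N \<ge> 0" using e by (simp add: N_def sum_nonneg)
    have \<sigma>: "\<sigma>\<^sup>2 \<le> perp_sq i0 e x * N"
      using Cauchy_Schwarz_ineq_sum[of "\<lambda>i. x $ i" "\<lambda>i. w $ i" "UNIV - {i0}"] e
      by (simp add: \<sigma>_def N_def perp_sq_def power_divide power2_eq_square divide_right_mono)
    have "w \<bullet> w \<le> (w $ i0)\<^sup>2 + N"
    proof -
      have "(\<Sum>i\<in>UNIV - {i0}. (w $ i)\<^sup>2) = e * N" using e by (simp add: N_def)
      also have "\<dots> \<le> 1 * N" using e N0 by (intro mult_right_mono) auto
      finally show ?thesis unfolding inner_split[of w i0] by simp
    qed
    then have "\<theta> * (w \<bullet> w) \<le> \<theta> * ((w $ i0)\<^sup>2 + N)" using \<theta> by (intro mult_left_mono) auto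
    also have "\<dots> \<le> w \<bullet> (hessian F x *v w)"
      unfolding F_def[abs_def] f_def quotient_hessian_form[OF e(1) v xR[unfolded R_def]]
      unfolding \<sigma>_def[symmetric] N_def[symmetric] \<theta>_def \<iota>_def
      by (rule quotient_form_lower_bound[where t = "perp_sq i0 e x" and \<delta> = \<delta>,
            OF d(1) _ _ _ tQ _ \<sigma> N0 c(1) at(1)[OF xR, unfolded f_def] \<delta>1[unfolded \<iota>_def]])
        (use x d in \<open>auto simp: B_def\<close>)
    finally show ?thesis .
  qed
  \<comment> \<open>On \<open>B\<close> the axial coordinate is positive, so \<open>F\<close> and
    \<open>u\<close> have the same sign: this is the set where \<open>u\<close> is negative,
    described by the function that is convex.\<close>
  define \<Omega> where "\<Omega> = {x \<in> B. F x < 0}"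
  have Fneg: "F x < 0 \<longleftrightarrow> f x < 0" if "x \<in> B" for x
    using that d by (auto simp: F_def B_def mult_less_0_iff zero_less_mult_iff)
  \<comment> \<open>Where one of the three bounds fails, the unperturbed t / 2 - q is at least d^2 /
    16, 1/4 or 1/8 respectively, more than the tolerance d^2 / 64. Hence the zero set cannot
    approach the faces of \<open>B\<close>.\<close>
  have core: "3 / 4 * d \<le> x $ i0 \<and> x $ i0 \<le> 5 / 4 \<and> perp_sq i0 e x \<le> 3 / 4" if x: "x \<in> \<Omega>" for x
  proof -
    define s where "s = x $ i0"
    define t where "t = perp_sq i0 e x"
    have xB: "x \<in> B" and f0: "f x < 0" using x Fneg by (auto simp: \<Omega>_def)
    have s: "d / 2 < s" "s < 3/2" using xB by (auto simp: B_def s_def)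
    have "c * (t / 2 - s * (s - d) * (1 - s)) < \<delta>" 
    proof -
      have "x \<in> R" using xB BR by blast
      from at(1)[OF this] have "\<bar>f x - c * (t / 2 - s * (s - d) * (1 - s))\<bar> \<le> \<delta>"
        unfolding near_profile_def s_def[symmetric] t_def[symmetric] by (elim conjE)
      then show ?thesis using f0 by linarith
    qed
    also have "\<dots> \<le> c * (d\<^sup>2 / 64)" using \<delta>(2) \<eta>(4) by simp
    finally have key: "t / 2 - s * (s - d) * (1 - s) < d\<^sup>2 / 64" using c(1) by simp
    have t0: "t \<ge> 0" using tQ by (simp add: t_def)
    have d2: "d\<^sup>2 \<le> 1/64" using power_mono[of d "1/8" 2] d by (simp add: power2_eq_square)
    have "3 / 4 * d \<le> s"
    proof (rule ccontr)
      assume "\<not> 3 / 4 * d \<le> s"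
      then have h: "s < 3 / 4 * d" by simp
      have "(d / 2) * (d / 4) * (1/2) \<le> s * (d - s) * (1 - s)"
        using s h d by (intro mult_mono) auto
      then have "- (s * (s - d) * (1 - s)) \<ge> d\<^sup>2 / 16" by (simp add: algebra_simps power2_eq_square)
      moreover have "d\<^sup>2 > 0" using d by simp
      ultimately show False using key t0 by linarith
    qed
    moreover have "s \<le> 5/4"
    proof (rule ccontr)
      assume "\<not> s \<le> 5/4"
      then have "1 * 1 * (1/4) \<le> s * (s - d) * (s - 1)" using d by (intro mult_mono) auto
      then have "- (s * (s - d) * (1 - s)) \<ge> 1/4" by (simp add: algebra_simps)
      then show False using key t0 d2 by linarith
    qed
    moreover have "t \<le> 3/4"
    proof -
      have "s * (s - d) * (1 - s) \<le> 1/4"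
      proof (cases "d \<le> s \<and> s \<le> 1")
        case True
        have "s * (s - d) * (1 - s) = (s - d) * (s * (1 - s))" by simp
        also have "\<dots> \<le> 1 * (1/4)"
        proof (rule mult_mono)
          show "s * (1 - s) \<le> 1/4" using zero_le_power2[of "s - 1/2"] by (simp add: power2_diff power2_eq_square algebra_simps)
        qed (use True d in auto)
        finally show ?thesis by simp
      next
        case False
        then have "s * (s - d) * (1 - s) \<le> 0"
          using s d by (auto simp: mult_le_0_iff zero_le_mult_iff)
        then show ?thesis by simp
      qed
      then show ?thesis using key d2 by linarith
    qed
    ultimately show ?thesis by (simp add: s_def t_def)
  qed
  have cl: "closure \<Omega> \<subseteq> B"
  proof -
    have "closed {x :: real ^ 'n. 3 / 4 * d \<le> x $ i0 \<and> x $ i0 \<le> 5 / 4 \<and> perp_sq i0 e x \<le> 3 / 4}"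
      by (intro closed_Collect_conj closed_Collect_le continuous_intros continuous_perp_sq)
    then have "closure \<Omega> \<subseteq> {x. 3 / 4 * d \<le> x $ i0 \<and> x $ i0 \<le> 5 / 4 \<and> perp_sq i0 e x \<le> 3 / 4}"
      using core by (intro closure_minimal) auto
    then show ?thesis using d by (auto simp: B_def)
  qed
  define pt where "pt s = s *\<^sub>R axis i0 (1::real)" for s
  have upt: "u (pt s) = - (e * c) * (s * (s - d) * (1 - s))" if "0 < s" "s < 3/2" for s
    using axis[of s] that by (simp add: u_def f_def axisym_def pt_def perp_sq_axis)
  have ptO: "pt s \<in> \<Omega>" if s: "d < s" "s < 1" for s
  proof -
    have B: "pt s \<in> B" using s d by (simp add: B_def pt_def perp_sq_axis)
    have "f (pt s) = - c * (s * (s - d) * (1 - s))"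
      using axis[of s] s d by (simp add: f_def axisym_def pt_def perp_sq_axis)
    moreover have "c * (s * (s - d) * (1 - s)) > 0" using s d c by simp
    ultimately show ?thesis using Fneg[OF B] B by (simp add: \<Omega>_def)
  qed
  have half: "pt (1/2) \<in> \<Omega>" using d by (intro ptO) auto
  note dom = sublevel_domain[OF smF opB cvB bdB \<theta> hess cl[unfolded \<Omega>_def], folded \<Omega>_def]
  have z: "pt (1/2) \<in> B" "F (pt (1/2)) < 0" using half by (auto simp: \<Omega>_def)
  note dom = dom(1)[OF _ z] dom(2)[OF _ z] dom(3)[OF _ z] dom(4)[OF _ z]
  have OR: "\<Omega> \<subseteq> R" using BR by (auto simp: \<Omega>_def)
  have opR: "open R" unfolding R_def by (rule open_axisym_region)
  have neg: "u x < 0" if "x \<in> \<Omega>" for x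
    using that Fneg e(1) by (auto simp: \<Omega>_def u_def mult_less_0_iff)
  have sol: "sigma2 (graph_curvatures u x) = (1 + (norm (grad u x))\<^sup>2) powi (-2)" "graph_curvatures u x \<in> Gamma2"
    if x: "x \<in> \<Omega>" for x
  proof -
    have xR: "x \<in> R" and xB: "x \<in> B" using x OR by (auto simp: \<Omega>_def)
    define y where "y = (\<chi> i. if i = i0 then 0 else x $ i)"
    define a1 where "a1 = axis i0 (1::real)"
    have a1: "a1 \<bullet> a1 = 1" "a1 \<bullet> y = 0" by (simp_all add: a1_def y_def inner_axis inner_axis')
    have yy: "y \<bullet> y = e * perp_sq i0 e x"
      unfolding inner_split[of y i0] sumQ[symmetric] by (simp add: y_def)
    note gh = grad_hessian_axisym[OF e(1) v xR[unfolded R_def], folded y_def a1_def f_def, folded u_def[abs_def]]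
    have pos: "0 < reduced_mean_curvature (real m) e (?t x) (?vx x) (?vxx x) (2 * ?vt x) (2 * ?vxt x) (4 * ?vtt x)"
      by (rule mean_curvature_positive[where \<delta> = \<delta>, OF d(1) _ _ _ tQ _ c e(1,3) _ _ at(1)[OF xR]])
        (use xB d m(1) \<delta>(2) \<eta>(3) in \<open>auto simp: B_def\<close>)
    show "sigma2 (graph_curvatures u x) = (1 + (norm (grad u x))\<^sup>2) powi (-2)" "graph_curvatures u x \<in> Gamma2"
      by (rule axisymmetric_sigma[OF e(1) a1 yy m(2) gh tQ at(2)[OF xR] pos])+
  qed
  have "admissible_solution \<Omega> u"
    unfolding admissible_solution_def Gamma2_admissible_def
  proof (intro conjI ballI sol)
    show "smooth_on u \<Omega>" by (rule smooth_on_subset[OF smu OR])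
    have "continuous_on R u"
      using smooth_has_derivative[OF smu opR] by (meson continuous_at_imp_continuous_on has_derivative_continuous)
    then show "continuous_on (closure \<Omega>) u" using cl BR by (meson continuous_on_subset subset_trans)
    fix x assume "x \<in> frontier \<Omega>"
    then have "x \<in> B" "F x = 0" using dom(3) by auto
    then show "u x = 0" using d by (auto simp: F_def u_def B_def)
  qed
  moreover have "\<not> concave_on \<Omega> (\<lambda>x. (- u x) powr \<gamma>)"
  proof
    assume conc: "concave_on \<Omega> (\<lambda>x. (- u x) powr \<gamma>)"
    \<comment> \<open>The weight of 1/2 when 2 d is written as a convex combination of 3 d / 2 and
      1/2. It is at least d, and the contribution of 3 d / 2 may be dropped by its sign.\<close>
    define \<tau> where "\<tau> = d / (1 - 3 * d)"
    have \<tau>: "d \<le> \<tau>" "0 \<le> \<tau>" "\<tau> \<le> 1" using d by (auto simp: \<tau>_def field_simps)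
    have mid: "(1 - \<tau>) *\<^sub>R pt (3 / 2 * d) + \<tau> *\<^sub>R pt (1/2) = pt (2 * d)"
    proof -
      have "\<tau> * (1 - 3 * d) = d" using d by (simp add: \<tau>_def)
      moreover have "(1 - \<tau>) * (3 / 2 * d) + \<tau> * (1/2) = 3 / 2 * d + \<tau> * (1 - 3 * d) / 2"
        by (simp add: field_simps)
      ultimately have "(1 - \<tau>) * (3 / 2 * d) + \<tau> * (1/2) = 2 * d" by simp
      then show ?thesis by (simp add: pt_def flip: scaleR_add_left)
    qed
    have "(- u (pt (2 * d))) powr \<gamma> \<ge> (1 - \<tau>) * (- u (pt (3 / 2 * d))) powr \<gamma> + \<tau> * (- u (pt (1/2))) powr \<gamma>"
    proof -
      have p: "pt (3 / 2 * d) \<in> \<Omega>" using d by (intro ptO) auto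
      have "convex_on \<Omega> (\<lambda>x. - ((- u x) powr \<gamma>))" using conc by (simp add: concave_on_def)
      from convex_onD[OF this \<tau>(2,3) p half] show ?thesis unfolding mid by simp
    qed
    moreover have "(1 - \<tau>) * (- u (pt (3 / 2 * d))) powr \<gamma> \<ge> 0" using \<tau> by simp
    moreover have "\<tau> * (- u (pt (1/2))) powr \<gamma> \<ge> d * (- u (pt (1/2))) powr \<gamma>" using \<tau> by (intro mult_right_mono) auto
    ultimately have le: "d * (- u (pt (1/2))) powr \<gamma> \<le> (- u (pt (2 * d))) powr \<gamma>" by linarith
    have pw: "(- u (pt s)) powr \<gamma> = (e * c) powr \<gamma> * (s * (s - d) * (1 - s)) powr \<gamma>" if "d < s" "s < 1" for s
      using upt[of s] that d e c by (simp add: powr_mult)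
    have "d * ((e * c) powr \<gamma> * (1/2 * (1/2 - d) * (1 - 1/2)) powr \<gamma>) \<le> (e * c) powr \<gamma> * (2 * d * (2 * d - d) * (1 - 2 * d)) powr \<gamma>"
      using le d by (subst (asm) pw, simp, simp, subst (asm) pw) simp_all
    then have "(e * c) powr \<gamma> * (d * (1/2 * (1/2 - d) * (1 - 1/2)) powr \<gamma>) \<le> (e * c) powr \<gamma> * (2 * d * (2 * d - d) * (1 - 2 * d)) powr \<gamma>"
      by (simp only: mult.left_commute)
    moreover have "(e * c) powr \<gamma> > 0" using e c by simp
    ultimately have "d * (1/2 * (1/2 - d) * (1 - 1/2)) powr \<gamma> \<le> (2 * d * (2 * d - d) * (1 - 2 * d)) powr \<gamma>"
      by (rule mult_left_le_imp_le)
    then show False using dg by linarith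
  qed
  ultimately show ?thesis using dom(1,2) neg by blast
qed

theorem theorem4p1:
  assumes "CARD('n::finite) \<ge> 3"
  shows "(\<forall>\<gamma>>1/2. \<exists>(\<Omega> :: (real ^ 'n) set) u.
            bounded_smooth_domain \<Omega> \<and> uniformly_convex_domain \<Omega> \<and>
            admissible_solution \<Omega> u \<and> (\<forall>x\<in>\<Omega>. u x < 0) \<and>
            \<not> concave_on \<Omega> (\<lambda>x. (- u x) powr \<gamma>)) \<and>
         (\<forall>\<gamma>>1/2. \<not> universal_power_concavity_exponent TYPE('n) \<gamma>)"
  using exists_counterexample[OF assms] unfolding universal_power_concavity_exponent_def by blast

end
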